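(* Let $n\ge1$, $s\in(0,1)$, let $W\subset\mathbb R^n$ be an unbounded open set and let $\Omega\subset W_e$ be a bounded, open and smooth set. Assume that $u\in\widetilde H^s(\Omega)$, that $\|(-\Delta)^su\|_{L^2(\Omega)}<\infty$, and that $((-\Delta)^su+\Psi u)|_W=0$, where $\Psi\in B(H^s,H^{-s})$ is quasilocal with a decay function $\mu$ satisfying $$\lim_{r\to\infty}c_M(r)\,|\log\mu(r)|^{-\sigma_M(r)}=0$$ for some $M\ge0$. Then $u\equiv0$.
   Context: $H^r=H^r(\mathbb R^n)$ is the $L^2$-based Sobolev space; for open $U$, $\widetilde H^r(U)$ is the closure of $C^\infty_c(U)$ in $H^r$, $H^r(U)=\{u|_U:u\in H^r\}$ with quotient norm. $(-\Delta)^s u=\mathcal F^{-1}(|\xi|^{2s}\hat u)$. For $A\subset\mathbb R^n$, $r\ge0$: $N(A,r)=\{x:\mathrm{dist}(x,A)\le r\}$ and $A_e=\mathbb R^n\setminus\overline A$. $\Psi\in B(H^s,H^{-s})$ (bounded linear) is quasilocal with decay function $\mu:(0,\infty)\to[0,\infty)$, $\lim_{r\to\infty}\mu(r)=0$, if $\|\Psi u\|_{H^{-s}(N(\mathrm{spt}\,u,r)_e)}\le\mu(r)\|u\|_{H^s}$ for all $u\in H^s$, $r>0$. For $r>0$ let $W_r:=W\cap N(\Omega,r)_e$ (non-empty, open, contained in $\Omega_e$). For $M\ge0$, $c_M(r),\sigma_M(r)>0$ denote the constants (depending on $\Omega,W_r,n,s,M$) provided by the paper's logarithmic estimate: for every $\Phi\in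 B(L^2(\Omega),L^2(\Omega))$ with norm $\le M$ such that $(-\Delta)^sw+\Phi w=0$ in $\Omega$, $w|_{\Omega_e}=0$, $w\in H^s$ implies $w=0$, and every $v\in L^2(\Omega)$ with $\|v\|_{L^2(\Omega)}=1$, one has $\|v\|_{H^{-s}(\Omega)}\le c_M(r)|\log\|(-\Delta)^sw\|_{H^{-s}(W_r)}|^{-\sigma_M(r)}$, where $w\in H^s$ solves $(-\Delta)^sw+\Phi w=v$ in $\Omega$, $w|_{\Omega_e}=0$. *)

theory Defs
  imports "HOL-Analysis.Analysis"
begin

coinductive smooth_fn :: "('a::euclidean_space \<Rightarrow> 'b::real_normed_vector) \<Rightarrow> bool" where
  "continuous_on UNIV f \<Longrightarrow>
   (\<forall>i\<in>Basis. \<exists>g. (\<forall>x. ((\<lambda>t::real. f (x + t *\<^sub>R i)) has_vector_derivative g x) (at 0))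
                    \<and> smooth_fn g) \<Longrightarrow> smooth_fn f"

definition csupp :: "('a::real_normed_vector \<Rightarrow> complex) \<Rightarrow> 'a set" where
  "csupp \<phi> = closure {x. \<phi> x \<noteq> 0}"

definition test_fn :: "'a::euclidean_space set \<Rightarrow> ('a \<Rightarrow> complex) \<Rightarrow> bool" where
  "test_fn U \<phi> \<longleftrightarrow> smooth_fn \<phi> \<and> compact (csupp \<phi>) \<and> csupp \<phi> \<subseteq> U"

definition smooth_boundary :: "'a::euclidean_space set \<Rightarrow> bool" where
  "smooth_boundary \<Omega> \<longleftrightarrow>
     (\<forall>x\<in>frontier \<Omega>. \<exists>r>0. \<exists>\<rho>::'a \<Rightarrow> real. smooth_fn \<rho> \<and>
        (\<forall>y\<in>ball x r. \<exists>D. (\<rho> has_derivative D) (at y) \<and> D \<noteq> (\<lambda>_. 0)) \<and>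
        \<Omega> \<inter> ball x r = {y\<in>ball x r. \<rho> y < 0})"

definition fourier :: "('a::euclidean_space \<Rightarrow> complex) \<Rightarrow> 'a \<Rightarrow> complex" where
  "fourier f \<xi> = integral\<^sup>L lborel (\<lambda>x. cis (- (x \<bullet> \<xi>)) * f x)"

definition L2fun :: "('a::euclidean_space \<Rightarrow> complex) \<Rightarrow> bool" where
  "L2fun f \<longleftrightarrow> f \<in> borel_measurable lborel \<and> (\<integral>\<^sup>+ x. ennreal ((cmod (f x))\<^sup>2) \<partial>lborel) < \<infinity>"

definition fourier_L2 :: "('a::euclidean_space \<Rightarrow> complex) \<Rightarrow> ('a \<Rightarrow> complex) \<Rightarrow> bool" where
  "fourier_L2 u g \<longleftrightarrow> L2fun u \<and> L2fun g \<and>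
     ((\<lambda>R::real. \<integral>\<^sup>+ \<xi>. ennreal ((cmod (g \<xi> - fourier (\<lambda>x. indicator (ball 0 R) x * u x) \<xi>))\<^sup>2) \<partial>lborel)
        \<longlongrightarrow> 0) at_top"

definition FT :: "('a::euclidean_space \<Rightarrow> complex) \<Rightarrow> 'a \<Rightarrow> complex" where
  "FT u = (SOME g. fourier_L2 u g)"

definition Hs :: "real \<Rightarrow> ('a::euclidean_space \<Rightarrow> complex) \<Rightarrow> bool" where
  "Hs s u \<longleftrightarrow> (\<exists>g. fourier_L2 u g \<and>
      (\<integral>\<^sup>+ \<xi>. ennreal ((1 + (norm \<xi>)\<^sup>2) powr s * (cmod (g \<xi>))\<^sup>2) \<partial>lborel) < \<infinity>)"

definition hs_norm :: "real \<Rightarrow> ('a::euclidean_space \<Rightarrow> complex) \<Rightarrow> real" where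
  "hs_norm s u = (2 * pi) powr (- real DIM('a) / 2) *
     sqrt (enn2real (\<integral>\<^sup>+ \<xi>. ennreal ((1 + (norm \<xi>)\<^sup>2) powr s * (cmod (FT u \<xi>))\<^sup>2) \<partial>lborel))"

text \<open>Elements of \<open>H^{-s}\<close> are represented through their Fourier transforms
\<open>F\<close>, i.e. measurable functions with \<open>(1+|\<xi>|\<^sup>2)^{-s/2} F \<in> L\<^sup>2\<close>.\<close>
definition Hneg :: "real \<Rightarrow> ('a::euclidean_space \<Rightarrow> complex) \<Rightarrow> bool" where
  "Hneg s F \<longleftrightarrow> F \<in> borel_measurable lborel \<and>
     (\<integral>\<^sup>+ \<xi>. ennreal ((1 + (norm \<xi>)\<^sup>2) powr (- s) * (cmod (F \<xi>))\<^sup>2) \<partial>lborel) < \<infinity>"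

definition hneg_norm :: "real \<Rightarrow> ('a::euclidean_space \<Rightarrow> complex) \<Rightarrow> real" where
  "hneg_norm s F = (2 * pi) powr (- real DIM('a) / 2) *
     sqrt (enn2real (\<integral>\<^sup>+ \<xi>. ennreal ((1 + (norm \<xi>)\<^sup>2) powr (- s) * (cmod (F \<xi>))\<^sup>2) \<partial>lborel))"

text \<open>Distributional pairing of \<open>f \<in> H^{-s}\<close> (given by \<open>F = \<hat>f\<close>) with a test
function: \<open>\<langle>f,\<phi>\<rangle> = (2\<pi>)^{-n} \<integral> \<hat>f(\<xi>) \<hat>\<phi>(-\<xi>) d\<xi>\<close>.\<close>
definition pair :: "('a::euclidean_space \<Rightarrow> complex) \<Rightarrow> ('a \<Rightarrow> complex) \<Rightarrow> complex" where
  "pair F \<phi> = complex_of_real ((2 * pi) powr (- real DIM('a))) *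
     integral\<^sup>L lborel (\<lambda>\<xi>. F \<xi> * fourier \<phi> (- \<xi>))"

definition hneg_rest_norm :: "real \<Rightarrow> 'a::euclidean_space set \<Rightarrow> ('a \<Rightarrow> complex) \<Rightarrow> real" where
  "hneg_rest_norm s U F = Inf {hneg_norm s G | G. Hneg s G \<and> (\<forall>\<phi>. test_fn U \<phi> \<longrightarrow> pair G \<phi> = pair F \<phi>)}"

definition fraclap :: "real \<Rightarrow> ('a::euclidean_space \<Rightarrow> complex) \<Rightarrow> 'a \<Rightarrow> complex" where
  "fraclap s u = (\<lambda>\<xi>. complex_of_real (norm \<xi> powr (2 * s)) * FT u \<xi>)"

definition Hs_tilde :: "real \<Rightarrow> 'a::euclidean_space set \<Rightarrow> ('a \<Rightarrow> complex) \<Rightarrow> bool" where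
  "Hs_tilde s U u \<longleftrightarrow> Hs s u \<and>
     (\<exists>\<phi>::nat \<Rightarrow> 'a \<Rightarrow> complex. (\<forall>k. test_fn U (\<phi> k)) \<and>
        (\<lambda>k. hs_norm s (\<lambda>x. \<phi> k x - u x)) \<longlonglongrightarrow> 0)"

definition nbhd :: "'a::metric_space set \<Rightarrow> real \<Rightarrow> 'a set" where
  "nbhd A r = {x. infdist x A \<le> r}"

definition ext :: "'a::topological_space set \<Rightarrow> 'a set" where
  "ext A = - closure A"

definition spt :: "('a::euclidean_space \<Rightarrow> complex) \<Rightarrow> 'a set" where
  "spt u = {x. \<forall>e>0. \<not> (AE y in lborel. y \<in> ball x e \<longrightarrow> u y = 0)}"

text \<open>\<open>\<Psi> \<in> B(H^s,H^{-s})\<close> (complex-linear, bounded); \<open>\<Psi> u\<close> is given via its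
Fourier representation.\<close>
definition bdd_op :: "real \<Rightarrow> (('a::euclidean_space \<Rightarrow> complex) \<Rightarrow> ('a \<Rightarrow> complex)) \<Rightarrow> bool" where
  "bdd_op s \<Psi> \<longleftrightarrow>
     (\<forall>u. Hs s u \<longrightarrow> Hneg s (\<Psi> u)) \<and>
     (\<forall>u v a. Hs s u \<longrightarrow> Hs s v \<longrightarrow>
        (AE \<xi> in lborel. \<Psi> (\<lambda>x. u x + a * v x) \<xi> = \<Psi> u \<xi> + a * \<Psi> v \<xi>)) \<and>
     (\<exists>C. \<forall>u. Hs s u \<longrightarrow> hneg_norm s (\<Psi> u) \<le> C * hs_norm s u)"

definition quasilocal :: "real \<Rightarrow> (('a::euclidean_space \<Rightarrow> complex) \<Rightarrow> ('a \<Rightarrow> complex)) \<Rightarrow> (real \<Rightarrow> real) \<Rightarrow> bool" where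
  "quasilocal s \<Psi> \<mu> \<longleftrightarrow> bdd_op s \<Psi> \<and> (\<forall>r>0. \<mu> r \<ge> 0) \<and> (\<mu> \<longlongrightarrow> 0) at_top \<and>
     (\<forall>u r. Hs s u \<longrightarrow> r > 0 \<longrightarrow>
        hneg_rest_norm s (ext (nbhd (spt u) r)) (\<Psi> u) \<le> \<mu> r * hs_norm s u)"

definition L2on :: "'a::euclidean_space set \<Rightarrow> ('a \<Rightarrow> complex) \<Rightarrow> bool" where
  "L2on \<Omega> f \<longleftrightarrow> f \<in> borel_measurable lborel \<and> (\<integral>\<^sup>+ x\<in>\<Omega>. ennreal ((cmod (f x))\<^sup>2) \<partial>lborel) < \<infinity>"

definition L2norm_on :: "'a::euclidean_space set \<Rightarrow> ('a \<Rightarrow> complex) \<Rightarrow> real" where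
  "L2norm_on \<Omega> f = sqrt (enn2real (\<integral>\<^sup>+ x\<in>\<Omega>. ennreal ((cmod (f x))\<^sup>2) \<partial>lborel))"

definition L2op_bdd :: "'a::euclidean_space set \<Rightarrow> (('a \<Rightarrow> complex) \<Rightarrow> ('a \<Rightarrow> complex)) \<Rightarrow> real \<Rightarrow> bool" where
  "L2op_bdd \<Omega> \<Phi> M \<longleftrightarrow>
     (\<forall>f. L2on \<Omega> f \<longrightarrow> L2on \<Omega> (\<Phi> f) \<and> L2norm_on \<Omega> (\<Phi> f) \<le> M * L2norm_on \<Omega> f) \<and>
     (\<forall>f g a. L2on \<Omega> f \<longrightarrow> L2on \<Omega> g \<longrightarrow>
        (AE x in lborel. x \<in> \<Omega> \<longrightarrow> \<Phi> (\<lambda>y. f y + a * g y) x = \<Phi> f x + a * \<Phi> g x))"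

definition solves :: "real \<Rightarrow> 'a::euclidean_space set \<Rightarrow> (('a \<Rightarrow> complex) \<Rightarrow> ('a \<Rightarrow> complex)) \<Rightarrow>
                      ('a \<Rightarrow> complex) \<Rightarrow> ('a \<Rightarrow> complex) \<Rightarrow> bool" where
  "solves s \<Omega> \<Phi> v w \<longleftrightarrow> Hs s w \<and> (AE x in lborel. x \<in> ext \<Omega> \<longrightarrow> w x = 0) \<and>
     (\<forall>\<phi>. test_fn \<Omega> \<phi> \<longrightarrow>
        pair (fraclap s w) \<phi> + (LINT x:\<Omega>|lborel. \<Phi> w x * \<phi> x) = (LINT x:\<Omega>|lborel. v x * \<phi> x))"

definition unique_cont :: "real \<Rightarrow> 'a::euclidean_space set \<Rightarrow> (('a \<Rightarrow> complex) \<Rightarrow> ('a \<Rightarrow> complex)) \<Rightarrow> bool" where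
  "unique_cont s \<Omega> \<Phi> \<longleftrightarrow> (\<forall>w. solves s \<Omega> \<Phi> (\<lambda>_. 0) w \<longrightarrow> (AE x in lborel. w x = 0))"

text \<open>The logarithmic stability estimate with constants \<open>c, \<sigma>\<close> (for the sets
\<open>\<Omega>\<close>, \<open>V = W\<^sub>r\<close>, and the bound \<open>M\<close>). The convention \<open>|log 0|^{-\<sigma>} = 0\<close>,
\<open>|log 1|^{-\<sigma>} = \<infinity>\<close> is used.\<close>
definition log_estimate :: "real \<Rightarrow> 'a::euclidean_space set \<Rightarrow> 'a set \<Rightarrow> real \<Rightarrow> real \<Rightarrow> real \<Rightarrow> bool" where
  "log_estimate s \<Omega> V M c \<sigma> \<longleftrightarrow>
     (\<forall>\<Phi>. L2op_bdd \<Omega> \<Phi> M \<and> unique_cont s \<Omega> \<Phi> \<longrightarrow>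
        (\<forall>v w. L2on \<Omega> v \<and> L2norm_on \<Omega> v = 1 \<and> solves s \<Omega> \<Phi> v w \<longrightarrow>
           (let N = hneg_rest_norm s V (fraclap s w) in
              N = 1 \<or> hneg_rest_norm s \<Omega> (FT (\<lambda>x. indicator \<Omega> x * v x)) \<le> c * \<bar>ln N\<bar> powr (- \<sigma>))))"

end

theory Submission
  imports Defs "HOL-Probability.Characteristic_Functions" "HOL-Probability.Sinc_Integral"
begin

text \<open>The logarithmic estimate is used with \<open>\<Phi> = 0\<close>, which requires uniqueness for the
Dirichlet problem of the fractional Laplacian on \<open>\<Omega>\<close>. A solution \<open>w\<close> supported in the closure
of \<open>\<Omega>\<close> is tested against mollified inward translates of the complex conjugate of \<open>\<kappa> w\<close>, where
\<open>\<kappa>\<close> is a cutoff to a small ball in which a fixed direction points into \<open>\<Omega>\<close>. In the limit, and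
after summing over a partition of unity, the energy of \<open>w\<close> vanishes.

Let \<open>h\<close> be the restriction of \<open>(-\<Delta>)^s u\<close> to \<open>\<Omega>\<close> and suppose that \<open>h \<noteq> 0\<close>. By quasilocality the
norm of \<open>(-\<Delta>)^s u\<close> on \<open>W_r\<close> is at most \<open>\<mu>(r)\<parallel>u\<parallel>\<close>. Applying the estimate to \<open>u / \<parallel>h\<parallel>\<close> is not
enough: the factor \<open>\<parallel>u\<parallel> / \<parallel>h\<parallel>\<close> inside the logarithm cannot be absorbed, because \<open>\<sigma>(r)\<close> may be
unbounded. Instead \<open>u\<close> is replaced by \<open>u + t\<theta>\<close> with \<open>\<theta>(x) = \<lambda>^{-2s} e^{i\<lambda> b\<bullet>x} \<psi>(x)\<close>, where the
test function \<open>\<psi>\<close> satisfies \<open>\<langle>h, \<psi>\<rangle> \<noteq> 0\<close>. As \<open>\<lambda> \<rightarrow> \<infinity>\<close>, \<open>(-\<Delta>)^s \<theta>\<close> approaches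
\<open>e^{i\<lambda> b\<bullet>x} \<psi>(x)\<close>, which vanishes on \<open>W\<close>, has a fixed norm in \<open>L^2(\<Omega>)\<close> and tends weakly to \<open>0\<close>.
Choosing \<open>t\<close> and then \<open>\<lambda>\<close> large, the normalised right-hand side keeps an \<open>H^{-s}(\<Omega>)\<close> norm bounded
below independently of \<open>r\<close>, while the norm on \<open>W_r\<close> drops to \<open>\<mu>(r)\<close>. This contradicts the decay
hypothesis.\<close>

section \<open>Smooth functions and cutoffs\<close>

text \<open>Uniqueness for the Dirichlet problem enters twice: it makes the zero operator admissible
  in the logarithmic estimate, and it turns u \<noteq> 0 into a test function \<psi> on \<Omega>
  with \<langle>h, \<psi>\<rangle> \<noteq> 0. The order of the choices is what makes the
  perturbation work. The amplitude t depends only on the norms of u, h and \<psi>, and it fixes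
  two-sided bounds for the norm of the perturbed right-hand side on \<Omega>. The frequency is
  raised only afterwards, depending on the level \<delta> to be reached on W_r. Since the
  oscillating term hardly changes the pairing with \<psi>, the lower bound a for the
  H^{-s}(\<Omega>) norm depends on neither r nor \<delta>. Hence a \<le> c(r) |log
  \<delta>|^{-\<sigma>(r)} holds for every \<delta> in (0,1) with \<delta> \<ge> \<mu>(r), and no
  multiple of \<mu>(r) is left inside the logarithm. Elements of H^{-s} are represented by their
  Fourier transforms, and H^{-s} norms on open sets are infima over extensions: upper bounds come
  from exhibiting one extension, lower bounds from pairing all extensions with \<psi>.\<close>

definition exp_inv :: "nat \<Rightarrow> real \<Rightarrow> real" where
  "exp_inv k t = (if t > 0 then exp (- (1 / t)) * (1 / t) ^ k else 0)"

lemma exp_inv_tendsto_0: "(exp_inv k \<longlongrightarrow> 0) (at 0)"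
proof (rule filterlim_split_at)
  have "((\<lambda>x. x ^ k / exp x) \<longlongrightarrow> (0::real)) at_top"
    by (rule tendsto_power_div_exp_0)
  then have "((\<lambda>t. inverse t ^ k / exp (inverse t)) \<longlongrightarrow> (0::real)) (at_right 0)"
    by (rule filterlim_compose[OF _ filterlim_inverse_at_top_right])
  then show "(exp_inv k \<longlongrightarrow> 0) (at_right 0)"
    by (rule Lim_transform_eventually)
       (auto simp: exp_inv_def eventually_at_right_field exp_minus field_simps intro!: exI[of _ 1])
  show "(exp_inv k \<longlongrightarrow> 0) (at_left 0)"
    by (rule Lim_transform_eventually[OF tendsto_const])
       (auto simp: exp_inv_def eventually_at_left_field intro!: exI[of _ "-1"])
qed

text \<open>The index \<open>k\<close> makes the family closed under differentiation: exp(-1/t)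
  contributes the factor 1/t^2 and t^{-k} the factor -k/t. At 0 the difference quotient of
  \<open>exp_inv k\<close> is \<open>exp_inv (k + 1)\<close>, which tends to 0.\<close>

lemma exp_inv_has_real_derivative:
  "(exp_inv k has_real_derivative exp_inv (k + 2) t - real k * exp_inv (k + 1) t) (at t)"
proof -
  consider "t > 0" | "t < 0" | "t = 0" by linarith
  then show ?thesis
  proof cases
    case 1
    have "((\<lambda>t. exp (- (1 / t)) * (1 / t) ^ k) has_real_derivative
        exp_inv (k + 2) t - real k * exp_inv (k + 1) t) (at t)"
      using 1 by (auto intro!: derivative_eq_intros simp: exp_inv_def)
         (cases k; simp add: field_simps power2_eq_square)
    moreover have "\<forall>\<^sub>F x in nhds t. exp_inv k x = exp (- (1 / x)) * (1 / x) ^ k"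
      using eventually_nhds_in_open[of "{0<..}" t] 1
      by (auto elim!: eventually_mono simp: exp_inv_def)
    ultimately show ?thesis
      by (subst DERIV_cong_ev[OF refl _ refl]) auto
  next
    case 2
    have "\<forall>\<^sub>F x in nhds t. exp_inv k x = 0"
      using eventually_nhds_in_open[of "{..<0}" t] 2
      by (auto elim!: eventually_mono simp: exp_inv_def)
    then show ?thesis
      using 2 by (subst DERIV_cong_ev[OF refl _ refl, where g = "\<lambda>_. 0"]) (auto simp: exp_inv_def)
  next
    case 3
    have "((\<lambda>y. (exp_inv k y - exp_inv k 0) / (y - 0)) \<longlongrightarrow> 0) (at 0)"
      by (rule Lim_transform_eventually[OF exp_inv_tendsto_0[of "Suc k"]])
         (auto simp: exp_inv_def eventually_at_filter)
    then show ?thesis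
      using 3 by (simp add: has_field_derivative_iff exp_inv_def)
  qed
qed

lemma smooth_fn_continuous: "smooth_fn f \<Longrightarrow> continuous_on UNIV f"
  by (erule smooth_fn.cases) auto

lemma smooth_fn_partial:
  assumes "smooth_fn f" "i \<in> Basis"
  obtains g where "\<And>x. ((\<lambda>t::real. f (x + t *\<^sub>R i)) has_vector_derivative g x) (at 0)" "smooth_fn g"
  using assms(1) by cases (use assms(2) that in blast)

text \<open>The smallest class containing the smooth functions and the building blocks of the cutoffs
  that is closed under the ring operations and inversion; by coinduction it contains only smooth
  functions.\<close>

inductive smooth_closure :: "('a::euclidean_space \<Rightarrow> complex) \<Rightarrow> bool" where
  base: "smooth_fn f \<Longrightarrow> smooth_closure f"
| const: "smooth_closure (\<lambda>_. c)"
| coord: "smooth_closure (\<lambda>x. of_real (x \<bullet> b))"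
| exp_inv: "smooth_closure f \<Longrightarrow> (\<And>x. Im (f x) = 0) \<Longrightarrow> smooth_closure (\<lambda>x. of_real (exp_inv k (Re (f x))))"
| add: "smooth_closure f \<Longrightarrow> smooth_closure g \<Longrightarrow> smooth_closure (\<lambda>x. f x + g x)"
| mult: "smooth_closure f \<Longrightarrow> smooth_closure g \<Longrightarrow> smooth_closure (\<lambda>x. f x * g x)"
| inv: "smooth_closure f \<Longrightarrow> (\<And>x. f x \<noteq> 0) \<Longrightarrow> smooth_closure (\<lambda>x. inverse (f x))"

lemma smooth_closure_diff: "smooth_closure f \<Longrightarrow> smooth_closure g \<Longrightarrow> smooth_closure (\<lambda>x. f x - g x)"
  using smooth_closure.add[of f "\<lambda>x. (-1) * g x"] smooth_closure.mult[OF smooth_closure.const, of g "-1"]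
  by simp

lemma smooth_closure_continuous: "smooth_closure f \<Longrightarrow> continuous_on UNIV f"
proof (induction rule: smooth_closure.induct)
  case (base f)
  then show ?case by (rule smooth_fn_continuous)
next
  case (exp_inv f k)
  have "continuous_on UNIV (exp_inv k)"
    by (intro continuous_at_imp_continuous_on ballI DERIV_isCont[OF exp_inv_has_real_derivative])
  then have "continuous_on UNIV (\<lambda>x. exp_inv k (Re (f x)))"
    by (rule continuous_on_compose2) (auto intro!: continuous_intros exp_inv.IH)
  then show ?case by (intro continuous_intros) auto
qed (auto intro!: continuous_intros)

lemma smooth_closure_partial:
  assumes "smooth_closure f" "i \<in> Basis"
  shows "\<exists>g. (\<forall>x. ((\<lambda>t::real. f (x + t *\<^sub>R i)) has_vector_derivative g x) (at 0)) \<and> smooth_closure g"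
  using assms
proof (induction rule: smooth_closure.induct)
  case (base f)
  then show ?case by (metis smooth_closure.base smooth_fn_partial)
next
  case (const c)
  then show ?case by (auto intro!: exI[of _ "\<lambda>_. 0"] smooth_closure.const)
next
  case (coord b)
  show ?case
    by (rule exI[of _ "\<lambda>_. of_real (i \<bullet> b)"])
       (auto intro!: smooth_closure.const derivative_eq_intros has_vector_derivative_of_real
         simp: inner_simps)
next
  case (exp_inv f k)
  then obtain f' where f': "\<And>x. ((\<lambda>t::real. f (x + t *\<^sub>R i)) has_vector_derivative f' x) (at 0)" "smooth_closure f'"
    by metis
  let ?g = "\<lambda>x. (complex_of_real (exp_inv (k + 2) (Re (f x))) - of_real k * complex_of_real (exp_inv (k + 1) (Re (f x)))) * f' x"
  have "smooth_closure ?g"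
    by (intro smooth_closure_diff smooth_closure.mult smooth_closure.const smooth_closure.exp_inv exp_inv.hyps f')
  moreover have "((\<lambda>t::real. complex_of_real (exp_inv k (Re (f (x + t *\<^sub>R i))))) has_vector_derivative ?g x) (at 0)" for x
  proof -
    \<comment> \<open>As \<open>f\<close> is real valued, so is its partial derivative; the real
      chain rule applied to Re f therefore yields the full complex derivative.\<close>
    have "((\<lambda>t::real. Im (f (x + t *\<^sub>R i))) has_vector_derivative Im (f' x)) (at 0)"
      using bounded_linear.has_vector_derivative[OF bounded_linear_Im f'(1)[of x]] .
    then have "((\<lambda>t::real. 0) has_vector_derivative Im (f' x)) (at 0)"
      unfolding exp_inv.hyps(2) .
    then have "Im (f' x) = 0"
      using vector_derivative_unique_at has_vector_derivative_const by blast
    then have f'x: "complex_of_real (Re (f' x)) = f' x"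
      by (simp add: complex_eq_iff)
    have "((\<lambda>t::real. Re (f (x + t *\<^sub>R i))) has_vector_derivative Re (f' x)) (at 0)"
      using bounded_linear.has_vector_derivative[OF bounded_linear_Re f'(1)[of x]] .
    then have "((\<lambda>t::real. Re (f (x + t *\<^sub>R i))) has_real_derivative Re (f' x)) (at 0)"
      by (simp add: has_real_derivative_iff_has_vector_derivative)
    from DERIV_chain2[OF exp_inv_has_real_derivative[of k] this]
    have "((\<lambda>t::real. exp_inv k (Re (f (x + t *\<^sub>R i)))) has_real_derivative
       (exp_inv (k + 2) (Re (f x)) - real k * exp_inv (k + 1) (Re (f x))) * Re (f' x)) (at 0)"
      by simp
    then have "((\<lambda>t::real. complex_of_real (exp_inv k (Re (f (x + t *\<^sub>R i))))) has_vector_derivative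
       of_real ((exp_inv (k + 2) (Re (f x)) - real k * exp_inv (k + 1) (Re (f x))) * Re (f' x))) (at 0)"
      by (intro has_vector_derivative_of_real) (simp add: has_real_derivative_iff_has_vector_derivative)
    moreover have "complex_of_real ((exp_inv (k + 2) (Re (f x)) - real k * exp_inv (k + 1) (Re (f x))) * Re (f' x)) = ?g x"
      by (simp add: f'x)
    ultimately show ?thesis by metis
  qed
  ultimately show ?case by (intro exI[of _ ?g] conjI allI)
next
  case (add f g)
  then obtain f' g' where "\<And>x. ((\<lambda>t::real. f (x + t *\<^sub>R i)) has_vector_derivative f' x) (at 0)" "smooth_closure f'"
    "\<And>x. ((\<lambda>t::real. g (x + t *\<^sub>R i)) has_vector_derivative g' x) (at 0)" "smooth_closure g'" by metis
  then show ?case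
    by (intro exI[of _ "\<lambda>x. f' x + g' x"]) (auto intro!: smooth_closure.add has_vector_derivative_add)
next
  case (mult f g)
  then obtain f' g' where *: "\<And>x. ((\<lambda>t::real. f (x + t *\<^sub>R i)) has_vector_derivative f' x) (at 0)" "smooth_closure f'"
    "\<And>x. ((\<lambda>t::real. g (x + t *\<^sub>R i)) has_vector_derivative g' x) (at 0)" "smooth_closure g'" by metis
  have "((\<lambda>t::real. f (x + t *\<^sub>R i) * g (x + t *\<^sub>R i)) has_vector_derivative f x * g' x + f' x * g x) (at 0)" for x
    using has_vector_derivative_mult[OF *(1)[of x] *(3)[of x]] by simp
  moreover have "smooth_closure (\<lambda>x. f x * g' x + f' x * g x)"
    using * mult by (intro smooth_closure.add smooth_closure.mult smooth_closure.inv
      smooth_closure.const)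
  ultimately show ?case by (intro exI conjI allI)
next
  case (inv f)
  then obtain f' where *: "\<And>x. ((\<lambda>t::real. f (x + t *\<^sub>R i)) has_vector_derivative f' x) (at 0)" "smooth_closure f'"
    by metis
  have "((\<lambda>t::real. inverse (f (x + t *\<^sub>R i))) has_vector_derivative (-1) * f' x * (inverse (f x) * inverse (f x))) (at 0)" for x
  proof -
    have "(inverse has_field_derivative - (inverse (f x) * inverse (f x))) (at (f (x + 0 *\<^sub>R i)))"
      using inv by (auto intro!: derivative_eq_intros)
    from field_vector_diff_chain_at[OF *(1)[of x] this] show ?thesis by (simp add: o_def)
  qed
  moreover have "smooth_closure (\<lambda>x. (-1) * f' x * (inverse (f x) * inverse (f x)))"
    using * inv by (intro smooth_closure.add smooth_closure.mult smooth_closure.inv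
      smooth_closure.const)
  ultimately show ?case by (intro exI conjI allI)
qed

lemma smooth_closure_imp_smooth_fn: "smooth_closure f \<Longrightarrow> smooth_fn f"
proof (coinduction arbitrary: f rule: smooth_fn.coinduct)
  case (smooth_fn f)
  then show ?case
    using smooth_closure_continuous[of f] smooth_closure_partial[of f] by blast
qed

lemmas smooth_fn_const = smooth_closure_imp_smooth_fn[OF smooth_closure.const]
lemmas smooth_fn_mult = smooth_closure_imp_smooth_fn[OF smooth_closure.mult[OF smooth_closure.base smooth_closure.base]]
lemmas smooth_fn_add = smooth_closure_imp_smooth_fn[OF smooth_closure.add[OF smooth_closure.base smooth_closure.base]]

lemma smooth_closure_sum:
  "finite I \<Longrightarrow> (\<And>i. i \<in> I \<Longrightarrow> smooth_closure (f i)) \<Longrightarrow> smooth_closure (\<lambda>x. \<Sum>i\<in>I. f i x)"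
  by (induction I rule: finite_induct) (auto intro: smooth_closure.add smooth_closure.const)

lemma smooth_closure_prod:
  "finite I \<Longrightarrow> (\<And>i. i \<in> I \<Longrightarrow> smooth_closure (f i)) \<Longrightarrow> smooth_closure (\<lambda>x. \<Prod>i\<in>I. f i x)"
  by (induction I rule: finite_induct) (auto intro: smooth_closure.mult smooth_closure.const)

lemma smooth_closure_exp_inv_quadratic:
  "smooth_closure (\<lambda>x::'a::euclidean_space. complex_of_real (exp_inv k (r - c * ((x - a) \<bullet> (x - a)))))"
proof -
  have "smooth_closure (\<lambda>x::'a. of_real r - of_real c * (\<Sum>b\<in>Basis. (of_real (x \<bullet> b) - of_real (a \<bullet> b)) * (of_real (x \<bullet> b) - of_real (a \<bullet> b))))"
    by (intro smooth_closure_diff smooth_closure.mult smooth_closure_sum smooth_closure.const smooth_closure.coord) simp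
  also have "(\<lambda>x::'a. of_real r - of_real c * (\<Sum>b\<in>Basis. (of_real (x \<bullet> b) - of_real (a \<bullet> b)) * (of_real (x \<bullet> b) - of_real (a \<bullet> b)))) =
      (\<lambda>x. complex_of_real (r - c * ((x - a) \<bullet> (x - a))))"
    by (subst euclidean_inner) (simp add: inner_diff_left)
  finally show ?thesis
    using smooth_closure.exp_inv[of "\<lambda>x. complex_of_real (r - c * ((x - a) \<bullet> (x - a)))" k] by simp
qed

lemma smooth_closure_exp_inv_affine:
  "smooth_closure (\<lambda>x::'a::euclidean_space. complex_of_real (exp_inv k (r + c * (x \<bullet> b))))"
proof -
  have "smooth_closure (\<lambda>x::'a. of_real r + of_real c * of_real (x \<bullet> b))"
    by (intro smooth_closure.add smooth_closure.mult smooth_closure.const smooth_closure.coord)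
  from smooth_closure.exp_inv[OF this, of k] show ?thesis by simp
qed

lemma exp_inv_0_pos: "exp_inv 0 t > 0 \<longleftrightarrow> t > 0" and exp_inv_0_nonneg: "exp_inv 0 t \<ge> 0"
  and exp_inv_0_eq_0: "exp_inv 0 t = 0 \<longleftrightarrow> t \<le> 0" and exp_inv_0_le_1: "exp_inv 0 t \<le> 1"
  by (auto simp: exp_inv_def)

text \<open>The quotient A/(A + B), where A is positive exactly for |x - a| < 2r and B exactly for
  |x - a| > r. These two regions cover the space, so the denominator never vanishes.\<close>

lemma smooth_cutoff_exists:
  fixes a :: "'a::euclidean_space"
  assumes "0 < r"
  obtains \<kappa> :: "'a \<Rightarrow> real" where "smooth_fn (\<lambda>x. complex_of_real (\<kappa> x))"
    "\<And>x. x \<in> cball a r \<Longrightarrow> \<kappa> x = 1" "\<And>x. x \<notin> ball a (2 * r) \<Longrightarrow> \<kappa> x = 0"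
proof -
  let ?A = "\<lambda>x. exp_inv 0 ((2 * r)\<^sup>2 - 1 * ((x - a) \<bullet> (x - a)))"
  \<comment> \<open>Level and coefficient are both negated: the argument is |x - a|^2 - r^2, written
    in the shape of \<open>smooth_closure_exp_inv_quadratic\<close>.\<close>
  let ?B = "\<lambda>x. exp_inv 0 (- r\<^sup>2 - (-1) * ((x - a) \<bullet> (x - a)))"
  have nz: "?A x + ?B x \<noteq> 0" for x
  proof -
    have "?A x > 0 \<or> ?B x > 0"
      unfolding exp_inv_0_pos using assms by (auto simp: power2_eq_square) (smt (verit) mult_pos_pos)
    then show ?thesis using exp_inv_0_nonneg by (smt (verit))
  qed
  let ?\<kappa> = "\<lambda>x. ?A x * inverse (?A x + ?B x)"
  have "smooth_fn (\<lambda>x. complex_of_real (?A x) * inverse (complex_of_real (?A x) + complex_of_real (?B x)))"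
    using nz by (intro smooth_closure_imp_smooth_fn smooth_closure.add smooth_closure.mult smooth_closure.inv
      smooth_closure_exp_inv_quadratic) (metis of_real_0 of_real_add of_real_eq_iff)
  then have "smooth_fn (\<lambda>x. complex_of_real (?\<kappa> x))" by simp
  moreover have "?\<kappa> x = 1" if "x \<in> cball a r" for x
  proof -
    have "(norm (x - a))\<^sup>2 \<le> r\<^sup>2"
      using that assms by (intro power_mono) (auto simp: dist_norm norm_minus_commute)
    then have "?B x = 0" unfolding exp_inv_0_eq_0 by (simp add: dot_square_norm)
    then show ?thesis using nz[of x] by simp
  qed
  moreover have "?\<kappa> x = 0" if "x \<notin> ball a (2 * r)" for x
  proof -
    have "(2 * r)\<^sup>2 \<le> (norm (x - a))\<^sup>2"
      using that assms by (intro power_mono) (auto simp: dist_norm norm_minus_commute)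
    then have "?A x = 0" unfolding exp_inv_0_eq_0 by (simp add: dot_square_norm)
    then show ?thesis by simp
  qed
  ultimately show ?thesis by (rule that[of ?\<kappa>])
qed

section \<open>Test functions and convolution\<close>

lemma nn_integral_affine:
  fixes t :: "'a::euclidean_space"
  assumes [measurable]: "f \<in> borel_measurable borel" and c: "c \<noteq> 0"
  shows "(\<integral>\<^sup>+ x. f x \<partial>lborel) = ennreal (\<bar>c\<bar> ^ DIM('a)) * (\<integral>\<^sup>+ x. f (t + c *\<^sub>R x) \<partial>lborel)"
  by (subst lborel_affine[OF c, of t])
     (simp add: nn_integral_density nn_integral_distr nn_integral_cmult ennreal_power)

lemma integral_affine:
  fixes t :: "'a::euclidean_space" and f :: "'a \<Rightarrow> 'b::{banach, second_countable_topology}"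
  assumes [measurable]: "f \<in> borel_measurable borel" and c: "c \<noteq> 0"
  shows "(LBINT x. f x) = \<bar>c\<bar> ^ DIM('a) *\<^sub>R (LBINT x. f (t + c *\<^sub>R x))"
  by (subst lborel_affine[OF c, of t])
     (simp add: integral_density integral_distr)

lemma integrable_affine:
  fixes t :: "'a::euclidean_space" and f :: "'a \<Rightarrow> 'b::{banach, second_countable_topology}"
  assumes f: "integrable lborel f" and c: "c \<noteq> 0"
  shows "integrable lborel (\<lambda>x. f (t + c *\<^sub>R x))"
  using f f[THEN borel_measurable_integrable] c unfolding integrable_iff_bounded
  by (subst (asm) nn_integral_affine[where c=c and t=t]) (auto simp: ennreal_mult_less_top)

section \<open>Closure properties and bounds of test functions\<close>

lemma test_fn_mono: "test_fn U \<phi> \<Longrightarrow> U \<subseteq> V \<Longrightarrow> test_fn V \<phi>"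
  by (auto simp: test_fn_def)

lemma test_fn_outside: "test_fn U \<phi> \<Longrightarrow> x \<notin> U \<Longrightarrow> \<phi> x = 0"
  using closure_subset[of "{x. \<phi> x \<noteq> 0}"] by (auto simp: test_fn_def csupp_def)

lemma csupp_subset: "closed K \<Longrightarrow> (\<And>x. x \<notin> K \<Longrightarrow> \<phi> x = 0) \<Longrightarrow> csupp \<phi> \<subseteq> K"
  unfolding csupp_def by (rule closure_minimal) auto

lemma not_in_csupp: "x \<notin> csupp \<phi> \<Longrightarrow> \<phi> x = 0"
  using closure_subset[of "{x. \<phi> x \<noteq> 0}"] by (auto simp: csupp_def)

lemma closed_csupp: "closed (csupp \<phi>)"
  by (simp add: csupp_def)

lemma test_fnI:
  assumes "smooth_fn \<phi>" "compact K" "K \<subseteq> U" "\<And>x. x \<notin> K \<Longrightarrow> \<phi> x = 0"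
  shows "test_fn U \<phi>"
proof -
  have "csupp \<phi> \<subseteq> K" using assms by (intro csupp_subset compact_imp_closed)
  then show ?thesis
    using assms compact_Int_closed[of K "csupp \<phi>"] closed_csupp[of \<phi>]
    by (auto simp: test_fn_def Int_absorb1)
qed

lemma test_fn_smooth_mult: "smooth_fn f \<Longrightarrow> test_fn U \<phi> \<Longrightarrow> test_fn U (\<lambda>x. f x * \<phi> x)"
  by (rule test_fnI[of _ "csupp \<phi>"]) (auto simp: test_fn_def not_in_csupp intro: smooth_fn_mult)

lemma test_fn_add: "test_fn U \<phi> \<Longrightarrow> test_fn U \<psi> \<Longrightarrow> test_fn U (\<lambda>x. \<phi> x + \<psi> x)"
  by (rule test_fnI[of _ "csupp \<phi> \<union> csupp \<psi>"]) (auto simp: test_fn_def not_in_csupp intro: smooth_fn_add)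

lemma test_fn_cmult: "test_fn U \<phi> \<Longrightarrow> test_fn U (\<lambda>x. c * \<phi> x)"
  by (rule test_fn_smooth_mult[OF smooth_fn_const])

lemma test_fn_continuous: "test_fn U \<phi> \<Longrightarrow> continuous_on UNIV \<phi>"
  by (simp add: test_fn_def smooth_fn_continuous)

lemma test_fn_measurable: "test_fn U \<phi> \<Longrightarrow> \<phi> \<in> borel_measurable borel"
  by (intro borel_measurable_continuous_onI test_fn_continuous)

lemma continuous_compact_support_integrable:
  fixes \<phi> :: "'a::euclidean_space \<Rightarrow> 'b::{banach, second_countable_topology}"
  assumes "continuous_on UNIV \<phi>" "compact K" "\<And>x. x \<notin> K \<Longrightarrow> \<phi> x = 0"
  shows "integrable lborel \<phi>"
proof -
  have "integrable lborel (\<lambda>x. indicator K x *\<^sub>R \<phi> x)"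
    using assms continuous_on_subset by (intro borel_integrable_compact) blast+
  also have "(\<lambda>x. indicator K x *\<^sub>R \<phi> x) = \<phi>"
    using assms(3) by (auto simp: indicator_def fun_eq_iff)
  finally show ?thesis .
qed

lemma test_fn_integrable: "test_fn U \<phi> \<Longrightarrow> integrable lborel \<phi>"
  by (rule continuous_compact_support_integrable[of _ "csupp \<phi>"])
     (auto simp: test_fn_def not_in_csupp smooth_fn_continuous)

lemma test_fn_square_integrable: "test_fn U \<phi> \<Longrightarrow> integrable lborel (\<lambda>x. (cmod (\<phi> x))\<^sup>2)"
  by (rule continuous_compact_support_integrable[of _ "csupp \<phi>"])
     (auto simp: test_fn_def not_in_csupp smooth_fn_continuous intro!: continuous_intros)

lemma test_fn_bounded:
  assumes "test_fn U \<phi>" obtains C where "C > 0" "\<And>x. cmod (\<phi> x) \<le> C"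
proof -
  have "compact (\<phi> ` csupp \<phi>)"
    using assms continuous_on_subset[OF test_fn_continuous[OF assms], of "csupp \<phi>"]
    by (intro compact_continuous_image) (auto simp: test_fn_def)
  then obtain C where "C > 0" "\<And>x. x \<in> csupp \<phi> \<Longrightarrow> cmod (\<phi> x) \<le> C"
    using compact_imp_bounded by (metis bounded_pos image_eqI)
  then show ?thesis using not_in_csupp[of _ \<phi>] by (intro that[of C]) (auto, metis less_eq_real_def norm_zero)
qed

lemma test_fn_partial:
  assumes "test_fn U \<phi>" "b \<in> Basis"
  obtains g where "\<And>x. ((\<lambda>t::real. \<phi> (x + t *\<^sub>R b)) has_vector_derivative g x) (at 0)" "test_fn U g"
proof -
  obtain g where g: "\<And>x. ((\<lambda>t::real. \<phi> (x + t *\<^sub>R b)) has_vector_derivative g x) (at 0)" "smooth_fn g"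
    using assms smooth_fn_partial by (metis test_fn_def)
  have "g x = 0" if "x \<notin> csupp \<phi>" for x
  proof -
    have "open ((\<lambda>t. x + t *\<^sub>R b) -` (- csupp \<phi>))"
      using closed_csupp[of \<phi>] by (intro open_vimage) (auto intro!: continuous_intros)
    moreover have "0 \<in> (\<lambda>t. x + t *\<^sub>R b) -` (- csupp \<phi>)" using that by simp
    moreover have "\<phi> (x + t *\<^sub>R b) = 0" if "t \<in> (\<lambda>t. x + t *\<^sub>R b) -` (- csupp \<phi>)" for t
      using that by (auto simp: not_in_csupp)
    ultimately have "((\<lambda>t::real. 0) has_vector_derivative g x) (at 0)"
      by (intro has_vector_derivative_transform_within_open[OF g(1)])
    then show ?thesis using vector_derivative_unique_at[OF _ has_vector_derivative_const] by blast
  qed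
  then have "test_fn U g"
    using assms g by (intro test_fnI[of g "csupp \<phi>"]) (auto simp: test_fn_def)
  with g(1) show ?thesis by (rule that)
qed

text \<open>In this form derivatives can be computed along sequences tending to 0, where dominated
  convergence applies to the difference quotients.\<close>

lemma has_vector_derivative_at_0_iff:
  "(f has_vector_derivative D) (at (0::real)) \<longleftrightarrow> ((\<lambda>t. (f t - f 0) /\<^sub>R t) \<longlongrightarrow> D) (at 0)"
proof -
  have "(f has_vector_derivative D) (at 0) \<longleftrightarrow> ((\<lambda>h. norm ((f h - f 0 - h *\<^sub>R D) /\<^sub>R norm h)) \<longlongrightarrow> 0) (at 0)"
    unfolding has_vector_derivative_def has_derivative_at by (simp add: bounded_linear_scaleR_left divide_inverse_commute)
  also have "\<dots> \<longleftrightarrow> ((\<lambda>h. norm ((f h - f 0) /\<^sub>R h - D)) \<longlongrightarrow> 0) (at 0)"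
  proof (rule tendsto_cong)
    have "norm ((f h - f 0 - h *\<^sub>R D) /\<^sub>R norm h) = norm ((f h - f 0) /\<^sub>R h - D)" if "h \<noteq> 0" for h
    proof -
      have "(f h - f 0) /\<^sub>R h - D = (f h - f 0 - h *\<^sub>R D) /\<^sub>R h"
        using that by (simp add: scaleR_diff_right)
      then show ?thesis by simp
    qed
    then show "\<forall>\<^sub>F h in at 0. norm ((f h - f 0 - h *\<^sub>R D) /\<^sub>R norm h) = norm ((f h - f 0) /\<^sub>R h - D)"
      by (auto simp: eventually_at_filter)
  qed
  also have "\<dots> \<longleftrightarrow> ((\<lambda>t. (f t - f 0) /\<^sub>R t) \<longlongrightarrow> D) (at 0)"
    by (simp only: tendsto_norm_zero_iff LIM_zero_iff)
  finally show ?thesis .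
qed

text \<open>The mean value inequality along a line in direction \<open>b\<close>. It supplies the
  constant that dominates the difference quotients when differentiating under the integral.\<close>

lemma test_fn_difference_bound:
  assumes "test_fn U \<phi>" "b \<in> Basis"
  obtains C where "C > 0" "\<And>x t. cmod (\<phi> (x + t *\<^sub>R b) - \<phi> x) \<le> C * \<bar>t\<bar>"
proof -
  obtain g where g: "\<And>x. ((\<lambda>t::real. \<phi> (x + t *\<^sub>R b)) has_vector_derivative g x) (at 0)" "test_fn U g"
    using test_fn_partial[OF assms] by metis
  obtain C where C: "C > 0" "\<And>x. cmod (g x) \<le> C" using test_fn_bounded[OF g(2)] by metis
  have "cmod (\<phi> (x + t *\<^sub>R b) - \<phi> x) \<le> C * \<bar>t\<bar>" for x t
  proof -
    have d: "((\<lambda>t::real. \<phi> (x + t *\<^sub>R b)) has_derivative (\<lambda>h. h *\<^sub>R g (x + s *\<^sub>R b))) (at s)" for s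
    proof -
      have "((\<lambda>t. \<phi> (x + (s + t) *\<^sub>R b)) has_vector_derivative g (x + s *\<^sub>R b)) (at 0)"
        using g(1)[of "x + s *\<^sub>R b"] by (simp add: scaleR_add_left add.assoc)
      then have "((\<lambda>t. \<phi> (x + (s + t) *\<^sub>R b)) \<circ> (\<lambda>t. t - s) has_vector_derivative 1 *\<^sub>R g (x + s *\<^sub>R b)) (at s)"
        by (intro vector_diff_chain_at) (auto intro!: derivative_eq_intros)
      then show ?thesis by (simp add: has_vector_derivative_def comp_def)
    qed
    have "norm (\<phi> (x + t *\<^sub>R b) - \<phi> (x + 0 *\<^sub>R b)) \<le> C * norm (t - 0)"
    proof (rule differentiable_bound[OF convex_UNIV])
      show "((\<lambda>t::real. \<phi> (x + t *\<^sub>R b)) has_derivative (\<lambda>h. h *\<^sub>R g (x + s *\<^sub>R b))) (at s within UNIV)" for s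
        using d by simp
      show "onorm (\<lambda>h. h *\<^sub>R g (x + s *\<^sub>R b)) \<le> C" for s
        using C by (intro onorm_bound) (auto simp: mult.commute[of C] intro!: mult_left_mono)
    qed auto
    then show ?thesis by simp
  qed
  then show ?thesis using that C by blast
qed

text \<open>All differentiation falls on the smooth factor, so integrability of \<open>f\<close>
  suffices. The difference quotients of \<phi> are uniformly bounded, which gives a multiple of |f|
  as dominating function.\<close>

lemma convolution_has_partial:
  fixes f :: "'a::euclidean_space \<Rightarrow> complex"
  assumes \<phi>: "test_fn U \<phi>" "b \<in> Basis" and f: "integrable lborel f"
    and g: "\<And>x. ((\<lambda>t::real. \<phi> (x + t *\<^sub>R b)) has_vector_derivative g x) (at 0)" "test_fn U g"
  shows "((\<lambda>t::real. \<integral>y. \<phi> (x + t *\<^sub>R b - y) * f y \<partial>lborel) has_vector_derivative (LBINT y. g (x - y) * f y)) (at 0)"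
  unfolding has_vector_derivative_at_0_iff tendsto_at_iff_sequentially comp_def
proof (intro allI impI)
  fix T :: "nat \<Rightarrow> real" assume T: "\<forall>i. T i \<in> UNIV - {0}" "T \<longlonglongrightarrow> 0"
  have [measurable]: "\<phi> \<in> borel_measurable borel" "g \<in> borel_measurable borel" "f \<in> borel_measurable borel"
    using \<phi> g f test_fn_measurable by auto
  obtain C0 where C0: "C0 > 0" "\<And>x. cmod (\<phi> x) \<le> C0" using test_fn_bounded[OF \<phi>(1)] by metis
  obtain C where C: "C > 0" "\<And>x t. cmod (\<phi> (x + t *\<^sub>R b) - \<phi> x) \<le> C * \<bar>t\<bar>"
    using test_fn_difference_bound[OF \<phi>] by metis
  have int: "integrable lborel (\<lambda>y. \<phi> (z - y) * f y)" for z
  proof (rule Bochner_Integration.integrable_bound)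
    show "integrable lborel (\<lambda>y. C0 * norm (f y))" using f by simp
    show "AE y in lborel. norm (\<phi> (z - y) * f y) \<le> norm (C0 * norm (f y))"
      using C0 by (auto simp: norm_mult intro!: mult_right_mono)
  qed measurable
  have "(\<lambda>i. \<integral>y. ((\<phi> (x - y + T i *\<^sub>R b) - \<phi> (x - y)) /\<^sub>R T i) * f y \<partial>lborel) \<longlonglongrightarrow> (LBINT y. g (x - y) * f y)"
  proof (rule integral_dominated_convergence)
    show "integrable lborel (\<lambda>y. C * norm (f y))" using f by simp
    show "AE y in lborel. (\<lambda>i. ((\<phi> (x - y + T i *\<^sub>R b) - \<phi> (x - y)) /\<^sub>R T i) * f y) \<longlonglongrightarrow> g (x - y) * f y"
    proof (intro AE_I2 tendsto_mult tendsto_const)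
      fix y
      have "((\<lambda>t. (\<phi> (x - y + t *\<^sub>R b) - \<phi> (x - y + 0 *\<^sub>R b)) /\<^sub>R t) \<longlongrightarrow> g (x - y)) (at 0)"
        using g(1)[of "x - y"] unfolding has_vector_derivative_at_0_iff .
      then show "(\<lambda>i. (\<phi> (x - y + T i *\<^sub>R b) - \<phi> (x - y)) /\<^sub>R T i) \<longlonglongrightarrow> g (x - y)"
        using T unfolding tendsto_at_iff_sequentially comp_def by simp
    qed
    show "AE y in lborel. norm (((\<phi> (x - y + T i *\<^sub>R b) - \<phi> (x - y)) /\<^sub>R T i) * f y) \<le> C * norm (f y)" for i
    proof (intro AE_I2)
      fix y
      have "cmod ((\<phi> (x - y + T i *\<^sub>R b) - \<phi> (x - y)) /\<^sub>R T i) \<le> C"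
        using C(2)[of "x - y" "T i"] T(1) by (simp add: divide_simps)
      then show "norm (((\<phi> (x - y + T i *\<^sub>R b) - \<phi> (x - y)) /\<^sub>R T i) * f y) \<le> C * norm (f y)"
        unfolding norm_mult by (rule mult_right_mono) simp
    qed
  qed measurable
  also have "(\<lambda>i. \<integral>y. ((\<phi> (x - y + T i *\<^sub>R b) - \<phi> (x - y)) /\<^sub>R T i) * f y \<partial>lborel) =
    (\<lambda>i. ((LBINT y. \<phi> (x + T i *\<^sub>R b - y) * f y) - (LBINT y. \<phi> (x + 0 *\<^sub>R b - y) * f y)) /\<^sub>R T i)"
    by (subst Bochner_Integration.integral_diff[symmetric, OF int int])
       (simp add: integral_scaleR_right[symmetric] algebra_simps del: integral_scaleR_right)
  finally show "(\<lambda>i. ((LBINT y. \<phi> (x + T i *\<^sub>R b - y) * f y) - (LBINT y. \<phi> (x + 0 *\<^sub>R b - y) * f y)) /\<^sub>R T i)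
      \<longlonglongrightarrow> (LBINT y. g (x - y) * f y)" .
qed

text \<open>A partial derivative is again a convolution with the same \<open>f\<close>, with \<phi>
  replaced by a derivative that is itself a test function. This is the coinductive invariant, so no
  order of differentiability has to be tracked.\<close>

lemma smooth_fn_convolution:
  assumes "test_fn UNIV \<phi>" "integrable lborel f"
  shows "smooth_fn (\<lambda>x. \<integral>y. \<phi> (x - y) * f y \<partial>lborel)"
  using assms(1)
proof (coinduction arbitrary: \<phi> rule: smooth_fn.coinduct)
  case (smooth_fn \<phi>)
  have [measurable]: "\<phi> \<in> borel_measurable borel" "f \<in> borel_measurable borel"
    using smooth_fn assms test_fn_measurable by auto
  obtain C0 where C0: "C0 > 0" "\<And>x. cmod (\<phi> x) \<le> C0" using test_fn_bounded[OF smooth_fn] by metis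
  have cont: "continuous_on UNIV (\<lambda>x. \<integral>y. \<phi> (x - y) * f y \<partial>lborel)"
    unfolding continuous_on_sequentially comp_def
  proof (intro allI impI ballI, elim conjE)
    fix x :: 'a and a :: "nat \<Rightarrow> 'a" assume a: "a \<longlonglongrightarrow> x"
    show "(\<lambda>n. \<integral>y. \<phi> (a n - y) * f y \<partial>lborel) \<longlonglongrightarrow> (LBINT y. \<phi> (x - y) * f y)"
    proof (rule integral_dominated_convergence)
      show "integrable lborel (\<lambda>y. C0 * norm (f y))" using assms by simp
      show "AE y in lborel. (\<lambda>i. \<phi> (a i - y) * f y) \<longlonglongrightarrow> \<phi> (x - y) * f y"
        using a test_fn_continuous[OF smooth_fn]
        by (intro AE_I2 tendsto_mult tendsto_const continuous_on_tendsto_compose[of UNIV \<phi>] tendsto_intros) auto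
      show "AE y in lborel. norm (\<phi> (a i - y) * f y) \<le> C0 * norm (f y)" for i
        using C0 by (auto simp: norm_mult intro!: mult_right_mono)
    qed measurable
  qed
  have partial: "\<exists>g. (\<forall>x. ((\<lambda>t. \<integral>y. \<phi> (x + t *\<^sub>R b - y) * f y \<partial>lborel) has_vector_derivative g x) (at 0)) \<and>
      ((\<exists>\<psi>. g = (\<lambda>x. \<integral>y. \<psi> (x - y) * f y \<partial>lborel) \<and> test_fn UNIV \<psi>) \<or> smooth_fn g)" if "b \<in> Basis" for b
  proof -
    obtain g where g: "\<And>x. ((\<lambda>t::real. \<phi> (x + t *\<^sub>R b)) has_vector_derivative g x) (at 0)" "test_fn UNIV g"
      using test_fn_partial[OF smooth_fn \<open>b \<in> Basis\<close>] by metis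
    show ?thesis
      by (rule exI[of _ "\<lambda>x. \<integral>y. g (x - y) * f y \<partial>lborel"], rule conjI, rule allI,
          rule convolution_has_partial[OF smooth_fn that assms(2) g], rule disjI1, rule exI,
          rule conjI[OF refl g(2)])
  qed
  show ?case
    by (rule exI, rule conjI, rule refl, rule conjI, rule cont, rule ballI, rule partial)
qed

section \<open>Fourier inversion and the Bessel inequality\<close>

lemma cis_measurable [measurable]: "cis \<in> borel_measurable borel"
  by (intro borel_measurable_continuous_onI continuous_intros)

lemma cnj_measurable [measurable]: "cnj \<in> borel_measurable borel"
  by (intro borel_measurable_continuous_onI continuous_intros)

lemma fourier_measurable [measurable]:
  assumes [measurable]: "f \<in> borel_measurable borel"
  shows "fourier f \<in> borel_measurable borel"
  unfolding fourier_def[abs_def] by measurable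

lemma integrable_cis_mult:
  assumes "integrable M f" and [measurable]: "g \<in> borel_measurable M"
  shows "integrable M (\<lambda>x. cis (g x) * f x)"
  using assms(1) by (rule Bochner_Integration.integrable_bound) (use assms(1) in \<open>auto simp: norm_mult\<close>)

lemma integrable_bounded_mult:
  fixes f g :: "'a \<Rightarrow> complex"
  assumes "integrable M f" "g \<in> borel_measurable M" "\<And>x. cmod (g x) \<le> C"
  shows "integrable M (\<lambda>x. g x * f x)"
proof (rule Bochner_Integration.integrable_bound)
  show "integrable M (\<lambda>x. C * norm (f x))" using assms(1) by simp
  show "AE x in M. norm (g x * f x) \<le> norm (C * norm (f x))"
    using assms(3) by (auto simp: norm_mult abs_mult intro!: mult_right_mono order_trans[OF assms(3) abs_ge_self])
  show "(\<lambda>x. g x * f x) \<in> borel_measurable M"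
    using assms by measurable
qed

lemma fourier_bound:
  assumes "integrable lborel f"
  shows "cmod (fourier f \<xi>) \<le> (LBINT x. cmod (f x))"
  unfolding fourier_def by (rule order_trans[OF integral_norm_bound]) (simp add: norm_mult)

lemma integrable_pair_mult:
  fixes f :: "'a::euclidean_space \<Rightarrow> complex" and g :: "'b::euclidean_space \<Rightarrow> complex"
  assumes f: "integrable lborel f" and g: "integrable lborel g"
  shows "integrable (lborel \<Otimes>\<^sub>M lborel) (\<lambda>(x, y). f x * g y)"
proof -
  have [measurable]: "f \<in> borel_measurable borel" "g \<in> borel_measurable borel"
    using f g by auto
  show ?thesis
  proof (rule lborel_pair.Fubini_integrable)
    show "integrable lborel (\<lambda>x. LBINT y. norm (case (x, y) of (x, y) \<Rightarrow> f x * g y))"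
      using f by (simp add: norm_mult)
    show "AE x in lborel. integrable lborel (\<lambda>y. case (x, y) of (x, y) \<Rightarrow> f x * g y)"
      using g by simp
  qed measurable
qed

lemma fourier_multiplication_formula:
  fixes f g :: "'a::euclidean_space \<Rightarrow> complex"
  assumes f: "integrable lborel f" and g: "integrable lborel g"
  shows "(LBINT \<xi>. fourier f \<xi> * g \<xi>) = (LBINT x. f x * fourier g x)"
proof -
  have [measurable]: "f \<in> borel_measurable borel" "g \<in> borel_measurable borel"
    using f g by auto
  have int: "integrable (lborel \<Otimes>\<^sub>M lborel) (\<lambda>(x, \<xi>). cis (- (x \<bullet> \<xi>)) * (f x * g \<xi>))"
    using integrable_cis_mult[OF integrable_pair_mult[OF f g], of "\<lambda>(x, \<xi>). - (x \<bullet> \<xi>)"]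
    by (simp add: case_prod_unfold)
  have "(LBINT \<xi>. fourier f \<xi> * g \<xi>) = (LBINT \<xi>. (LBINT x. cis (- (x \<bullet> \<xi>)) * (f x * g \<xi>)))"
    by (simp add: fourier_def integral_mult_left_zero[symmetric] mult.assoc del: integral_mult_left_zero)
  also have "\<dots> = (LBINT x. (LBINT \<xi>. cis (- (x \<bullet> \<xi>)) * (f x * g \<xi>)))"
    by (rule lborel_pair.Fubini_integral[OF int])
  also have "\<dots> = (LBINT x. f x * fourier g x)"
    by (simp add: fourier_def integral_mult_right_zero[symmetric] mult_ac inner_commute del: integral_mult_right_zero)
  finally show ?thesis .
qed

text \<open>\<open>lborel\<close> is the image of the product of one-dimensional Lebesgue measures
  under the coordinate map, so products over the coordinates integrate factor by factor. This serves
  the Gaussians and the weight (1 + |\<xi>|^2)^{-n}.\<close>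

lemma lborel_prod_integrable:
  fixes k :: "'a::euclidean_space \<Rightarrow> real \<Rightarrow> 'b::{real_normed_field, banach, second_countable_topology}"
  assumes "\<And>b. b \<in> Basis \<Longrightarrow> integrable lborel (k b)"
  shows "integrable lborel (\<lambda>x::'a. \<Prod>b\<in>Basis. k b (x \<bullet> b))"
    and "(\<integral>x. (\<Prod>b\<in>Basis. k b (x \<bullet> b)) \<partial>(lborel :: 'a measure)) = (\<Prod>b\<in>Basis. \<integral>t. k b t \<partial>lborel)"
proof -
  interpret finite_product_sigma_finite "\<lambda>_. lborel :: real measure" "Basis :: 'a set"
    by standard simp
  have [measurable]: "k b \<in> borel_measurable borel" if "b \<in> Basis" for b
    using assms[OF that] by auto
  have m: "(\<lambda>x. \<Prod>b\<in>Basis. k b (x \<bullet> b)) \<in> borel_measurable (borel :: 'a measure)"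
    by (rule borel_measurable_prod) measurable
  have T: "(\<lambda>f. \<Sum>b\<in>Basis. f b *\<^sub>R b) \<in> (\<Pi>\<^sub>M b\<in>Basis. lborel) \<rightarrow>\<^sub>M (borel :: 'a measure)"
    by measurable
  have eq: "(\<Prod>b\<in>Basis. k b ((\<Sum>b\<in>Basis. f b *\<^sub>R b) \<bullet> b)) = (\<Prod>b\<in>Basis. k b (f b))" for f
    by (intro prod.cong) auto
  show "integrable lborel (\<lambda>x::'a. \<Prod>b\<in>Basis. k b (x \<bullet> b))"
    unfolding lborel_eq[where 'a = 'a] by (subst integrable_distr_eq[OF T m]) (simp add: eq product_integrable_prod assms)
  show "(\<integral>x. (\<Prod>b\<in>Basis. k b (x \<bullet> b)) \<partial>(lborel :: 'a measure)) = (\<Prod>b\<in>Basis. \<integral>t. k b t \<partial>lborel)"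
    unfolding lborel_eq[where 'a = 'a] by (subst integral_distr[OF T m]) (simp add: eq product_integral_prod assms)
qed

section \<open>Gaussians and their transforms\<close>

definition gaussian :: "real \<Rightarrow> 'a::euclidean_space \<Rightarrow> complex" where
  "gaussian t x = of_real (exp (- ((t * norm x)\<^sup>2 / 2)))"

lemma gaussian_measurable [measurable]: "gaussian t \<in> borel_measurable borel"
  unfolding gaussian_def[abs_def] by measurable

lemma gaussian_scale: "gaussian t (c *\<^sub>R x) = gaussian (t * c) x"
  by (simp add: gaussian_def power_mult_distrib)

text \<open>Gaussian and character both factorise over the coordinates, and each one-dimensional
  integral is sqrt(2 pi) times the characteristic function of the standard normal
  distribution.\<close>

lemma fourier_gaussian_1:
  shows "integrable lborel (gaussian 1 :: 'a::euclidean_space \<Rightarrow> complex)"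
    and "fourier (gaussian 1) (y::'a) = of_real (sqrt (2 * pi) ^ DIM('a)) * gaussian 1 y"
proof -
  define k where "k \<tau> t = cis (- (t * \<tau>)) * complex_of_real (exp (- (t\<^sup>2 / 2)))" for \<tau> t :: real
  have sd: "exp (- (t\<^sup>2 / 2)) = sqrt (2 * pi) * std_normal_density t" for t
    by (simp add: std_normal_density_def)
  have int: "integrable lborel (k \<tau>)" for \<tau>
  proof -
    have "integrable lborel (\<lambda>t. complex_of_real (exp (- (t\<^sup>2 / 2))))"
      unfolding sd by (intro integrable_of_real integrable_mult_right) simp
    then show ?thesis unfolding k_def by (intro integrable_cis_mult) auto
  qed
  have val: "(LBINT t. k \<tau> t) = of_real (sqrt (2 * pi) * exp (- (\<tau>\<^sup>2 / 2)))" for \<tau>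
  proof -
    have "char std_normal_distribution (- \<tau>) = (LBINT t. std_normal_density t *\<^sub>R cis (- (t * \<tau>)))"
      by (simp add: char_def integral_density cis_conv_exp mult_ac)
    then have "complex_of_real (sqrt (2 * pi)) * char std_normal_distribution (- \<tau>) = (LBINT t. k \<tau> t)"
      by (simp add: k_def sd scaleR_conv_of_real mult_ac integral_mult_right_zero[symmetric] del: integral_mult_right_zero)
    then show ?thesis by (simp add: char_std_normal_distribution)
  qed
  have sq: "(norm x)\<^sup>2 = (\<Sum>b\<in>Basis. (x \<bullet> b)\<^sup>2)" for x :: 'a
    by (subst power2_norm_eq_inner, subst euclidean_inner) (simp add: power2_eq_square)
  have g: "gaussian 1 x = (\<Prod>b\<in>Basis. complex_of_real (exp (- ((x \<bullet> b)\<^sup>2 / 2))))" for x :: 'a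
    by (simp add: gaussian_def sq exp_sum sum_negf[symmetric] sum_divide_distrib)
  have c: "cis (- (x \<bullet> y)) = (\<Prod>b\<in>Basis. cis (- ((x \<bullet> b) * (y \<bullet> b))))" for x y :: 'a
    by (simp add: cis_conv_exp exp_sum[symmetric] euclidean_inner[of x y] sum_negf sum_distrib_left)
  have gk: "gaussian 1 x = (\<Prod>b\<in>Basis. k 0 (x \<bullet> b))" for x :: 'a
    unfolding g by (simp add: k_def)
  show "integrable lborel (gaussian 1 :: 'a \<Rightarrow> complex)"
    unfolding gk by (rule lborel_prod_integrable(1)) (rule int)
  have "fourier (gaussian 1) y = (LBINT x. (\<Prod>b\<in>Basis. k (y \<bullet> b) (x \<bullet> b)))"
    unfolding fourier_def g c k_def by (simp add: prod.distrib)
  also have "\<dots> = (\<Prod>b\<in>Basis. of_real (sqrt (2 * pi) * exp (- ((y \<bullet> b)\<^sup>2 / 2))))"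
    by (subst lborel_prod_integrable(2)[OF int]) (simp add: val)
  also have "\<dots> = of_real (sqrt (2 * pi) ^ DIM('a)) * gaussian 1 y"
    by (simp add: g prod.distrib)
  finally show "fourier (gaussian 1) y = of_real (sqrt (2 * pi) ^ DIM('a)) * gaussian 1 y" .
qed

lemma gaussian_integrable:
  assumes "t \<noteq> 0"
  shows "integrable lborel (gaussian t :: 'a::euclidean_space \<Rightarrow> complex)"
  using integrable_affine[OF fourier_gaussian_1(1) assms, of 0] by (simp add: gaussian_scale)

lemma fourier_gaussian:
  fixes y :: "'a::euclidean_space"
  assumes "t > 0"
  shows "fourier (gaussian t) y = of_real ((sqrt (2 * pi) / t) ^ DIM('a)) * gaussian (1 / t) y"
proof -
  have "fourier (gaussian 1) ((1 / t) *\<^sub>R y) =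
    \<bar>t\<bar> ^ DIM('a) *\<^sub>R (LBINT x. cis (- ((0 + t *\<^sub>R x) \<bullet> ((1 / t) *\<^sub>R y))) * gaussian 1 (0 + t *\<^sub>R x))"
    unfolding fourier_def using assms by (intro integral_affine) auto
  also have "\<dots> = of_real (t ^ DIM('a)) * fourier (gaussian t) y"
    using assms by (simp add: gaussian_scale fourier_def scaleR_conv_of_real)
  finally show ?thesis
    using assms unfolding fourier_gaussian_1 gaussian_scale
    by (simp add: field_simps power_divide)
qed

lemma integral_gaussian:
  assumes "t > 0"
  shows "(LBINT x. gaussian t (x::'a::euclidean_space)) = of_real ((sqrt (2 * pi) / t) ^ DIM('a))"
  using fourier_gaussian[OF assms, of "0::'a"] by (simp add: fourier_def gaussian_def)

lemma gaussian_tendsto_1: "(\<lambda>n. gaussian (1 / real (Suc n)) x) \<longlonglongrightarrow> 1"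
proof -
  have "(\<lambda>n. exp (- ((1 / real (Suc n) * norm x)\<^sup>2 / 2))) \<longlonglongrightarrow> exp (- ((0 * norm x)\<^sup>2 / 2))"
    by (intro tendsto_intros) (use LIMSEQ_inverse_real_of_nat in \<open>simp_all add: inverse_eq_divide\<close>)
  then show ?thesis unfolding gaussian_def using tendsto_of_real by fastforce
qed

lemma cmod_gaussian_le_1: "cmod (gaussian t x) \<le> 1"
  by (simp add: gaussian_def)

lemma fourier_cis_gaussian:
  "fourier (\<lambda>\<xi>. cis (x \<bullet> \<xi>) * gaussian t \<xi>) y = fourier (gaussian t) (y - x)"
  unfolding fourier_def
  by (simp add: mult.assoc[symmetric] cis_mult inner_diff_right inner_commute)

text \<open>A Gaussian with parameter t is inserted into the inversion integral. The multiplication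
  formula turns the result into an average of \<open>f\<close> over the points x + t z with Gaussian
  weight in z. As t tends to 0, dominated convergence applies to both forms; the second uses that
  \<open>f\<close> is bounded and continuous.\<close>

theorem fourier_inversion:
  fixes f :: "'a::euclidean_space \<Rightarrow> complex"
  assumes f: "integrable lborel f" "continuous_on UNIV f" "\<And>x. cmod (f x) \<le> C"
    and F: "integrable lborel (fourier f)"
  shows "(LBINT \<xi>. cis (x \<bullet> \<xi>) * fourier f \<xi>) = of_real ((2 * pi) ^ DIM('a)) * f x"
proof -
  let ?t = "\<lambda>n. 1 / real (Suc n)"
  have [measurable]: "f \<in> borel_measurable borel" using f by auto
  have "(\<lambda>n. \<integral>\<xi>. fourier f \<xi> * (cis (x \<bullet> \<xi>) * gaussian (?t n) \<xi>) \<partial>lborel) \<longlonglongrightarrow>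
      (LBINT \<xi>. fourier f \<xi> * (cis (x \<bullet> \<xi>) * 1))"
  proof (rule integral_dominated_convergence)
    show "integrable lborel (\<lambda>\<xi>. cmod (fourier f \<xi>))" using F by simp
    show "AE \<xi> in lborel. (\<lambda>n. fourier f \<xi> * (cis (x \<bullet> \<xi>) * gaussian (?t n) \<xi>)) \<longlonglongrightarrow> fourier f \<xi> * (cis (x \<bullet> \<xi>) * 1)"
      by (intro AE_I2 tendsto_mult tendsto_const gaussian_tendsto_1)
    show "AE \<xi> in lborel. norm (fourier f \<xi> * (cis (x \<bullet> \<xi>) * gaussian (?t n) \<xi>)) \<le> cmod (fourier f \<xi>)" for n
      by (intro AE_I2) (simp add: norm_mult mult_left_le cmod_gaussian_le_1 del: of_nat_Suc)
  qed measurable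
  moreover have "(LBINT \<xi>. fourier f \<xi> * (cis (x \<bullet> \<xi>) * gaussian t \<xi>)) =
      (LBINT z. of_real (sqrt (2 * pi) ^ DIM('a)) * (f (x + t *\<^sub>R z) * gaussian 1 z))" if t: "t > 0" for t
  proof -
    have "(LBINT \<xi>. fourier f \<xi> * (cis (x \<bullet> \<xi>) * gaussian t \<xi>)) =
        (LBINT y. f y * fourier (\<lambda>\<xi>. cis (x \<bullet> \<xi>) * gaussian t \<xi>) y)"
      using t by (intro fourier_multiplication_formula f integrable_cis_mult gaussian_integrable) (auto simp: inner_commute[of x])
    also have "\<dots> = (LBINT y. f y * (of_real ((sqrt (2 * pi) / t) ^ DIM('a)) * gaussian (1 / t) (y - x)))"
      unfolding fourier_cis_gaussian fourier_gaussian[OF t] ..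
    also have "\<dots> = \<bar>t\<bar> ^ DIM('a) *\<^sub>R (LBINT z. f (x + t *\<^sub>R z) * (of_real ((sqrt (2 * pi) / t) ^ DIM('a)) * gaussian (1 / t) (x + t *\<^sub>R z - x)))"
      using t by (intro integral_affine) auto
    also have "\<dots> = (LBINT z. of_real (sqrt (2 * pi) ^ DIM('a)) * (f (x + t *\<^sub>R z) * gaussian 1 z))"
      unfolding integral_scaleR_right[symmetric] using t
      by (intro Bochner_Integration.integral_cong) (simp_all add: gaussian_scale scaleR_conv_of_real power_divide)
    finally show ?thesis .
  qed
  ultimately have "(\<lambda>n. \<integral>z. of_real (sqrt (2 * pi) ^ DIM('a)) * (f (x + ?t n *\<^sub>R z) * gaussian 1 z) \<partial>lborel) \<longlonglongrightarrow>
      (LBINT \<xi>. cis (x \<bullet> \<xi>) * fourier f \<xi>)"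
    by (simp add: mult.commute)
  moreover have "(\<lambda>n. \<integral>z. of_real (sqrt (2 * pi) ^ DIM('a)) * (f (x + ?t n *\<^sub>R z) * gaussian 1 z) \<partial>lborel) \<longlonglongrightarrow>
      (LBINT z. of_real (sqrt (2 * pi) ^ DIM('a)) * (f x * gaussian 1 (z::'a)))"
  proof (rule integral_dominated_convergence)
    show "integrable lborel (\<lambda>z::'a. sqrt (2 * pi) ^ DIM('a) * (C * cmod (gaussian 1 z)))"
      using fourier_gaussian_1(1) by (intro integrable_mult_right integrable_norm)
    have t0: "?t \<longlonglongrightarrow> 0" using LIMSEQ_inverse_real_of_nat by (simp add: inverse_eq_divide)
    have "(\<lambda>n. f (x + ?t n *\<^sub>R z)) \<longlonglongrightarrow> f x" for z
    proof (rule continuous_on_tendsto_compose[OF f(2)])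
      have "(\<lambda>n. x + ?t n *\<^sub>R z) \<longlonglongrightarrow> x + 0 *\<^sub>R z" by (intro tendsto_intros t0)
      then show "(\<lambda>n. x + ?t n *\<^sub>R z) \<longlonglongrightarrow> x" by simp
    qed auto
    then show "AE z in lborel. (\<lambda>n. of_real (sqrt (2 * pi) ^ DIM('a)) * (f (x + ?t n *\<^sub>R z) * gaussian 1 z)) \<longlonglongrightarrow>
        of_real (sqrt (2 * pi) ^ DIM('a)) * (f x * gaussian 1 z)"
      by (intro AE_I2 tendsto_mult tendsto_const)
    show "AE z in lborel. norm (of_real (sqrt (2 * pi) ^ DIM('a)) * (f (x + ?t n *\<^sub>R z) * gaussian 1 z)) \<le>
        sqrt (2 * pi) ^ DIM('a) * (C * cmod (gaussian 1 z))" for n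
      using f(3) by (auto simp: norm_mult norm_power intro!: mult_left_mono mult_right_mono)
  qed measurable
  ultimately have "(LBINT \<xi>. cis (x \<bullet> \<xi>) * fourier f \<xi>) =
      (LBINT z. of_real (sqrt (2 * pi) ^ DIM('a)) * (f x * gaussian 1 (z::'a)))"
    by (rule LIMSEQ_unique)
  also have "\<dots> = of_real (sqrt (2 * pi) ^ DIM('a)) * (f x * (LBINT z. gaussian 1 (z::'a)))"
    by simp
  also have "\<dots> = of_real (sqrt (2 * pi) ^ DIM('a) * sqrt (2 * pi) ^ DIM('a)) * f x"
    by (subst integral_gaussian) simp_all
  also have "sqrt (2 * pi) ^ DIM('a) * sqrt (2 * pi) ^ DIM('a) = (2 * pi) ^ DIM('a)"
    by (subst power_mult_distrib[symmetric]) simp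
  finally show ?thesis .
qed

abbreviation l2_sq :: "('a::euclidean_space \<Rightarrow> complex) \<Rightarrow> ennreal" where
  "l2_sq f \<equiv> \<integral>\<^sup>+ x. ennreal ((cmod (f x))\<^sup>2) \<partial>lborel"

text \<open>The integral of the squared transform, damped by a Gaussian, is bounded through two uses
  of the multiplication formula by a double integral of |f(x)| |f'(y)| K(x + y) with K \<ge> 0 of
  mass (2 pi)^n. Replacing the product by half the sum of squares and integrating out the other
  variable gives the constant; Fatou's lemma removes the damping.\<close>

theorem bessel_inequality:
  fixes f :: "'a::euclidean_space \<Rightarrow> complex"
  assumes f: "integrable lborel f"
  shows "l2_sq (fourier f) \<le> ennreal ((2 * pi) ^ DIM('a)) * (l2_sq f)"
proof -
  let ?t = "\<lambda>n. 1 / real (Suc n)"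
  let ?N = "l2_sq f"
  let ?C = "\<integral>x. cmod (f x) \<partial>lborel"
  have [measurable]: "f \<in> borel_measurable borel" using f by auto
  \<comment> \<open>Reflection and conjugation make the transform of \<open>f'\<close> the complex
    conjugate of that of \<open>f\<close>.\<close>
  define f' where "f' y = cnj (f (- y))" for y
  have f'm [measurable]: "f' \<in> borel_measurable borel" unfolding f'_def[abs_def] by measurable
  have f': "integrable lborel f'"
    unfolding f'_def[abs_def] using integrable_affine[OF f, of "-1" 0] by (intro integrable_cnj) simp
  have cnjF: "cnj (fourier f \<xi>) = fourier f' \<xi>" for \<xi>
  proof -
    have "fourier f' \<xi> = \<bar>-1\<bar> ^ DIM('a) *\<^sub>R (LBINT x. cis (- ((0 + (-1) *\<^sub>R x) \<bullet> \<xi>)) * f' (0 + (-1) *\<^sub>R x))"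
      unfolding fourier_def by (intro integral_affine) auto
    also have "\<dots> = (LBINT x. cnj (cis (- (x \<bullet> \<xi>)) * f x))"
      by (simp add: f'_def cis_cnj)
    also have "\<dots> = cnj (fourier f \<xi>)" unfolding fourier_def by (rule Bochner_Integration.integral_cnj)
    finally show ?thesis ..
  qed
  have main: "(\<integral>\<^sup>+ \<xi>. ennreal ((cmod (fourier f \<xi>))\<^sup>2 * cmod (gaussian t \<xi>)) \<partial>lborel) \<le> ennreal ((2 * pi) ^ DIM('a)) * ?N"
    if t: "t > 0" for t
  proof -
    let ?c = "(sqrt (2 * pi) / t) ^ DIM('a)"
    \<comment> \<open>The transform of the damping Gaussian. Its mass is (2 pi)^n for every t, which
      is where the constant of the inequality comes from.\<close>
    define K where "K z = ?c * cmod (gaussian (1 / t) z)" for z :: 'a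
    have K0: "K z \<ge> 0" and Km [measurable]: "K \<in> borel_measurable borel" for z
      using t unfolding K_def[abs_def] by auto
    have Kint: "(\<integral>\<^sup>+ y. ennreal (K (x + y)) \<partial>lborel) = ennreal ((2 * pi) ^ DIM('a))" for x
    proof -
      have "(\<integral>\<^sup>+ y. ennreal (K (x + y)) \<partial>lborel) = (\<integral>\<^sup>+ y. ennreal (K y) \<partial>lborel)"
        by (subst nn_integral_affine[of "\<lambda>y. ennreal (K y)" 1 x]) auto
      also have "\<dots> = ennreal (LBINT y. K y)"
        unfolding K_def using t gaussian_integrable[of "1 / t", where 'a='a]
        by (intro nn_integral_eq_integral) (auto intro!: integrable_mult_right integrable_norm)
      also have "(LBINT y. K y) = ?c * (sqrt (2 * pi) * t) ^ DIM('a)"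
      proof -
        have "complex_of_real (\<integral>y. cmod (gaussian (1 / t) y) \<partial>(lborel :: 'a measure)) = (\<integral>y. gaussian (1 / t) y \<partial>(lborel :: 'a measure))"
          by (simp add: gaussian_def integral_complex_of_real)
        also have "\<dots> = of_real ((sqrt (2 * pi) * t) ^ DIM('a))" using t by (subst integral_gaussian) auto
        finally show ?thesis unfolding K_def by (simp only: of_real_eq_iff integral_mult_right_zero)
      qed
      also have "\<dots> = (2 * pi) ^ DIM('a)"
        using t by (subst power_mult_distrib[symmetric]) simp
      finally show ?thesis .
    qed
    have weight: "(\<integral>\<^sup>+ x. (\<integral>\<^sup>+ y. ennreal (1 / 2 * (cmod (g x))\<^sup>2) * ennreal (K (x + y)) \<partial>lborel) \<partial>lborel) =
        ennreal ((2 * pi) ^ DIM('a)) * (ennreal (1 / 2) * (l2_sq g))"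
      if [measurable]: "g \<in> borel_measurable borel" for g :: "'a \<Rightarrow> complex"
    proof -
      have "(\<integral>\<^sup>+ y. ennreal (1 / 2 * (cmod (g x))\<^sup>2) * ennreal (K (x + y)) \<partial>lborel) =
          ennreal ((2 * pi) ^ DIM('a)) * (ennreal (1 / 2) * ennreal ((cmod (g x))\<^sup>2))" for x
      proof -
        have half: "ennreal (1 / 2 * (cmod (g x))\<^sup>2) = ennreal (1 / 2) * ennreal ((cmod (g x))\<^sup>2)"
          by (rule ennreal_mult') simp
        show ?thesis unfolding half
          by (subst nn_integral_cmult, measurable) (simp only: Kint mult.commute)
      qed
      then show ?thesis by (simp only:) (subst nn_integral_cmult, measurable, subst nn_integral_cmult, measurable)
    qed
    define h where "h \<xi> = fourier f' \<xi> * gaussian t \<xi>" for \<xi>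
    have h: "integrable lborel h"
      unfolding h_def[abs_def] using t fourier_bound[OF f']
      by (intro integrable_bounded_mult gaussian_integrable) auto
    have Fh: "cmod (fourier h x) \<le> (LBINT y. cmod (f' y) * K (x + y))" for x
    proof -
      have "fourier h x = (LBINT \<xi>. fourier f' \<xi> * (cis ((- x) \<bullet> \<xi>) * gaussian t \<xi>))"
        by (simp add: fourier_def[of h] h_def mult_ac inner_commute)
      also have "\<dots> = (LBINT y. f' y * fourier (\<lambda>\<xi>. cis ((- x) \<bullet> \<xi>) * gaussian t \<xi>) y)"
        using t by (intro fourier_multiplication_formula f' integrable_cis_mult gaussian_integrable) (auto simp: inner_commute[of x])
      also have "\<dots> = (LBINT y. f' y * (of_real ?c * gaussian (1 / t) (y + x)))"
        unfolding fourier_cis_gaussian fourier_gaussian[OF t] by simp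
      finally have "cmod (fourier h x) \<le> (LBINT y. norm (f' y * (of_real ?c * gaussian (1 / t) (y + x))))"
        by simp
      also have "\<dots> = (LBINT y. cmod (f' y) * K (x + y))"
        using t by (simp add: K_def norm_mult add.commute norm_divide norm_power)
      finally show ?thesis .
    qed
    have intK: "integrable lborel (\<lambda>y. cmod (f' y) * K (x + y))" for x
    proof (rule Bochner_Integration.integrable_bound)
      show "integrable lborel (\<lambda>y. ?c * cmod (f' y))" using f' by simp
      show "AE y in lborel. norm (cmod (f' y) * K (x + y)) \<le> norm (?c * cmod (f' y))"
      proof (intro AE_I2)
        fix y
        have Kc: "K (x + y) \<le> ?c"
          unfolding K_def using t by (intro mult_left_le cmod_gaussian_le_1) simp
        from mult_left_mono[OF this, of "cmod (f' y)"] have "cmod (f' y) * K (x + y) \<le> ?c * cmod (f' y)"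
          by (simp only: norm_ge_zero mult.commute[of ?c])
        then show "norm (cmod (f' y) * K (x + y)) \<le> norm (?c * cmod (f' y))"
          using K0[of "x + y"] by simp
      qed
    qed measurable
    have eq: "(cmod (fourier f \<xi>))\<^sup>2 * cmod (gaussian t \<xi>) = Re (fourier f \<xi> * h \<xi>)" for \<xi>
    proof -
      have "fourier f \<xi> * h \<xi> = of_real ((cmod (fourier f \<xi>))\<^sup>2) * gaussian t \<xi>"
        unfolding h_def cnjF[symmetric] complex_norm_square by (simp only: mult.assoc)
      then show ?thesis by (simp add: gaussian_def)
    qed
    have intFh: "integrable lborel (\<lambda>\<xi>. fourier f \<xi> * h \<xi>)"
      using fourier_bound[OF f] by (intro integrable_bounded_mult h) auto
    have "(\<integral>\<^sup>+ \<xi>. ennreal ((cmod (fourier f \<xi>))\<^sup>2 * cmod (gaussian t \<xi>)) \<partial>lborel)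
        = ennreal (LBINT \<xi>. (cmod (fourier f \<xi>))\<^sup>2 * cmod (gaussian t \<xi>))"
    proof (rule nn_integral_eq_integral)
      show "integrable lborel (\<lambda>\<xi>. (cmod (fourier f \<xi>))\<^sup>2 * cmod (gaussian t \<xi>))"
        unfolding eq by (rule integrable_Re[OF intFh])
    qed auto
    also have "(LBINT \<xi>. (cmod (fourier f \<xi>))\<^sup>2 * cmod (gaussian t \<xi>)) = Re (LBINT \<xi>. fourier f \<xi> * h \<xi>)"
      unfolding eq by (rule Bochner_Integration.integral_Re[OF intFh])
    also have "(LBINT \<xi>. fourier f \<xi> * h \<xi>) = (LBINT x. f x * fourier h x)"
      by (rule fourier_multiplication_formula[OF f h])
    also have "ennreal (Re (LBINT x. f x * fourier h x)) \<le> ennreal (cmod (LBINT x. f x * fourier h x))"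
      by (intro ennreal_leI complex_Re_le_cmod)
    also have "\<dots> \<le> (\<integral>\<^sup>+ x. norm (f x * fourier h x) \<partial>lborel)"
      by (rule integral_norm_bound_ennreal)
         (subst mult.commute, use fourier_bound[OF h] h in \<open>intro integrable_bounded_mult f; auto\<close>)
    also have "\<dots> \<le> (\<integral>\<^sup>+ x. (\<integral>\<^sup>+ y. ennreal (cmod (f x) * (cmod (f' y) * K (x + y))) \<partial>lborel) \<partial>lborel)"
    proof (rule nn_integral_mono)
      fix x
      have "ennreal (norm (f x * fourier h x)) \<le> ennreal (cmod (f x) * (LBINT y. cmod (f' y) * K (x + y)))"
        using Fh by (auto simp: norm_mult intro!: ennreal_leI mult_left_mono)
      also have "\<dots> = ennreal (cmod (f x)) * (\<integral>\<^sup>+ y. ennreal (cmod (f' y) * K (x + y)) \<partial>lborel)"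
        using K0 by (subst nn_integral_eq_integral[OF intK]) (auto simp: ennreal_mult' integral_nonneg)
      also have "\<dots> = (\<integral>\<^sup>+ y. ennreal (cmod (f x) * (cmod (f' y) * K (x + y))) \<partial>lborel)"
        by (subst nn_integral_cmult[symmetric]) (auto simp: ennreal_mult')
      finally show "ennreal (norm (f x * fourier h x)) \<le> (\<integral>\<^sup>+ y. ennreal (cmod (f x) * (cmod (f' y) * K (x + y))) \<partial>lborel)" .
    qed
    also have "\<dots> \<le> (\<integral>\<^sup>+ x. (\<integral>\<^sup>+ y. ennreal (1 / 2 * (cmod (f x))\<^sup>2) * ennreal (K (x + y)) + ennreal (1 / 2 * (cmod (f' y))\<^sup>2) * ennreal (K (x + y)) \<partial>lborel) \<partial>lborel)"
    proof (intro nn_integral_mono)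
      fix x y
      have "cmod (f x) * cmod (f' y) \<le> 1 / 2 * (cmod (f x))\<^sup>2 + 1 / 2 * (cmod (f' y))\<^sup>2"
        using sum_squares_bound[of "cmod (f x)" "cmod (f' y)"] by simp
      from mult_right_mono[OF this K0[of "x + y"]]
      have "cmod (f x) * (cmod (f' y) * K (x + y)) \<le> 1 / 2 * (cmod (f x))\<^sup>2 * K (x + y) + 1 / 2 * (cmod (f' y))\<^sup>2 * K (x + y)"
        by (simp add: algebra_simps)
      then have "ennreal (cmod (f x) * (cmod (f' y) * K (x + y))) \<le> ennreal (1 / 2 * (cmod (f x))\<^sup>2 * K (x + y) + 1 / 2 * (cmod (f' y))\<^sup>2 * K (x + y))"
        by (rule ennreal_leI)
      also have "\<dots> = ennreal (1 / 2 * (cmod (f x))\<^sup>2) * ennreal (K (x + y)) + ennreal (1 / 2 * (cmod (f' y))\<^sup>2) * ennreal (K (x + y))"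
        using K0 by (simp only: ennreal_mult''[symmetric] ennreal_plus mult_nonneg_nonneg zero_le_power2 zero_le_divide_1_iff zero_le_numeral)
      finally show "ennreal (cmod (f x) * (cmod (f' y) * K (x + y))) \<le> \<dots>" .
    qed
    also have "\<dots> = (\<integral>\<^sup>+ x. (\<integral>\<^sup>+ y. ennreal (1 / 2 * (cmod (f x))\<^sup>2) * ennreal (K (x + y)) \<partial>lborel) \<partial>lborel)
        + (\<integral>\<^sup>+ x. (\<integral>\<^sup>+ y. ennreal (1 / 2 * (cmod (f' y))\<^sup>2) * ennreal (K (x + y)) \<partial>lborel) \<partial>lborel)"
      by (simp add: nn_integral_add)
    also have "(\<integral>\<^sup>+ x. (\<integral>\<^sup>+ y. ennreal (1 / 2 * (cmod (f' y))\<^sup>2) * ennreal (K (x + y)) \<partial>lborel) \<partial>lborel) =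
        (\<integral>\<^sup>+ y. (\<integral>\<^sup>+ x. ennreal (1 / 2 * (cmod (f' y))\<^sup>2) * ennreal (K (x + y)) \<partial>lborel) \<partial>lborel)"
      by (rule lborel_pair.Fubini') measurable
    also have "(\<integral>\<^sup>+ x. (\<integral>\<^sup>+ y. ennreal (1 / 2 * (cmod (f x))\<^sup>2) * ennreal (K (x + y)) \<partial>lborel) \<partial>lborel) =
        ennreal ((2 * pi) ^ DIM('a)) * (ennreal (1 / 2) * ?N)"
      by (rule weight) measurable
    also have "(\<integral>\<^sup>+ y. (\<integral>\<^sup>+ x. ennreal (1 / 2 * (cmod (f' y))\<^sup>2) * ennreal (K (x + y)) \<partial>lborel) \<partial>lborel) =
        ennreal ((2 * pi) ^ DIM('a)) * (ennreal (1 / 2) * (l2_sq f'))"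
    proof -
      have "(\<integral>\<^sup>+ x. ennreal (1 / 2 * (cmod (f' y))\<^sup>2) * ennreal (K (x + y)) \<partial>lborel) =
          (\<integral>\<^sup>+ x. ennreal (1 / 2 * (cmod (f' y))\<^sup>2) * ennreal (K (y + x)) \<partial>lborel)" for y
        by (simp only: add.commute)
      then show ?thesis using weight[OF f'm] by (simp only:)
    qed
    also have "l2_sq f' = ?N"
      by (subst nn_integral_affine[of _ "-1" 0]) (auto simp: f'_def)
    also have "ennreal ((2 * pi) ^ DIM('a)) * (ennreal (1 / 2) * ?N) + ennreal ((2 * pi) ^ DIM('a)) * (ennreal (1 / 2) * ?N)
       = ennreal ((2 * pi) ^ DIM('a)) * ?N"
    proof -
      have "ennreal (1 / 2) + ennreal (1 / 2) = 1" by (subst ennreal_plus[symmetric]) auto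
      then have "c * (ennreal (1 / 2) * N) + c * (ennreal (1 / 2) * N) = c * N" for c N :: ennreal
        by (metis distrib_left distrib_right mult_1)
      then show ?thesis .
    qed
    finally show ?thesis .
  qed
  have "l2_sq (fourier f) =
      (\<integral>\<^sup>+ \<xi>. liminf (\<lambda>n. ennreal ((cmod (fourier f \<xi>))\<^sup>2 * cmod (gaussian (?t n) \<xi>))) \<partial>lborel)"
  proof (intro nn_integral_cong)
    fix \<xi> :: 'a
    have "(\<lambda>n. (cmod (fourier f \<xi>))\<^sup>2 * cmod (gaussian (?t n) \<xi>)) \<longlonglongrightarrow> (cmod (fourier f \<xi>))\<^sup>2 * cmod 1"
      by (intro tendsto_mult tendsto_const tendsto_norm gaussian_tendsto_1)
    then have "(\<lambda>n. ennreal ((cmod (fourier f \<xi>))\<^sup>2 * cmod (gaussian (?t n) \<xi>))) \<longlonglongrightarrow> ennreal ((cmod (fourier f \<xi>))\<^sup>2)"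
      by (intro tendsto_ennrealI) simp
    then show "ennreal ((cmod (fourier f \<xi>))\<^sup>2) = liminf (\<lambda>n. ennreal ((cmod (fourier f \<xi>))\<^sup>2 * cmod (gaussian (?t n) \<xi>)))"
      by (intro lim_imp_Liminf[symmetric]) auto
  qed
  also have "\<dots> \<le> liminf (\<lambda>n. \<integral>\<^sup>+ \<xi>. ennreal ((cmod (fourier f \<xi>))\<^sup>2 * cmod (gaussian (?t n) \<xi>)) \<partial>lborel)"
    by (rule nn_integral_liminf) measurable
  also have "\<dots> \<le> liminf (\<lambda>n. ennreal ((2 * pi) ^ DIM('a)) * ?N)"
    by (intro Liminf_mono always_eventually allI main) auto
  also have "\<dots> = ennreal ((2 * pi) ^ DIM('a)) * ?N"
    by (simp add: Liminf_const)
  finally show ?thesis .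
qed

section \<open>Decay of Fourier transforms of test functions\<close>

abbreviation bracket :: "real \<Rightarrow> 'a::euclidean_space \<Rightarrow> real" where
  "bracket s \<xi> \<equiv> (1 + (norm \<xi>)\<^sup>2) powr s"

text \<open>Applied to a Fourier transform, this is the squared H^s norm up to the factor (2
  pi)^{-n}; the argument \<open>- s\<close> gives the quantity behind \<open>Hneg\<close> and
  \<open>hneg_norm\<close>.\<close>

abbreviation sobolev_sq :: "real \<Rightarrow> ('a::euclidean_space \<Rightarrow> complex) \<Rightarrow> ennreal" where
  "sobolev_sq s f \<equiv> \<integral>\<^sup>+ \<xi>. ennreal (bracket s \<xi> * (cmod (f \<xi>))\<^sup>2) \<partial>lborel"

text \<open>Each of the n factors 1/(1 + |\<xi>|^2) is bounded by the one-dimensional integrable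
  function 1/(1 + t^2) in one coordinate; this is why the exponent is the dimension.\<close>

lemma integrable_bracket: "integrable lborel (\<lambda>\<xi>::'a::euclidean_space. 1 / (1 + (norm \<xi>)\<^sup>2) ^ DIM('a))"
proof (rule Bochner_Integration.integrable_bound)
  have "integrable lborel (\<lambda>t::real. inverse (1 + t\<^sup>2))"
    using integrable_inverse_1_plus_square by (simp add: set_integrable_def einterval_def)
  then show "integrable lborel (\<lambda>\<xi>::'a. \<Prod>b\<in>Basis. inverse (1 + (\<xi> \<bullet> b)\<^sup>2))"
    by (intro lborel_prod_integrable(1))
  show "AE \<xi>::'a in lborel. norm (1 / (1 + (norm \<xi>)\<^sup>2) ^ DIM('a)) \<le> norm (\<Prod>b\<in>Basis. inverse (1 + (\<xi> \<bullet> b)\<^sup>2))"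
  proof (intro AE_I2)
    fix \<xi> :: 'a
    have pos: "1 + (norm \<xi>)\<^sup>2 > 0" by (rule add_pos_nonneg) auto
    have "(\<Prod>b\<in>(Basis::'a set). inverse (1 + (norm \<xi>)\<^sup>2)) \<le> (\<Prod>b\<in>Basis. inverse (1 + (\<xi> \<bullet> b)\<^sup>2))"
    proof (intro prod_mono conjI)
      fix b :: 'a assume "b \<in> Basis"
      then have "\<bar>\<xi> \<bullet> b\<bar> \<le> norm \<xi>" by (rule Basis_le_norm)
      then have "(\<xi> \<bullet> b)\<^sup>2 \<le> (norm \<xi>)\<^sup>2" by (metis abs_norm_cancel abs_le_square_iff)
      then show "inverse (1 + (norm \<xi>)\<^sup>2) \<le> inverse (1 + (\<xi> \<bullet> b)\<^sup>2)"
        by (intro le_imp_inverse_le) (auto intro: add_pos_nonneg)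
    qed (use pos in auto)
    moreover have "0 \<le> (\<Prod>b\<in>Basis. inverse (1 + (\<xi> \<bullet> b)\<^sup>2))" by (intro prod_nonneg) auto
    ultimately show "norm (1 / (1 + (norm \<xi>)\<^sup>2) ^ DIM('a)) \<le> norm (\<Prod>b\<in>Basis. inverse (1 + (\<xi> \<bullet> b)\<^sup>2))"
      using pos by (simp add: power_inverse inverse_eq_divide power_one_over)
  qed
qed simp

section \<open>Rules for the Fourier transform of integrable functions\<close>

lemma fourier_add:
  assumes "integrable lborel f" "integrable lborel g"
  shows "fourier (\<lambda>x. f x + g x) \<xi> = fourier f \<xi> + fourier g \<xi>"
  unfolding fourier_def using assms
  by (subst Bochner_Integration.integral_add[symmetric]) (auto intro!: integrable_cis_mult simp: distrib_left)

lemma fourier_cmult: "fourier (\<lambda>x. c * f x) \<xi> = c * fourier f \<xi>"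
  unfolding fourier_def by (subst integral_mult_right_zero[symmetric]) (simp add: mult_ac)

lemma fourier_sum:
  assumes "finite I" "\<And>i. i \<in> I \<Longrightarrow> integrable lborel (f i)"
  shows "fourier (\<lambda>x. \<Sum>i\<in>I. f i x) \<xi> = (\<Sum>i\<in>I. fourier (f i) \<xi>)"
  using assms
proof (induction I rule: finite_induct)
  case empty
  then show ?case by (simp add: fourier_def)
next
  case (insert i I)
  then show ?case by (simp add: fourier_add)
qed

lemma fourier_translate:
  fixes f :: "'a::euclidean_space \<Rightarrow> complex"
  assumes [measurable]: "f \<in> borel_measurable borel"
  shows "fourier (\<lambda>x. f (x + a)) \<xi> = cis (a \<bullet> \<xi>) * fourier f \<xi>"
proof -
  have "fourier f \<xi> = \<bar>1\<bar> ^ DIM('a) *\<^sub>R (LBINT x. cis (- ((a + 1 *\<^sub>R x) \<bullet> \<xi>)) * f (a + 1 *\<^sub>R x))"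
    unfolding fourier_def by (intro integral_affine) auto
  also have "\<dots> = (LBINT x. cis (- (a \<bullet> \<xi>)) * (cis (- (x \<bullet> \<xi>)) * f (x + a)))"
    by (simp add: inner_add_left cis_mult mult.assoc[symmetric] add.commute del: integral_mult_right_zero)
  also have "\<dots> = cis (- (a \<bullet> \<xi>)) * fourier (\<lambda>x. f (x + a)) \<xi>"
    by (simp add: fourier_def)
  finally show ?thesis by (simp add: mult.assoc[symmetric] cis_mult)
qed

lemma integral_uminus:
  fixes f :: "'a::euclidean_space \<Rightarrow> complex"
  assumes [measurable]: "f \<in> borel_measurable borel"
  shows "(LBINT x. f (- x)) = (LBINT x. f x)"
  by (subst integral_affine[of f "-1" 0]) auto

text \<open>The derivative of the transform of a translate is computed in two ways: through the
  phase factor multiplying \<open>fourier \<phi> \<xi>\<close>, and as a convolution of \<phi> with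
  a truncated character, where differentiation passes to \<open>g\<close>. Uniqueness of derivatives
  gives the formula.\<close>

lemma fourier_partial:
  fixes \<phi> :: "'a::euclidean_space \<Rightarrow> complex"
  assumes \<phi>: "test_fn U \<phi>" and b: "b \<in> Basis"
    and g: "\<And>x. ((\<lambda>t::real. \<phi> (x + t *\<^sub>R b)) has_vector_derivative g x) (at 0)" "test_fn U g"
  shows "fourier g \<xi> = \<i> * of_real (\<xi> \<bullet> b) * fourier \<phi> \<xi>"
proof -
  have [measurable]: "\<phi> \<in> borel_measurable borel" "g \<in> borel_measurable borel"
    using \<phi> g test_fn_measurable by auto
  have "bounded (csupp \<phi> \<union> csupp g)" using \<phi> g by (auto simp: test_fn_def compact_imp_bounded)
  then obtain R where R: "R > 0" "\<And>x. x \<in> csupp \<phi> \<union> csupp g \<Longrightarrow> norm x < R"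
    using bounded_pos_less by metis
  \<comment> \<open>The character is not integrable and has to be cut off. The radius R + 1 leaves
    room for shifts by t b with |t| < 1, so the cutoff does not change any of the integrals.\<close>
  define f where "f y = indicator (ball 0 (R + 1)) y *\<^sub>R cis (y \<bullet> \<xi>)" for y :: 'a
  have fi: "integrable lborel f"
    unfolding f_def[abs_def]
    by (rule integrableI_bounded_set_indicator[where B = 1]) (auto simp: emeasure_lborel_ball_finite[unfolded infinity_ennreal_def])
  have [measurable]: "f \<in> borel_measurable borel" using fi by auto
  have F: "(LBINT y. h (t *\<^sub>R b - y) * f y) = cis ((t *\<^sub>R b) \<bullet> \<xi>) * fourier h \<xi>"
    if "\<bar>t\<bar> < 1" and h: "h \<in> borel_measurable borel" "\<And>x. h x \<noteq> 0 \<Longrightarrow> norm x < R" for t and h :: "'a \<Rightarrow> complex"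
  proof -
    have "h (t *\<^sub>R b - y) * f y = h (t *\<^sub>R b - y) * cis (y \<bullet> \<xi>)" for y
    proof (cases "h (t *\<^sub>R b - y) = 0")
      case False
      then have "norm (t *\<^sub>R b - y) < R" by (rule h(2))
      moreover have "norm y \<le> norm (t *\<^sub>R b) + norm (t *\<^sub>R b - y)"
        using norm_triangle_ineq4[of "t *\<^sub>R b" "t *\<^sub>R b - y"] by simp
      moreover have "norm (t *\<^sub>R b) < 1" using that(1) b by simp
      ultimately have "y \<in> ball 0 (R + 1)" by simp
      then show ?thesis by (simp add: f_def)
    qed simp
    then have "(LBINT y. h (t *\<^sub>R b - y) * f y) = (LBINT y. h (t *\<^sub>R b - y) * cis (y \<bullet> \<xi>))"
      by (simp only:)
    also have "\<dots> = (LBINT y. h (y + t *\<^sub>R b) * cis (- (y \<bullet> \<xi>)))"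
      using h(1) by (subst integral_uminus[symmetric]) (auto simp: add.commute)
    also have "\<dots> = cis ((t *\<^sub>R b) \<bullet> \<xi>) * fourier h \<xi>"
      by (subst fourier_translate[OF h(1), symmetric]) (simp add: fourier_def mult.commute)
    finally show ?thesis .
  qed
  have "((\<lambda>t. \<integral>y. \<phi> (0 + t *\<^sub>R b - y) * f y \<partial>lborel) has_vector_derivative (LBINT y. g (0 - y) * f y)) (at 0)"
    by (rule convolution_has_partial[OF \<phi> b fi g])
  moreover have "(LBINT y. g (0 - y) * f y) = fourier g \<xi>"
    using F[of 0 g] R(2) not_in_csupp[of _ g] by auto
  ultimately have "((\<lambda>t. \<integral>y. \<phi> (0 + t *\<^sub>R b - y) * f y \<partial>lborel) has_vector_derivative fourier g \<xi>) (at 0)"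
    by simp
  then have "((\<lambda>t. cis ((t *\<^sub>R b) \<bullet> \<xi>) * fourier \<phi> \<xi>) has_vector_derivative fourier g \<xi>) (at 0)"
  proof (rule has_vector_derivative_transform_within_open[where S = "ball 0 1"])
    show "(LBINT y. \<phi> (0 + t *\<^sub>R b - y) * f y) = cis ((t *\<^sub>R b) \<bullet> \<xi>) * fourier \<phi> \<xi>" if "t \<in> ball 0 1" for t
      using F[of t \<phi>] R(2) not_in_csupp[of _ \<phi>] that by auto
  qed auto
  moreover have "((\<lambda>t. cis ((t *\<^sub>R b) \<bullet> \<xi>) * fourier \<phi> \<xi>) has_vector_derivative (\<i> * of_real (\<xi> \<bullet> b) * fourier \<phi> \<xi>)) (at 0)"
  proof -
    have "((\<lambda>t. exp (t *\<^sub>R (\<i> * of_real (\<xi> \<bullet> b)))) has_vector_derivative \<i> * of_real (\<xi> \<bullet> b) * exp (0 *\<^sub>R (\<i> * of_real (\<xi> \<bullet> b)))) (at 0)"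
      by (rule exp_scaleR_has_vector_derivative_left)
    from has_vector_derivative_mult_left[OF this, of "fourier \<phi> \<xi>"]
    show ?thesis by (simp add: cis_conv_exp scaleR_conv_of_real mult_ac inner_commute)
  qed
  ultimately show ?thesis by (rule vector_derivative_unique_at)
qed

lemma test_fn_sum:
  "finite I \<Longrightarrow> (\<And>i. i \<in> I \<Longrightarrow> test_fn U (f i)) \<Longrightarrow> test_fn U (\<lambda>x. \<Sum>i\<in>I. f i x)"
proof (induction I rule: finite_induct)
  case empty
  show ?case by (rule test_fnI[OF _ compact_empty]) (auto intro: smooth_fn_const)
qed (auto intro: test_fn_add)

lemma fourier_one_minus_laplacian:
  fixes \<phi> :: "'a::euclidean_space \<Rightarrow> complex"
  assumes \<phi>: "test_fn U \<phi>"
  obtains \<psi> where "test_fn U \<psi>" "\<And>\<xi>. fourier \<psi> \<xi> = of_real (1 + (norm \<xi>)\<^sup>2) * fourier \<phi> \<xi>"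
proof -
  have "\<exists>h. test_fn U h \<and> (\<forall>\<xi>. fourier h \<xi> = - (of_real ((\<xi> \<bullet> b)\<^sup>2) * fourier \<phi> \<xi>))" if b: "b \<in> Basis" for b
  proof -
    obtain g where g: "\<And>x. ((\<lambda>t::real. \<phi> (x + t *\<^sub>R b)) has_vector_derivative g x) (at 0)" "test_fn U g"
      using test_fn_partial[OF \<phi> b] by metis
    obtain h where h: "\<And>x. ((\<lambda>t::real. g (x + t *\<^sub>R b)) has_vector_derivative h x) (at 0)" "test_fn U h"
      using test_fn_partial[OF g(2) b] by metis
    have "fourier h \<xi> = - (of_real ((\<xi> \<bullet> b)\<^sup>2) * fourier \<phi> \<xi>)" for \<xi>
      unfolding fourier_partial[OF g(2) b h] fourier_partial[OF \<phi> b g]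
      by (simp add: power2_eq_square mult_ac)
    with h show ?thesis by blast
  qed
  then obtain h where h: "\<And>b. b \<in> Basis \<Longrightarrow> test_fn U (h b)"
    "\<And>b \<xi>. b \<in> Basis \<Longrightarrow> fourier (h b) \<xi> = - (of_real ((\<xi> \<bullet> b)\<^sup>2) * fourier \<phi> \<xi>)" by metis
  let ?\<psi> = "\<lambda>x. \<phi> x + (-1) * (\<Sum>b\<in>Basis. h b x)"
  have ts: "test_fn U (\<lambda>x. \<Sum>b\<in>Basis. h b x)" by (rule test_fn_sum) (auto intro: h)
  have t: "test_fn U ?\<psi>" by (intro test_fn_add \<phi> test_fn_cmult ts)
  have "fourier ?\<psi> \<xi> = of_real (1 + (norm \<xi>)\<^sup>2) * fourier \<phi> \<xi>" for \<xi>
  proof -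
    have "fourier ?\<psi> \<xi> = fourier \<phi> \<xi> + (-1) * (\<Sum>b\<in>Basis. fourier (h b) \<xi>)"
      using h by (subst fourier_add, intro test_fn_integrable[OF \<phi>], intro test_fn_integrable[OF test_fn_cmult[OF ts]],
        subst fourier_cmult, subst fourier_sum) (auto intro: test_fn_integrable)
    also have "\<dots> = fourier \<phi> \<xi> + (\<Sum>b\<in>Basis. of_real ((\<xi> \<bullet> b)\<^sup>2)) * fourier \<phi> \<xi>"
      by (simp add: h sum_negf sum_distrib_right)
    also have "(\<Sum>b\<in>Basis. complex_of_real ((\<xi> \<bullet> b)\<^sup>2)) = of_real ((norm \<xi>)\<^sup>2)"
      by (subst power2_norm_eq_inner, subst euclidean_inner) (simp add: power2_eq_square)
    finally show ?thesis by (simp add: algebra_simps)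
  qed
  with t show ?thesis by (rule that)
qed

text \<open>The weighted transform is the transform of another test function, namely (1 -
  \<Delta>)^k applied to \<phi>, and transforms of integrable functions are bounded.\<close>

lemma fourier_test_fn_decay:
  assumes "test_fn U \<phi>"
  obtains C where "C > 0" "\<And>\<xi>. (1 + (norm \<xi>)\<^sup>2) ^ k * cmod (fourier \<phi> \<xi>) \<le> C"
proof -
  have "\<exists>\<psi>. test_fn U \<psi> \<and> (\<forall>\<xi>. fourier \<psi> \<xi> = of_real ((1 + (norm \<xi>)\<^sup>2) ^ k) * fourier \<phi> \<xi>)"
  proof (induction k)
    case 0
    show ?case using assms by auto
  next
    case (Suc k)
    then obtain \<psi> where \<psi>: "test_fn U \<psi>" "\<And>\<xi>. fourier \<psi> \<xi> = of_real ((1 + (norm \<xi>)\<^sup>2) ^ k) * fourier \<phi> \<xi>" by blast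
    obtain \<psi>' where "test_fn U \<psi>'" "\<And>\<xi>. fourier \<psi>' \<xi> = of_real (1 + (norm \<xi>)\<^sup>2) * fourier \<psi> \<xi>"
      using fourier_one_minus_laplacian[OF \<psi>(1)] by metis
    with \<psi> show ?case by (intro exI[of _ \<psi>']) (simp add: mult.assoc)
  qed
  then obtain \<psi> where \<psi>: "test_fn U \<psi>" "\<And>\<xi>. fourier \<psi> \<xi> = of_real ((1 + (norm \<xi>)\<^sup>2) ^ k) * fourier \<phi> \<xi>" by blast
  have "(1 + (norm \<xi>)\<^sup>2) ^ k * cmod (fourier \<phi> \<xi>) \<le> (LBINT x. cmod (\<psi> x)) + 1" for \<xi>
  proof -
    have nn: "0 \<le> (1 + (norm \<xi>)\<^sup>2) ^ k" by (intro zero_le_power add_nonneg_nonneg) auto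
    have "cmod (fourier \<psi> \<xi>) = (1 + (norm \<xi>)\<^sup>2) ^ k * cmod (fourier \<phi> \<xi>)"
      unfolding \<psi>(2) norm_mult norm_of_real using nn by simp
    then show ?thesis using fourier_bound[OF test_fn_integrable[OF \<psi>(1)], of \<xi>] by linarith
  qed
  moreover have "(LBINT x. cmod (\<psi> x)) + 1 > 0" by (intro add_nonneg_pos integral_nonneg) auto
  ultimately show ?thesis using that by blast
qed

lemma bracket_ge_1: "(1 + (norm \<xi>)\<^sup>2) ^ k \<ge> 1"
  by (rule one_le_power) simp

lemma integrable_fourier_test_fn:
  fixes \<phi> :: "'a::euclidean_space \<Rightarrow> complex"
  assumes "test_fn U \<phi>"
  shows "integrable lborel (\<lambda>\<xi>. (1 + (norm \<xi>)\<^sup>2) ^ k * cmod (fourier \<phi> \<xi>))"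
    and "integrable lborel (\<lambda>\<xi>. (1 + (norm \<xi>)\<^sup>2) ^ k * (cmod (fourier \<phi> \<xi>))\<^sup>2)"
    and "integrable lborel (fourier \<phi>)"
proof -
  have [measurable]: "\<phi> \<in> borel_measurable borel" using assms by (rule test_fn_measurable)
  have main: "integrable lborel (\<lambda>\<xi>. (1 + (norm \<xi>)\<^sup>2) ^ k * cmod (fourier \<phi> \<xi>))" for k
  proof -
    \<comment> \<open>The surplus decay of order \<open>DIM('a)\<close> leaves exactly the
      integrable factor of \<open>integrable_bracket\<close>.\<close>
    obtain C where C: "C > 0" "\<And>\<xi>. (1 + (norm \<xi>)\<^sup>2) ^ (k + DIM('a)) * cmod (fourier \<phi> \<xi>) \<le> C"
      using fourier_test_fn_decay[OF assms] by metis
    show ?thesis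
    proof (rule Bochner_Integration.integrable_bound)
      show "integrable lborel (\<lambda>\<xi>::'a. C * (1 / (1 + (norm \<xi>)\<^sup>2) ^ DIM('a)))"
        by (intro integrable_mult_right integrable_bracket)
      show "AE \<xi> in lborel. norm ((1 + (norm \<xi>)\<^sup>2) ^ k * cmod (fourier \<phi> \<xi>)) \<le> norm (C * (1 / (1 + (norm \<xi>)\<^sup>2) ^ DIM('a)))"
      proof (intro AE_I2)
        fix \<xi> :: 'a
        have p: "(1 + (norm \<xi>)\<^sup>2) ^ m > 0" for m using bracket_ge_1[of \<xi> m] by linarith
        have "(1 + (norm \<xi>)\<^sup>2) ^ k * cmod (fourier \<phi> \<xi>) \<le> C / (1 + (norm \<xi>)\<^sup>2) ^ DIM('a)"
          using C(2)[of \<xi>] p[of "DIM('a)"] by (simp add: power_add pos_le_divide_eq mult_ac)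
        then show "norm ((1 + (norm \<xi>)\<^sup>2) ^ k * cmod (fourier \<phi> \<xi>)) \<le> norm (C * (1 / (1 + (norm \<xi>)\<^sup>2) ^ DIM('a)))"
          using p C(1) by (simp add: abs_mult)
      qed
    qed measurable
  qed
  show "integrable lborel (\<lambda>\<xi>. (1 + (norm \<xi>)\<^sup>2) ^ k * cmod (fourier \<phi> \<xi>))" by (rule main)
  show "integrable lborel (fourier \<phi>)"
    using main[of 0] by (subst integrable_norm_iff[symmetric]) auto
  obtain C where C: "C > 0" "\<And>\<xi>. (1 + (norm \<xi>)\<^sup>2) ^ 0 * cmod (fourier \<phi> \<xi>) \<le> C"
    using fourier_test_fn_decay[OF assms] by metis
  show "integrable lborel (\<lambda>\<xi>. (1 + (norm \<xi>)\<^sup>2) ^ k * (cmod (fourier \<phi> \<xi>))\<^sup>2)"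
  proof (rule Bochner_Integration.integrable_bound)
    show "integrable lborel (\<lambda>\<xi>. C * ((1 + (norm \<xi>)\<^sup>2) ^ k * cmod (fourier \<phi> \<xi>)))"
      by (intro integrable_mult_right main)
    show "AE \<xi> in lborel. norm ((1 + (norm \<xi>)\<^sup>2) ^ k * (cmod (fourier \<phi> \<xi>))\<^sup>2) \<le> norm (C * ((1 + (norm \<xi>)\<^sup>2) ^ k * cmod (fourier \<phi> \<xi>)))"
    proof (intro AE_I2)
      fix \<xi> :: 'a
      have p: "(1 + (norm \<xi>)\<^sup>2) ^ k \<ge> 0" using bracket_ge_1[of \<xi> k] by linarith
      have "((1 + (norm \<xi>)\<^sup>2) ^ k * cmod (fourier \<phi> \<xi>)) * cmod (fourier \<phi> \<xi>) \<le> ((1 + (norm \<xi>)\<^sup>2) ^ k * cmod (fourier \<phi> \<xi>)) * C"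
        using C(2)[of \<xi>] p by (intro mult_left_mono) auto
      then show "norm ((1 + (norm \<xi>)\<^sup>2) ^ k * (cmod (fourier \<phi> \<xi>))\<^sup>2) \<le> norm (C * ((1 + (norm \<xi>)\<^sup>2) ^ k * cmod (fourier \<phi> \<xi>)))"
        using p C(1) by (simp add: power2_eq_square mult_ac abs_mult)
    qed
  qed measurable
qed

lemma fourier_inversion_test_fn:
  fixes \<phi> :: "'a::euclidean_space \<Rightarrow> complex"
  assumes "test_fn U \<phi>"
  shows "(LBINT \<xi>. cis (x \<bullet> \<xi>) * fourier \<phi> \<xi>) = of_real ((2 * pi) ^ DIM('a)) * \<phi> x"
  using test_fn_bounded[OF assms]
  by (metis fourier_inversion test_fn_integrable[OF assms] test_fn_continuous[OF assms] integrable_fourier_test_fn(3)[OF assms])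

section \<open>Sobolev norms and distributional pairings\<close>

text \<open>Based on |a + b|^2 \<le> 2 |a|^2 + 2 |b|^2, which avoids square roots in
  \<open>ennreal\<close>; the price is the factor 2 in the later norm inequalities. The weight is
  general in order to serve plain L2 norms, Sobolev weights and indicator functions alike.\<close>

lemma nn_integral_weighted_add:
  fixes f g :: "'a \<Rightarrow> complex" and w :: "'a \<Rightarrow> real"
  assumes [measurable]: "f \<in> borel_measurable M" "g \<in> borel_measurable M" "w \<in> borel_measurable M"
    and w: "\<And>x. w x \<ge> 0"
  shows "(\<integral>\<^sup>+ x. ennreal (w x * (cmod (f x + c * g x))\<^sup>2) \<partial>M) \<le>
    ennreal 2 * (\<integral>\<^sup>+ x. ennreal (w x * (cmod (f x))\<^sup>2) \<partial>M) +
    ennreal (2 * (cmod c)\<^sup>2) * (\<integral>\<^sup>+ x. ennreal (w x * (cmod (g x))\<^sup>2) \<partial>M)"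
proof -
  have pt: "w x * (cmod (f x + c * g x))\<^sup>2 \<le> 2 * (w x * (cmod (f x))\<^sup>2) + (2 * (cmod c)\<^sup>2) * (w x * (cmod (g x))\<^sup>2)" for x
  proof -
    have "cmod (f x + c * g x) \<le> cmod (f x) + cmod c * cmod (g x)"
      using norm_triangle_ineq[of "f x" "c * g x"] by (simp add: norm_mult)
    then have "(cmod (f x + c * g x))\<^sup>2 \<le> (cmod (f x) + cmod c * cmod (g x))\<^sup>2"
      by (intro power_mono) auto
    also have "\<dots> \<le> 2 * (cmod (f x))\<^sup>2 + 2 * (cmod c * cmod (g x))\<^sup>2"
      using sum_squares_bound[of "cmod (f x)" "cmod c * cmod (g x)"] by (simp add: power2_sum)
    finally have "w x * (cmod (f x + c * g x))\<^sup>2 \<le> w x * (2 * (cmod (f x))\<^sup>2 + 2 * (cmod c * cmod (g x))\<^sup>2)"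
      using w by (intro mult_left_mono)
    then show ?thesis by (simp add: algebra_simps power_mult_distrib)
  qed
  have "(\<integral>\<^sup>+ x. ennreal (w x * (cmod (f x + c * g x))\<^sup>2) \<partial>M) \<le>
      (\<integral>\<^sup>+ x. ennreal 2 * ennreal (w x * (cmod (f x))\<^sup>2) + ennreal (2 * (cmod c)\<^sup>2) * ennreal (w x * (cmod (g x))\<^sup>2) \<partial>M)"
  proof (intro nn_integral_mono)
    fix x
    have "ennreal 2 * ennreal (w x * (cmod (f x))\<^sup>2) + ennreal (2 * (cmod c)\<^sup>2) * ennreal (w x * (cmod (g x))\<^sup>2)
       = ennreal (2 * (w x * (cmod (f x))\<^sup>2) + (2 * (cmod c)\<^sup>2) * (w x * (cmod (g x))\<^sup>2))"
      using w by (subst ennreal_plus) (auto simp: ennreal_mult)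
    then show "ennreal (w x * (cmod (f x + c * g x))\<^sup>2) \<le>
        ennreal 2 * ennreal (w x * (cmod (f x))\<^sup>2) + ennreal (2 * (cmod c)\<^sup>2) * ennreal (w x * (cmod (g x))\<^sup>2)"
      using ennreal_leI[OF pt[of x]] by simp
  qed
  also have "\<dots> = ennreal 2 * (\<integral>\<^sup>+ x. ennreal (w x * (cmod (f x))\<^sup>2) \<partial>M) +
    ennreal (2 * (cmod c)\<^sup>2) * (\<integral>\<^sup>+ x. ennreal (w x * (cmod (g x))\<^sup>2) \<partial>M)"
    by (subst nn_integral_add) (auto simp: nn_integral_cmult)
  finally show ?thesis .
qed

lemma nn_integral_weighted_add_finite:
  fixes f g :: "'a \<Rightarrow> complex" and w :: "'a \<Rightarrow> real"
  assumes "f \<in> borel_measurable M" "g \<in> borel_measurable M" "w \<in> borel_measurable M"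
    and "\<And>x. w x \<ge> 0"
    and "(\<integral>\<^sup>+ x. ennreal (w x * (cmod (f x))\<^sup>2) \<partial>M) < \<infinity>" "(\<integral>\<^sup>+ x. ennreal (w x * (cmod (g x))\<^sup>2) \<partial>M) < \<infinity>"
  shows "(\<integral>\<^sup>+ x. ennreal (w x * (cmod (f x + c * g x))\<^sup>2) \<partial>M) < \<infinity>"
  by (rule le_less_trans[OF nn_integral_weighted_add[OF assms(1-4)]])
     (use assms(5,6) in \<open>simp add: ennreal_mult_eq_top_iff less_top[symmetric]\<close>)

section \<open>The L2 Fourier transform and the spaces H^s\<close>

lemma L2fun_measurable: "L2fun u \<Longrightarrow> u \<in> borel_measurable borel"
  by (simp add: L2fun_def)

lemma L2fun_lincomb:
  assumes "L2fun u" "L2fun v" shows "L2fun (\<lambda>x. u x + c * v x)"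
proof -
  have [measurable]: "u \<in> borel_measurable borel" "v \<in> borel_measurable borel"
    using assms by (auto simp: L2fun_def)
  show ?thesis
    using nn_integral_weighted_add_finite[of u lborel v "\<lambda>_. 1" c] assms by (simp add: L2fun_def)
qed

lemma L2fun_indicator:
  assumes "L2fun u" and [measurable]: "A \<in> sets borel"
  shows "L2fun (\<lambda>x. indicator A x * u x)"
proof -
  have [measurable]: "u \<in> borel_measurable borel" using assms by (simp add: L2fun_def)
  have "l2_sq (\<lambda>x. indicator A x * u x) \<le> l2_sq u"
    by (intro nn_integral_mono ennreal_leI) (simp add: indicator_def)
  with assms(1) show ?thesis by (simp add: L2fun_def less_top[symmetric] top_unique) (metis neq_top_trans)
qed

lemma L2_bounded_support_integrable:
  fixes u :: "'a::euclidean_space \<Rightarrow> complex"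
  assumes "L2fun u" "AE x in lborel. x \<notin> ball 0 R \<longrightarrow> u x = 0"
  shows "integrable lborel u"
proof -
  have [measurable]: "u \<in> borel_measurable borel" using assms by (simp add: L2fun_def)
  have u2: "integrable lborel (\<lambda>x. (cmod (u x))\<^sup>2)"
    using assms(1) by (intro integrableI_nonneg) (auto simp: L2fun_def)
  have ib: "integrable lborel (\<lambda>x::'a. indicator (ball 0 R) x :: real)"
    using emeasure_lborel_ball_finite by (intro integrable_real_indicator) auto
  show ?thesis
  proof (rule Bochner_Integration.integrable_bound[OF Bochner_Integration.integrable_add[OF ib u2]])
    show "AE x in lborel. norm (u x) \<le> norm (indicator (ball 0 R) x + (cmod (u x))\<^sup>2)"
      using assms(2)
    proof eventually_elim
      case (elim x)
      show ?case
      proof (cases "x \<in> ball 0 R")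
        case True
        have "2 * cmod (u x) \<le> 1 + (cmod (u x))\<^sup>2"
          using sum_squares_bound[of 1 "cmod (u x)"] by simp
        then have "cmod (u x) \<le> 1 + (cmod (u x))\<^sup>2" using norm_ge_zero[of "u x"] by linarith
        then show ?thesis using True by (simp add: abs_of_nonneg)
      next
        case False
        then show ?thesis using elim by simp
      qed
    qed
  qed measurable
qed

lemma L2fun_ball_integrable: "L2fun u \<Longrightarrow> integrable lborel (\<lambda>x. indicator (ball 0 R) x * u x)"
  by (rule L2_bounded_support_integrable[OF L2fun_indicator]) (auto simp: indicator_def)

lemma L2fun_fourier:
  assumes "integrable lborel f" "L2fun f"
  shows "L2fun (fourier f)"
proof -
  have [measurable]: "f \<in> borel_measurable borel" using assms by (simp add: L2fun_def)
  show ?thesis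
    using le_less_trans[OF bessel_inequality[OF assms(1)]] assms(2)
    by (simp add: L2fun_def ennreal_mult_less_top)
qed

lemma fourier_cong_AE:
  assumes "AE x in lborel. f x = g x" and [measurable]: "f \<in> borel_measurable borel" "g \<in> borel_measurable borel"
  shows "fourier f \<xi> = fourier g \<xi>"
  unfolding fourier_def by (intro integral_cong_AE) (use assms(1) in auto)

text \<open>Truncation to a large ball changes \<open>f\<close> only on a null set, so the limit
  defining the L2 transform is eventually constant. This identifies \<open>FT\<close>, up to null
  sets, with a concrete integral.\<close>

lemma fourier_L2_bounded_support:
  fixes f :: "'a::euclidean_space \<Rightarrow> complex"
  assumes "L2fun f" "AE x in lborel. x \<notin> ball 0 R \<longrightarrow> f x = 0"
  shows "fourier_L2 f (fourier f)"
proof -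
  have [measurable]: "f \<in> borel_measurable borel" using assms by (simp add: L2fun_def)
  have int: "integrable lborel f" by (rule L2_bounded_support_integrable[OF assms])
  have "fourier (\<lambda>x. indicator (ball 0 R') x * f x) \<xi> = fourier f \<xi>" if "R' \<ge> R" for R' \<xi>
    by (rule fourier_cong_AE) (use assms(2) that in \<open>auto simp: indicator_def elim!: eventually_mono\<close>)
  then have "\<forall>\<^sub>F R' in at_top. (l2_sq (\<lambda>\<xi>. fourier f \<xi> - fourier (\<lambda>x. indicator (ball 0 R') x * f x) \<xi>)) = 0"
    by (intro eventually_at_top_linorderI[of R]) auto
  then have "((\<lambda>R'. l2_sq (\<lambda>\<xi>. fourier f \<xi> - fourier (\<lambda>x. indicator (ball 0 R') x * f x) \<xi>)) \<longlongrightarrow> 0) at_top"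
    by (rule tendsto_eventually)
  then show ?thesis
    using assms(1) L2fun_fourier[OF int assms(1)] by (simp add: fourier_L2_def)
qed

lemma fourier_L2_unique:
  assumes "fourier_L2 u g" "fourier_L2 u g'"
  shows "AE \<xi> in lborel. g \<xi> = g' \<xi>"
proof -
  let ?f = "\<lambda>R. fourier (\<lambda>x. indicator (ball 0 R) x * u x)"
  have [measurable]: "u \<in> borel_measurable borel" "g \<in> borel_measurable borel" "g' \<in> borel_measurable borel"
    using assms by (auto simp: fourier_L2_def L2fun_def)
  have "l2_sq (\<lambda>\<xi>. g \<xi> - g' \<xi>) \<le> ennreal 2 * 0 + ennreal 2 * 0"
  proof (rule tendsto_lowerbound)
    show "((\<lambda>R. ennreal 2 * (l2_sq (\<lambda>\<xi>. g \<xi> - ?f R \<xi>)) +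
        ennreal 2 * (l2_sq (\<lambda>\<xi>. g' \<xi> - ?f R \<xi>))) \<longlongrightarrow> ennreal 2 * 0 + ennreal 2 * 0) at_top"
      using assms unfolding fourier_L2_def by (intro tendsto_add ennreal_tendsto_cmult) auto
    have "l2_sq (\<lambda>\<xi>. g \<xi> - g' \<xi>) \<le> ennreal 2 * (l2_sq (\<lambda>\<xi>. g \<xi> - ?f R \<xi>)) +
        ennreal 2 * (l2_sq (\<lambda>\<xi>. g' \<xi> - ?f R \<xi>))" for R
    proof -
      have "(\<lambda>\<xi>. g \<xi> - ?f R \<xi>) \<in> borel_measurable lborel" "(\<lambda>\<xi>. g' \<xi> - ?f R \<xi>) \<in> borel_measurable lborel"
        using L2fun_measurable[OF L2fun_indicator[of u "ball 0 R"]] assms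
        by (auto simp: fourier_L2_def intro!: borel_measurable_diff fourier_measurable)
      from nn_integral_weighted_add[OF this, of "\<lambda>_. 1" "-1"] show ?thesis by simp
    qed
    then show "\<forall>\<^sub>F R in at_top. (l2_sq (\<lambda>\<xi>. g \<xi> - g' \<xi>)) \<le> ennreal 2 * (l2_sq (\<lambda>\<xi>. g \<xi> - ?f R \<xi>)) +
        ennreal 2 * (l2_sq (\<lambda>\<xi>. g' \<xi> - ?f R \<xi>))"
      by simp
  qed simp
  then have "l2_sq (\<lambda>\<xi>. g \<xi> - g' \<xi>) = 0" by simp
  then show ?thesis by (subst (asm) nn_integral_0_iff_AE) auto
qed

lemma fourier_L2_lincomb:
  assumes u: "fourier_L2 u g" and v: "fourier_L2 v h"
  shows "fourier_L2 (\<lambda>x. u x + c * v x) (\<lambda>\<xi>. g \<xi> + c * h \<xi>)"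
proof -
  let ?f = "\<lambda>u R. fourier (\<lambda>x. indicator (ball 0 R) x * u x)"
  have [measurable]: "u \<in> borel_measurable borel" "v \<in> borel_measurable borel" "g \<in> borel_measurable borel" "h \<in> borel_measurable borel"
    using assms by (auto simp: fourier_L2_def L2fun_def)
  have L2: "L2fun u" "L2fun v" "L2fun g" "L2fun h" using assms by (auto simp: fourier_L2_def)
  have F: "?f (\<lambda>x. u x + c * v x) R \<xi> = ?f u R \<xi> + c * ?f v R \<xi>" for R \<xi>
  proof -
    have "?f (\<lambda>x. u x + c * v x) R \<xi> = fourier (\<lambda>x. indicator (ball 0 R) x * u x + c * (indicator (ball 0 R) x * v x)) \<xi>"
      by (simp add: algebra_simps)
    also have "\<dots> = ?f u R \<xi> + c * ?f v R \<xi>"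
      using L2fun_ball_integrable[OF L2(1)] L2fun_ball_integrable[OF L2(2)]
      by (subst fourier_add) (auto simp: fourier_cmult)
    finally show ?thesis .
  qed
  have "((\<lambda>R. l2_sq (\<lambda>\<xi>. g \<xi> + c * h \<xi> - ?f (\<lambda>x. u x + c * v x) R \<xi>)) \<longlongrightarrow> 0) at_top"
  proof (rule tendsto_sandwich[OF _ _ tendsto_const[of 0]])
    show "((\<lambda>R. ennreal 2 * (l2_sq (\<lambda>\<xi>. g \<xi> - ?f u R \<xi>)) +
        ennreal (2 * (cmod c)\<^sup>2) * (l2_sq (\<lambda>\<xi>. h \<xi> - ?f v R \<xi>))) \<longlongrightarrow> 0) at_top"
    proof -
      have "((\<lambda>R. ennreal 2 * (l2_sq (\<lambda>\<xi>. g \<xi> - ?f u R \<xi>)) +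
        ennreal (2 * (cmod c)\<^sup>2) * (l2_sq (\<lambda>\<xi>. h \<xi> - ?f v R \<xi>))) \<longlongrightarrow> ennreal 2 * 0 + ennreal (2 * (cmod c)\<^sup>2) * 0) at_top"
        using assms unfolding fourier_L2_def by (intro tendsto_add ennreal_tendsto_cmult) auto
      then show ?thesis by simp
    qed
    have "l2_sq (\<lambda>\<xi>. g \<xi> + c * h \<xi> - ?f (\<lambda>x. u x + c * v x) R \<xi>) \<le>
       ennreal 2 * (l2_sq (\<lambda>\<xi>. g \<xi> - ?f u R \<xi>)) +
        ennreal (2 * (cmod c)\<^sup>2) * (l2_sq (\<lambda>\<xi>. h \<xi> - ?f v R \<xi>))" for R
    proof -
      have "(\<lambda>\<xi>. g \<xi> - ?f u R \<xi>) \<in> borel_measurable lborel" "(\<lambda>\<xi>. h \<xi> - ?f v R \<xi>) \<in> borel_measurable lborel"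
        using L2fun_measurable[OF L2fun_indicator[of u "ball 0 R"]] L2fun_measurable[OF L2fun_indicator[of v "ball 0 R"]] L2
        by (auto intro!: borel_measurable_diff fourier_measurable)
      note * = nn_integral_weighted_add[OF this, of "\<lambda>_. 1" c]
      have eq: "g \<xi> + c * h \<xi> - ?f (\<lambda>x. u x + c * v x) R \<xi> = (g \<xi> - ?f u R \<xi>) + c * (h \<xi> - ?f v R \<xi>)" for \<xi>
        unfolding F by (simp only: algebra_simps)
      show ?thesis unfolding eq using * by simp
    qed
    then show "\<forall>\<^sub>F R in at_top. (l2_sq (\<lambda>\<xi>. g \<xi> + c * h \<xi> - ?f (\<lambda>x. u x + c * v x) R \<xi>)) \<le>
       ennreal 2 * (l2_sq (\<lambda>\<xi>. g \<xi> - ?f u R \<xi>)) +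
        ennreal (2 * (cmod c)\<^sup>2) * (l2_sq (\<lambda>\<xi>. h \<xi> - ?f v R \<xi>))"
      by simp
  qed auto
  then show ?thesis
    using L2 by (simp add: fourier_L2_def L2fun_lincomb)
qed

text \<open>\<open>FT\<close> picks a representative by Hilbert choice; these facts make it
  interchangeable with any other L2 transform up to null sets.\<close>

lemma fourier_L2_FT:
  assumes "fourier_L2 u g"
  shows "fourier_L2 u (FT u)" "AE \<xi> in lborel. FT u \<xi> = g \<xi>"
proof -
  show "fourier_L2 u (FT u)" unfolding FT_def using assms by (rule someI[of "fourier_L2 u"])
  then show "AE \<xi> in lborel. FT u \<xi> = g \<xi>" using assms by (rule fourier_L2_unique)
qed

lemma Hs_FT:
  assumes "Hs s u"
  shows "fourier_L2 u (FT u)" "sobolev_sq s (FT u) < \<infinity>"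
    "L2fun u" "L2fun (FT u)"
proof -
  obtain g where g: "fourier_L2 u g" "sobolev_sq s g < \<infinity>"
    using assms by (auto simp: Hs_def)
  show F: "fourier_L2 u (FT u)" by (rule fourier_L2_FT[OF g(1)])
  then show "L2fun u" "L2fun (FT u)" by (auto simp: fourier_L2_def)
  have "sobolev_sq s (FT u) = sobolev_sq s g"
    by (intro nn_integral_cong_AE) (use fourier_L2_FT(2)[OF g(1)] in \<open>auto elim!: eventually_mono\<close>)
  then show "sobolev_sq s (FT u) < \<infinity>" using g(2) by simp
qed

lemma Hs_lincomb:
  assumes u: "Hs s u" and v: "Hs s v"
  shows "Hs s (\<lambda>x. u x + c * v x)" "AE \<xi> in lborel. FT (\<lambda>x. u x + c * v x) \<xi> = FT u \<xi> + c * FT v \<xi>"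
proof -
  note F = fourier_L2_lincomb[OF Hs_FT(1)[OF u] Hs_FT(1)[OF v], of c]
  have [measurable]: "FT u \<in> borel_measurable borel" "FT v \<in> borel_measurable borel"
    using Hs_FT(4)[OF u] Hs_FT(4)[OF v] by (auto simp: L2fun_def)
  show "AE \<xi> in lborel. FT (\<lambda>x. u x + c * v x) \<xi> = FT u \<xi> + c * FT v \<xi>"
    by (rule fourier_L2_FT(2)[OF F])
  show "Hs s (\<lambda>x. u x + c * v x)"
    unfolding Hs_def
    by (intro exI conjI, rule F, rule nn_integral_weighted_add_finite) (use Hs_FT(2)[OF u] Hs_FT(2)[OF v] in auto)
qed

text \<open>Duality of H^{-s} and H^s on the transform side: the weights with exponents -s/2 and s/2
  multiply to 1. Any real s is allowed.\<close>

lemma bracket_Cauchy_Schwarz: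
  fixes f h :: "'a::euclidean_space \<Rightarrow> complex"
  assumes [measurable]: "f \<in> borel_measurable borel" "h \<in> borel_measurable borel"
  shows "(\<integral>\<^sup>+ \<xi>. ennreal (cmod (f \<xi> * h \<xi>)) \<partial>lborel)\<^sup>2 \<le>
    (sobolev_sq (- s) f) * (sobolev_sq s h)"
proof -
  have sq: "(ennreal (bracket (t / 2) \<xi> * cmod z))\<^sup>2 = ennreal (bracket t \<xi> * (cmod z)\<^sup>2)" for t z and \<xi> :: 'a
  proof -
    have "(bracket (t / 2) \<xi>)\<^sup>2 = bracket t \<xi>"
      by (simp add: power2_eq_square powr_add[symmetric])
    then show ?thesis by (simp add: ennreal_power power_mult_distrib)
  qed
  have "ennreal (cmod (f \<xi> * h \<xi>)) = ennreal (bracket ((- s) / 2) \<xi> * cmod (f \<xi>)) * ennreal (bracket (s / 2) \<xi> * cmod (h \<xi>))" for \<xi>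
  proof -
    have "1 + (norm \<xi>)\<^sup>2 > 0" by (rule add_pos_nonneg) auto
    then have "bracket ((- s) / 2) \<xi> * bracket (s / 2) \<xi> = 1"
      by (simp add: powr_add[symmetric])
    then have "cmod (f \<xi> * h \<xi>) = (bracket ((- s) / 2) \<xi> * cmod (f \<xi>)) * (bracket (s / 2) \<xi> * cmod (h \<xi>))"
      by (simp add: norm_mult mult_ac)
    then show ?thesis by (simp add: ennreal_mult'[symmetric])
  qed
  then have eq: "(\<integral>\<^sup>+ \<xi>. ennreal (cmod (f \<xi> * h \<xi>)) \<partial>lborel) =
     (\<integral>\<^sup>+ \<xi>. ennreal (bracket ((- s) / 2) \<xi> * cmod (f \<xi>)) * ennreal (bracket (s / 2) \<xi> * cmod (h \<xi>)) \<partial>lborel)"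
    by (simp only:)
  have "(\<integral>\<^sup>+ \<xi>. ennreal (bracket ((- s) / 2) \<xi> * cmod (f \<xi>)) * ennreal (bracket (s / 2) \<xi> * cmod (h \<xi>)) \<partial>lborel)\<^sup>2 \<le>
      (\<integral>\<^sup>+ \<xi>. (ennreal (bracket ((- s) / 2) \<xi> * cmod (f \<xi>)))\<^sup>2 \<partial>lborel) * (\<integral>\<^sup>+ \<xi>. (ennreal (bracket (s / 2) \<xi> * cmod (h \<xi>)))\<^sup>2 \<partial>lborel)"
    by (rule Cauchy_Schwarz_nn_integral) measurable
  then show ?thesis unfolding eq sq .
qed

lemma test_fn_bracket_finite:
  fixes \<phi> :: "'a::euclidean_space \<Rightarrow> complex"
  assumes "test_fn U \<phi>"
  shows "sobolev_sq s (fourier \<phi>) < \<infinity>"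
proof -
  define k where "k = nat \<lceil>s\<rceil>"
  have k: "s \<le> real k" unfolding k_def by linarith
  have "sobolev_sq s (fourier \<phi>) \<le>
      (\<integral>\<^sup>+ \<xi>. ennreal (norm ((1 + (norm \<xi>)\<^sup>2) ^ k * (cmod (fourier \<phi> \<xi>))\<^sup>2)) \<partial>lborel)"
  proof (intro nn_integral_mono ennreal_leI)
    fix \<xi> :: 'a
    have "1 + (norm \<xi>)\<^sup>2 > 0" by (rule add_pos_nonneg) auto
    then have "bracket s \<xi> \<le> (1 + (norm \<xi>)\<^sup>2) ^ k"
      using k by (subst powr_realpow[symmetric]) (auto intro!: powr_mono)
    then have "bracket s \<xi> * (cmod (fourier \<phi> \<xi>))\<^sup>2 \<le> (1 + (norm \<xi>)\<^sup>2) ^ k * (cmod (fourier \<phi> \<xi>))\<^sup>2"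
      by (intro mult_right_mono) auto
    then show "bracket s \<xi> * (cmod (fourier \<phi> \<xi>))\<^sup>2 \<le> norm ((1 + (norm \<xi>)\<^sup>2) ^ k * (cmod (fourier \<phi> \<xi>))\<^sup>2)"
      by simp
  qed
  also have "\<dots> < \<infinity>"
    using integrable_fourier_test_fn(2)[OF assms, of k] unfolding integrable_iff_bounded by simp
  finally show ?thesis .
qed

lemma test_fn_L2fun: "test_fn U \<phi> \<Longrightarrow> L2fun \<phi>"
  using test_fn_square_integrable[of U \<phi>] test_fn_measurable[of U \<phi>]
  by (simp add: L2fun_def integrable_iff_bounded)

lemma test_fn_fourier_L2:
  assumes "test_fn U \<phi>" shows "fourier_L2 \<phi> (fourier \<phi>)"
proof -
  have "bounded (csupp \<phi>)" using assms by (simp add: test_fn_def compact_imp_bounded)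
  then obtain R where "\<And>x. x \<in> csupp \<phi> \<Longrightarrow> norm x < R" using bounded_pos_less by metis
  then show ?thesis
    using not_in_csupp[of _ \<phi>] by (intro fourier_L2_bounded_support[of _ R] test_fn_L2fun[OF assms]) auto
qed

lemma test_fn_Hs: "test_fn U \<phi> \<Longrightarrow> Hs s \<phi>"
  unfolding Hs_def using test_fn_fourier_L2 test_fn_bracket_finite by blast

section \<open>The spaces H^{-s} and the pairing with test functions\<close>

lemma Hneg_measurable: "Hneg s G \<Longrightarrow> G \<in> borel_measurable borel"
  by (simp add: Hneg_def)

lemma nn_integral_uminus:
  fixes f :: "'a::euclidean_space \<Rightarrow> ennreal"
  assumes [measurable]: "f \<in> borel_measurable borel"
  shows "(\<integral>\<^sup>+ x. f (- x) \<partial>lborel) = (\<integral>\<^sup>+ x. f x \<partial>lborel)"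
  by (subst nn_integral_affine[of f "-1" 0]) auto

lemma ennreal_power2_le_imp_le: "(X::ennreal)\<^sup>2 \<le> (ennreal y)\<^sup>2 \<Longrightarrow> y \<ge> 0 \<Longrightarrow> X \<le> ennreal y"
  by (cases X) (auto simp: ennreal_power ennreal_top_eq_mult_iff top_unique intro: power2_le_imp_le)

text \<open>Cauchy-Schwarz with the rapidly decaying transform of \<phi>; \<open>K\<close> depends
  on \<phi> and s but not on \<open>G\<close>. The lemma is applied with exponent s, with 0 for L2
  limits, and with -s for limits in H^s.\<close>

lemma pair_bound:
  fixes \<phi> :: "'a::euclidean_space \<Rightarrow> complex"
  assumes \<phi>: "test_fn U \<phi>"
  obtains K where "K > 0" "\<And>G. Hneg s G \<Longrightarrow> integrable lborel (\<lambda>\<xi>. G \<xi> * fourier \<phi> (- \<xi>))"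
    "\<And>G. Hneg s G \<Longrightarrow> cmod (pair G \<phi>) \<le> K * hneg_norm s G"
proof -
  define B where "B = sobolev_sq s (fourier \<phi>)"
  have [measurable]: "\<phi> \<in> borel_measurable borel" by (rule test_fn_measurable[OF \<phi>])
  have B: "B < \<infinity>" "sobolev_sq s (\<lambda>\<xi>. fourier \<phi> (- \<xi>)) = B"
    using test_fn_bracket_finite[OF \<phi>] nn_integral_uminus[of "\<lambda>\<xi>. ennreal (bracket s \<xi> * (cmod (fourier \<phi> \<xi>))\<^sup>2)"]
    unfolding B_def by simp_all
  define c where "c = (2 * pi) powr (- real DIM('a) / 2)"
  have c: "c > 0" "(2 * pi) powr (- real DIM('a)) = c * c"
    by (auto simp: c_def powr_add[symmetric])
  \<comment> \<open>The added 1 makes \<open>K\<close> strictly positive in all cases, so that it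
    may be divided by.\<close>
  define K where "K = c * sqrt (enn2real B) + 1"
  have K: "K > 0" unfolding K_def using c by (intro add_nonneg_pos) auto
  have *: "integrable lborel (\<lambda>\<xi>. G \<xi> * fourier \<phi> (- \<xi>)) \<and> cmod (pair G \<phi>) \<le> K * hneg_norm s G" if G: "Hneg s G" for G
  proof -
    have [measurable]: "G \<in> borel_measurable borel" using G by (rule Hneg_measurable)
    define A where "A = sobolev_sq (- s) G"
    have A: "A < \<infinity>" using G by (simp add: A_def Hneg_def)
    have le: "(\<integral>\<^sup>+ \<xi>. ennreal (cmod (G \<xi> * fourier \<phi> (- \<xi>))) \<partial>lborel)\<^sup>2 \<le> A * B"
      unfolding A_def B(2)[symmetric] by (rule bracket_Cauchy_Schwarz) auto
    also have AB: "A * B = ennreal (enn2real A * enn2real B)"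
      using A B(1) by (simp add: ennreal_mult)
    also have "\<dots> = (ennreal (sqrt (enn2real A) * sqrt (enn2real B)))\<^sup>2"
      by (simp add: ennreal_power power_mult_distrib)
    finally have le': "(\<integral>\<^sup>+ \<xi>. ennreal (cmod (G \<xi> * fourier \<phi> (- \<xi>))) \<partial>lborel) \<le> ennreal (sqrt (enn2real A) * sqrt (enn2real B))"
      by (rule ennreal_power2_le_imp_le) simp
    then have int: "integrable lborel (\<lambda>\<xi>. G \<xi> * fourier \<phi> (- \<xi>))"
      by (intro integrableI_bounded) (auto simp: less_top[symmetric] top_unique intro: le_less_trans)
    have "ennreal (cmod (LBINT \<xi>. G \<xi> * fourier \<phi> (- \<xi>))) \<le> ennreal (sqrt (enn2real A) * sqrt (enn2real B))"
      using integral_norm_bound_ennreal[OF int] le' by (rule order_trans)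
    then have "cmod (LBINT \<xi>. G \<xi> * fourier \<phi> (- \<xi>)) \<le> sqrt (enn2real A) * sqrt (enn2real B)"
      by (subst (asm) ennreal_le_iff) auto
    then have "cmod (pair G \<phi>) \<le> c * c * (sqrt (enn2real A) * sqrt (enn2real B))"
      unfolding pair_def norm_mult c(2)[symmetric] by (auto intro!: mult_left_mono)
    also have "\<dots> = (c * sqrt (enn2real B)) * hneg_norm s G"
      unfolding hneg_norm_def A_def c_def by (simp add: mult_ac)
    also have "\<dots> \<le> K * hneg_norm s G"
      unfolding K_def by (intro mult_right_mono) (auto simp: hneg_norm_def)
    finally show ?thesis using int by blast
  qed
  show ?thesis using that[OF K] * by blast
qed

lemma pair_lincomb:
  assumes \<phi>: "test_fn U \<phi>" and F: "Hneg s F" and G: "Hneg s G"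
  shows "pair (\<lambda>\<xi>. F \<xi> + c * G \<xi>) \<phi> = pair F \<phi> + c * pair G \<phi>"
proof -
  obtain K where "\<And>G. Hneg s G \<Longrightarrow> integrable lborel (\<lambda>\<xi>. G \<xi> * fourier \<phi> (- \<xi>))"
    using pair_bound[OF \<phi>, of s] by metis
  with F G have i: "integrable lborel (\<lambda>\<xi>. F \<xi> * fourier \<phi> (- \<xi>))" "integrable lborel (\<lambda>\<xi>. G \<xi> * fourier \<phi> (- \<xi>))"
    by auto
  have "(LBINT \<xi>. (F \<xi> + c * G \<xi>) * fourier \<phi> (- \<xi>)) =
      (LBINT \<xi>. F \<xi> * fourier \<phi> (- \<xi>) + c * (G \<xi> * fourier \<phi> (- \<xi>)))"
    by (simp add: algebra_simps)
  also have "\<dots> = (LBINT \<xi>. F \<xi> * fourier \<phi> (- \<xi>)) + c * (LBINT \<xi>. G \<xi> * fourier \<phi> (- \<xi>))"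
    using i by simp
  finally show ?thesis by (simp add: pair_def algebra_simps)
qed

lemma Hneg_lincomb:
  assumes "Hneg s F" "Hneg s G" shows "Hneg s (\<lambda>\<xi>. F \<xi> + c * G \<xi>)"
proof -
  have [measurable]: "F \<in> borel_measurable borel" "G \<in> borel_measurable borel"
    using assms by (auto simp: Hneg_def)
  show ?thesis
    using nn_integral_weighted_add_finite[of F lborel G "\<lambda>\<xi>. bracket (- s) \<xi>" c] assms by (simp add: Hneg_def)
qed

text \<open>A triangle inequality with constant 2, inherited from the pointwise bound for squares
  through sqrt(2A + 2 |c|^2 B) \<le> 2 (sqrt A + |c| sqrt B).\<close>

lemma hneg_norm_lincomb:
  assumes F: "Hneg s F" and G: "Hneg s G"
  shows "hneg_norm s (\<lambda>\<xi>. F \<xi> + c * G \<xi>) \<le> 2 * (hneg_norm s F + cmod c * hneg_norm s G)"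
proof -
  define A where "A = enn2real (sobolev_sq (- s) F)"
  define B where "B = enn2real (sobolev_sq (- s) G)"
  have A: "A \<ge> 0" "sobolev_sq (- s) F = ennreal A"
    and B: "B \<ge> 0" "sobolev_sq (- s) G = ennreal B"
    using F G by (auto simp: A_def B_def Hneg_def)
  have "sobolev_sq (- s) (\<lambda>\<xi>. F \<xi> + c * G \<xi>) \<le>
     ennreal 2 * ennreal A + ennreal (2 * (cmod c)\<^sup>2) * ennreal B"
    unfolding A(2)[symmetric] B(2)[symmetric]
    using Hneg_measurable[OF F] Hneg_measurable[OF G] by (intro nn_integral_weighted_add) auto
  also have "\<dots> = ennreal (2 * A + 2 * (cmod c)\<^sup>2 * B)"
    using A(1) B(1) by (simp add: ennreal_mult ennreal_plus)
  finally have "enn2real (sobolev_sq (- s) (\<lambda>\<xi>. F \<xi> + c * G \<xi>)) \<le> 2 * A + 2 * (cmod c)\<^sup>2 * B"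
    using A(1) B(1) by (intro enn2real_leI) auto
  then have "sqrt (enn2real (sobolev_sq (- s) (\<lambda>\<xi>. F \<xi> + c * G \<xi>))) \<le> sqrt (2 * A + 2 * (cmod c)\<^sup>2 * B)"
    by (rule real_sqrt_le_mono)
  also have "\<dots> \<le> 2 * (sqrt A + cmod c * sqrt B)"
  proof (rule real_le_lsqrt)
    have "(2 * (sqrt A + cmod c * sqrt B))\<^sup>2 = 4 * A + 8 * (sqrt A * (cmod c * sqrt B)) + 4 * (cmod c)\<^sup>2 * B"
      using A(1) B(1) by (simp add: power2_sum power_mult_distrib algebra_simps)
    moreover have "0 \<le> sqrt A * (cmod c * sqrt B)" "0 \<le> (cmod c)\<^sup>2 * B" using A(1) B(1) by auto
    ultimately show "2 * A + 2 * (cmod c)\<^sup>2 * B \<le> (2 * (sqrt A + cmod c * sqrt B))\<^sup>2"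
      using A(1) by linarith
  qed (use A(1) B(1) in auto)
  finally have "(2 * pi) powr (- real DIM('a) / 2) * sqrt (enn2real (sobolev_sq (- s) (\<lambda>\<xi>. F \<xi> + c * G \<xi>)))
     \<le> (2 * pi) powr (- real DIM('a) / 2) * (2 * (sqrt A + cmod c * sqrt B))"
    by (intro mult_left_mono) auto
  then show ?thesis unfolding hneg_norm_def A_def B_def by (simp add: algebra_simps)
qed

lemma hneg_norm_nonneg: "hneg_norm s G \<ge> 0"
  by (simp add: hneg_norm_def)

lemma pair_cong_AE:
  assumes "AE \<xi> in lborel. F \<xi> = G \<xi>" and [measurable]: "F \<in> borel_measurable borel" "G \<in> borel_measurable borel"
    and \<phi>: "test_fn U \<phi>"
  shows "pair F \<phi> = pair G \<phi>"
proof -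
  have [measurable]: "\<phi> \<in> borel_measurable borel" by (rule test_fn_measurable[OF \<phi>])
  show ?thesis
    unfolding pair_def by (intro arg_cong2[where f = "(*)"] refl integral_cong_AE) (use assms(1) in \<open>auto elim!: eventually_mono\<close>)
qed

lemma L2fun_Hneg:
  fixes G :: "'a::euclidean_space \<Rightarrow> complex"
  assumes "L2fun G" "s \<ge> 0" shows "Hneg s G"
proof -
  have "sobolev_sq (- s) G \<le> l2_sq G"
  proof (intro nn_integral_mono ennreal_leI)
    fix \<xi> :: 'a
    have "bracket (- s) \<xi> \<le> bracket 0 \<xi>" using assms(2) by (intro powr_mono) auto
    also have "\<dots> = 1" by (simp add: add_nonneg_eq_0_iff)
    finally show "bracket (- s) \<xi> * (cmod (G \<xi>))\<^sup>2 \<le> (cmod (G \<xi>))\<^sup>2"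
      by (intro mult_left_le_one_le) auto
  qed
  from le_less_trans[OF this] show ?thesis using assms(1) by (simp add: Hneg_def L2fun_def)
qed

lemma norm_powr_le_bracket: "s > 0 \<Longrightarrow> norm \<xi> powr (2 * s) \<le> bracket s \<xi>"
proof -
  assume s: "s > 0"
  have "norm \<xi> powr (2 * s) = ((norm \<xi>)\<^sup>2) powr s"
  proof (cases "\<xi> = 0")
    case False
    then have "((norm \<xi>)\<^sup>2) powr s = (norm \<xi> powr 2) powr s" by simp
    then show ?thesis by (simp only: powr_powr)
  qed simp
  also have "\<dots> \<le> bracket s \<xi>" using s by (intro powr_mono2) auto
  finally show ?thesis .
qed

text \<open>The multiplier |\<xi>|^{2s} is at most (1 + |\<xi>|^2)^s, so its square times the weight
  of exponent -s is at most the weight of exponent s. This is the mapping property of (-\<Delta>)^s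
  from H^s to H^{-s}, stated for a bare transform \<open>g\<close>.\<close>

lemma norm_powr_mult_Hneg:
  fixes g :: "'a::euclidean_space \<Rightarrow> complex"
  assumes [measurable]: "g \<in> borel_measurable borel" and s: "s > 0"
    and g: "sobolev_sq s g < \<infinity>"
  shows "Hneg s (\<lambda>\<xi>. complex_of_real (norm \<xi> powr (2 * s)) * g \<xi>)"
proof -
  let ?f = "\<lambda>\<xi>. complex_of_real (norm \<xi> powr (2 * s)) * g \<xi>"
  have "sobolev_sq (- s) ?f \<le> sobolev_sq s g"
  proof (intro nn_integral_mono ennreal_leI)
    fix \<xi> :: 'a
    have p: "1 + (norm \<xi>)\<^sup>2 > 0" by (rule add_pos_nonneg) auto
    have "(norm \<xi> powr (2 * s))\<^sup>2 \<le> (bracket s \<xi>)\<^sup>2"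
      using norm_powr_le_bracket[OF s, of \<xi>] by (intro power_mono) auto
    then have "bracket (- s) \<xi> * (norm \<xi> powr (2 * s))\<^sup>2 \<le> bracket (- s) \<xi> * (bracket s \<xi> * bracket s \<xi>)"
      by (intro mult_left_mono) (auto simp: power2_eq_square)
    also have "\<dots> = bracket s \<xi>" using p by (simp add: powr_add[symmetric])
    finally have "bracket (- s) \<xi> * (norm \<xi> powr (2 * s))\<^sup>2 * (cmod (g \<xi>))\<^sup>2 \<le> bracket s \<xi> * (cmod (g \<xi>))\<^sup>2"
      by (intro mult_right_mono) auto
    then show "bracket (- s) \<xi> * (cmod (?f \<xi>))\<^sup>2 \<le> bracket s \<xi> * (cmod (g \<xi>))\<^sup>2"
      by (simp add: norm_mult power_mult_distrib mult.assoc)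
  qed
  then show ?thesis using le_less_trans[OF _ g] by (simp add: Hneg_def)
qed

lemma fraclap_Hneg: "Hs s u \<Longrightarrow> s > 0 \<Longrightarrow> Hneg s (fraclap s u)"
  unfolding fraclap_def using Hs_FT[of s u] by (intro norm_powr_mult_Hneg) (auto simp: L2fun_def)

text \<open>The multiplication formula moves the transform onto the reflected
  \<open>fourier \<phi>\<close>, and Fourier inversion returns \<phi>. The normalising factor in
  \<open>pair\<close> cancels the inversion constant (2 pi)^n.\<close>

lemma pair_fourier:
  fixes \<phi> :: "'a::euclidean_space \<Rightarrow> complex"
  assumes f: "integrable lborel f" and \<phi>: "test_fn U \<phi>"
  shows "pair (fourier f) \<phi> = (LBINT x. f x * \<phi> x)"
proof -
  have [measurable]: "\<phi> \<in> borel_measurable borel" by (rule test_fn_measurable[OF \<phi>])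
  have int: "integrable lborel (\<lambda>\<xi>. fourier \<phi> (- \<xi>))"
    using integrable_affine[OF integrable_fourier_test_fn(3)[OF \<phi>], of "-1" 0] by simp
  have "fourier (\<lambda>\<xi>. fourier \<phi> (- \<xi>)) x = of_real ((2 * pi) ^ DIM('a)) * \<phi> x" for x
  proof -
    have "fourier (\<lambda>\<xi>. fourier \<phi> (- \<xi>)) x = (LBINT \<xi>. cis (x \<bullet> - \<xi>) * fourier \<phi> (- \<xi>))"
      by (simp add: fourier_def[of "\<lambda>\<xi>. fourier \<phi> (- \<xi>)"] inner_commute)
    also have "\<dots> = (LBINT \<xi>. cis (x \<bullet> \<xi>) * fourier \<phi> \<xi>)"
      by (rule integral_uminus[of "\<lambda>\<xi>. cis (x \<bullet> \<xi>) * fourier \<phi> \<xi>"]) measurable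
    finally show ?thesis by (simp add: fourier_inversion_test_fn[OF \<phi>])
  qed
  then have eq: "(LBINT \<xi>. fourier f \<xi> * fourier \<phi> (- \<xi>)) = of_real ((2 * pi) ^ DIM('a)) * (LBINT x. f x * \<phi> x)"
    by (subst fourier_multiplication_formula[OF f int]) (simp add: mult.left_commute[of "f _"])
  have "(2 * pi) powr (- real DIM('a)) * (2 * pi) ^ DIM('a) = 1"
    by (subst powr_minus, subst powr_realpow, simp) (rule left_inverse, simp)
  then show ?thesis
    unfolding pair_def eq mult.assoc[symmetric] of_real_mult[symmetric] by simp
qed

text \<open>Truncations of \<open>u\<close> to balls are integrable, so the L1 case applies to them.
  Once the ball contains the support of \<phi> the integral against \<phi> no longer changes, while
  the transforms converge to \<open>g\<close> in L2, that is in \<open>hneg_norm 0\<close>.\<close>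

lemma pair_FT:
  fixes \<phi> :: "'a::euclidean_space \<Rightarrow> complex"
  assumes u: "fourier_L2 u g" and \<phi>: "test_fn U \<phi>"
  shows "pair g \<phi> = (LBINT x. u x * \<phi> x)"
proof -
  let ?f = "\<lambda>R x. indicator (ball 0 R) x * u x"
  have L2: "L2fun u" "L2fun g" using u by (auto simp: fourier_L2_def)
  obtain K where K: "K > 0" "\<And>G. Hneg 0 G \<Longrightarrow> cmod (pair G \<phi>) \<le> K * hneg_norm 0 G"
    using pair_bound[OF \<phi>, of 0] by metis
  have "bounded (csupp \<phi>)" using \<phi> by (simp add: test_fn_def compact_imp_bounded)
  then obtain R0 where R0: "\<And>x. x \<in> csupp \<phi> \<Longrightarrow> norm x < R0" using bounded_pos_less by metis
  have f: "integrable lborel (?f R)" "L2fun (?f R)" for R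
    using L2(1) by (auto intro: L2fun_ball_integrable L2fun_indicator)
  have diff: "Hneg 0 (\<lambda>\<xi>. g \<xi> + (-1) * fourier (?f R) \<xi>)" for R
    by (intro Hneg_lincomb L2fun_Hneg L2 L2fun_fourier f) auto
  have le: "cmod (pair g \<phi> - (LBINT x. u x * \<phi> x)) \<le> K * hneg_norm 0 (\<lambda>\<xi>. g \<xi> + (-1) * fourier (?f R) \<xi>)" if "R \<ge> R0" for R
  proof -
    have "pair (fourier (?f R)) \<phi> = (LBINT x. ?f R x * \<phi> x)" by (rule pair_fourier[OF f(1) \<phi>])
    also have "\<dots> = (LBINT x. u x * \<phi> x)"
    proof (rule Bochner_Integration.integral_cong[OF refl])
      fix x show "?f R x * \<phi> x = u x * \<phi> x"
        using R0[of x] that not_in_csupp[of x \<phi>] by (cases "x \<in> csupp \<phi>") (auto simp: indicator_def)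
    qed
    finally have "pair g \<phi> - (LBINT x. u x * \<phi> x) = pair (\<lambda>\<xi>. g \<xi> + (-1) * fourier (?f R) \<xi>) \<phi>"
      by (subst pair_lincomb[OF \<phi>, of 0]) (auto intro!: L2fun_Hneg L2 L2fun_fourier f)
    then show ?thesis using K(2)[OF diff] by simp
  qed
  have "((\<lambda>R. sobolev_sq (- 0) (\<lambda>\<xi>. g \<xi> + (-1) * fourier (?f R) \<xi>)) \<longlongrightarrow> ennreal 0) at_top"
    using u by (simp add: fourier_L2_def add_nonneg_eq_0_iff)
  then have "((\<lambda>R. hneg_norm 0 (\<lambda>\<xi>. g \<xi> + (-1) * fourier (?f R) \<xi>)) \<longlongrightarrow> (2 * pi) powr (- real DIM('a) / 2) * sqrt 0) at_top"
    unfolding hneg_norm_def by (intro tendsto_mult tendsto_const tendsto_real_sqrt tendsto_enn2real) auto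
  then have "((\<lambda>R. K * hneg_norm 0 (\<lambda>\<xi>. g \<xi> + (-1) * fourier (?f R) \<xi>)) \<longlongrightarrow> K * ((2 * pi) powr (- real DIM('a) / 2) * sqrt 0)) at_top"
    by (rule tendsto_mult_left)
  moreover have "\<forall>\<^sub>F R in at_top. cmod (pair g \<phi> - (LBINT x. u x * \<phi> x)) \<le> K * hneg_norm 0 (\<lambda>\<xi>. g \<xi> + (-1) * fourier (?f R) \<xi>)"
    using le by (rule eventually_at_top_linorderI)
  ultimately have "cmod (pair g \<phi> - (LBINT x. u x * \<phi> x)) \<le> K * ((2 * pi) powr (- real DIM('a) / 2) * sqrt 0)"
    by (rule tendsto_lowerbound) simp
  then show ?thesis by simp
qed

section \<open>Restriction norms as infima over extensions\<close>

lemma hneg_rest_norm_le: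
  assumes "Hneg s G" "\<And>\<phi>. test_fn U \<phi> \<Longrightarrow> pair G \<phi> = pair F \<phi>"
  shows "hneg_rest_norm s U F \<le> hneg_norm s G"
  unfolding hneg_rest_norm_def
  by (rule cInf_lower) (use assms in \<open>auto intro!: bdd_belowI[of _ 0] simp: hneg_norm_nonneg\<close>)

lemma hneg_rest_norm_ge:
  assumes "Hneg s F" "\<And>G. Hneg s G \<Longrightarrow> (\<And>\<phi>. test_fn U \<phi> \<Longrightarrow> pair G \<phi> = pair F \<phi>) \<Longrightarrow> a \<le> hneg_norm s G"
  shows "a \<le> hneg_rest_norm s U F"
  unfolding hneg_rest_norm_def by (rule cInf_greatest) (use assms in auto)

lemma hneg_rest_norm_nonneg: "Hneg s F \<Longrightarrow> 0 \<le> hneg_rest_norm s U F"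
  by (rule hneg_rest_norm_ge) (auto simp: hneg_norm_nonneg)

lemma hneg_rest_norm_approx:
  assumes "Hneg s F" "hneg_rest_norm s U F < x"
  obtains G where "Hneg s G" "\<And>\<phi>. test_fn U \<phi> \<Longrightarrow> pair G \<phi> = pair F \<phi>" "hneg_norm s G < x"
proof -
  have "{hneg_norm s G | G. Hneg s G \<and> (\<forall>\<phi>. test_fn U \<phi> \<longrightarrow> pair G \<phi> = pair F \<phi>)} \<noteq> {}"
    using assms(1) by auto
  from cInf_lessD[OF this] assms(2) show ?thesis
    unfolding hneg_rest_norm_def using that by auto
qed

section \<open>Locality, mollification and multiplication by cutoffs\<close>

text \<open>The local exceptional sets may be uncountably many; the Lindelof property selects a
  countable subfamily of neighbourhoods with the same union.\<close>

lemma AE_on_open_locally: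
  fixes U :: "'a::euclidean_space set"
  assumes "\<And>x. x \<in> U \<Longrightarrow> \<exists>V. open V \<and> x \<in> V \<and> (AE y in lborel. y \<in> V \<longrightarrow> P y)"
  shows "AE y in lborel. y \<in> U \<longrightarrow> P y"
proof -
  let ?F = "{V. open V \<and> (AE y in lborel. y \<in> V \<longrightarrow> P y)}"
  obtain F where F: "F \<subseteq> ?F" "countable F" "\<Union>F = \<Union>?F"
    using Lindelof[of ?F] by auto
  have "AE y in lborel. \<forall>V\<in>F. y \<in> V \<longrightarrow> P y"
    using F(1) by (subst AE_ball_countable[OF F(2)]) auto
  then show ?thesis
  proof eventually_elim
    case (elim y)
    show ?case
    proof
      assume "y \<in> U"
      then have "y \<in> \<Union>?F" using assms by blast
      then have "y \<in> \<Union>F" using F(3) by simp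
      then show "P y" using elim by blast
    qed
  qed
qed

text \<open>Open boxes form an intersection-stable generator of the Borel sets, and the sets over
  which \<open>f\<close> integrates to zero are closed under complements and countable disjoint
  unions. Complements need the total integral to vanish, which follows because \<open>f\<close>
  lives in one box.\<close>

lemma integral_zero_on_boxes:
  fixes f :: "'a::euclidean_space \<Rightarrow> complex"
  assumes f: "integrable lborel f" and box: "\<And>l u. (LBINT x. indicator (box l u) x *\<^sub>R f x) = 0"
    and outside: "\<And>x. x \<notin> box l u \<Longrightarrow> f x = 0"
  shows "AE x in lborel. f x = 0"
proof (rule sigma_finite_measure.density_zero[OF sigma_finite_lborel f])
  let ?G = "range (\<lambda>(a, b). box a b :: 'a set)"
  have tot: "(LBINT x. f x) = 0"
  proof -
    have "(LBINT x. f x) = (LBINT x. indicator (box l u) x *\<^sub>R f x)"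
      by (intro Bochner_Integration.integral_cong) (use outside in \<open>auto simp: indicator_def\<close>)
    then show ?thesis by (simp add: box)
  qed
  have borel: "sets (borel :: 'a measure) = sigma_sets UNIV ?G"
    by (subst borel_eq_box) (simp add: sets_measure_of)
  fix A :: "'a set" assume "A \<in> sets lborel"
  then have A: "A \<in> sigma_sets UNIV ?G" by (simp add: borel)
  have "Int_stable ?G"
    by (auto simp: Int_stable_def box_Int_box)
  moreover have "?G \<subseteq> Pow UNIV" by simp
  moreover note A
  ultimately show "set_lebesgue_integral lborel A f = 0"
  proof (induction A rule: sigma_sets_induct_disjoint)
    case (basic A)
    then show ?case using box by (auto simp: set_lebesgue_integral_def)
  next
    case empty
    show ?case by (simp add: set_lebesgue_integral_def)
  next
    case (compl A)
    then have [measurable]: "A \<in> sets lborel" by (simp add: borel)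
    have "set_lebesgue_integral lborel (UNIV - A) f = (LBINT x. f x - indicator A x *\<^sub>R f x)"
      unfolding set_lebesgue_integral_def by (intro Bochner_Integration.integral_cong) (auto simp: indicator_def)
    also have "\<dots> = (LBINT x. f x) - set_lebesgue_integral lborel A f"
      unfolding set_lebesgue_integral_def using f \<open>A \<in> sets lborel\<close>
      by (intro Bochner_Integration.integral_diff integrable_mult_indicator) auto
    finally show ?case using compl tot by simp
  next
    case (union A)
    then have A: "A i \<in> sets lborel" for i by (auto simp: borel)
    have "set_integrable lborel (\<Union>i. A i) f"
      unfolding set_integrable_def using A f by (intro integrable_mult_indicator) auto
    then have "(LINT x:(\<Union>i. A i)|lborel. f x) = (\<Sum>i. (LINT x:(A i)|lborel. f x))"
      using union(1) A by (intro lebesgue_integral_countable_add) (auto simp: disjoint_family_on_def)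
    then show ?case using union(3) by simp
  qed
qed

text \<open>The fundamental lemma of the calculus of variations: the indicator of a box is a bounded
  pointwise limit of test functions supported in the closed box, so \<open>f\<close> integrates to
  zero over every small box.\<close>

lemma L2fun_zero_on_open:
  fixes f :: "'a::euclidean_space \<Rightarrow> complex"
  assumes f: "L2fun f" and U: "open U" and zero: "\<And>\<phi>. test_fn U \<phi> \<Longrightarrow> (LBINT x. f x * \<phi> x) = 0"
  shows "AE x in lborel. x \<in> U \<longrightarrow> f x = 0"
proof (rule AE_on_open_locally)
  fix x assume "x \<in> U"
  then obtain l u where lu: "cbox l u \<subseteq> U" "x \<in> box l u" "\<forall>i\<in>Basis. l \<bullet> i < u \<bullet> i"
    using open_contains_cbox[OF U] by metis
  have [measurable]: "f \<in> borel_measurable borel" using f by (simp add: L2fun_def)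
  have int_box: "integrable lborel (\<lambda>x. indicator (box l' u') x *\<^sub>R f x)" for l' u'
  proof -
    have L: "L2fun (\<lambda>x. indicator (box l' u') x * f x)" by (intro L2fun_indicator f) simp
    have "bounded (box l' u')" by simp
    then obtain R where "\<And>x. x \<in> box l' u' \<Longrightarrow> norm x < R" using bounded_pos_less by metis
    then have "AE x in lborel. x \<notin> ball 0 R \<longrightarrow> indicator (box l' u') x * f x = 0"
      by (intro AE_I2) (auto simp: indicator_def)
    from L2_bounded_support_integrable[OF L this] show ?thesis
      by (rule Bochner_Integration.integrable_cong[THEN iffD1, rotated -1]) (auto simp: indicator_def)
  qed
  have box0: "(LBINT x. indicator (box l' u') x *\<^sub>R f x) = 0" if sub: "box l' u' \<subseteq> box l u" for l' u'
  proof (cases "box l' u' = {}")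
    case False
    have "cbox l' u' \<subseteq> cbox l u"
      using closure_mono[OF sub] False lu(2) by (metis closure_box empty_iff)
    then have K: "cbox l' u' \<subseteq> U" using lu(1) by simp
    \<comment> \<open>In each coordinate exp(-1/((k + 1) d)), with d the distance to a face, tends
      to 1 inside the box, and the factor is 0 beyond the face. The support thus stays in the closed
      box for all k.\<close>
    define \<phi> where "\<phi> k x = (\<Prod>b\<in>Basis. complex_of_real (exp_inv 0 (- (real (Suc k) * (l' \<bullet> b)) + real (Suc k) * (x \<bullet> b))) *
        complex_of_real (exp_inv 0 (real (Suc k) * (u' \<bullet> b) + (- real (Suc k)) * (x \<bullet> b))))" for k and x :: 'a
    have \<phi>0: "\<phi> k x = 0" if x: "x \<notin> box l' u'" for k x
    proof -
      obtain b where b: "b \<in> Basis" "x \<bullet> b \<le> l' \<bullet> b \<or> u' \<bullet> b \<le> x \<bullet> b"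
        using x by (auto simp: mem_box not_less)
      have "exp_inv 0 (- (real (Suc k) * (l' \<bullet> b)) + real (Suc k) * (x \<bullet> b)) = 0 \<or>
          exp_inv 0 (real (Suc k) * (u' \<bullet> b) + (- real (Suc k)) * (x \<bullet> b)) = 0"
        unfolding exp_inv_0_eq_0 using b(2)
        by (elim disjE) (simp_all add: mult_left_mono del: of_nat_Suc)
      then show ?thesis unfolding \<phi>_def using b(1) by (intro prod_zero) auto
    qed
    have t: "test_fn U (\<phi> k)" for k
    proof (rule test_fnI[OF _ compact_cbox K])
      show "smooth_fn (\<phi> k)"
        unfolding \<phi>_def[abs_def]
        by (intro smooth_closure_imp_smooth_fn smooth_closure_prod smooth_closure.mult smooth_closure_exp_inv_affine) simp
      show "\<phi> k x = 0" if "x \<notin> cbox l' u'" for x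
        using that box_subset_cbox by (intro \<phi>0) auto
    qed
    have lim: "(\<lambda>k. \<phi> k x * f x) \<longlonglongrightarrow> indicator (box l' u') x *\<^sub>R f x" for x
    proof (cases "x \<in> box l' u'")
      case True
      have e: "(\<lambda>k. complex_of_real (exp_inv 0 (real (Suc k) * a))) \<longlonglongrightarrow> 1" if a: "a > 0" for a
      proof -
        have "(\<lambda>k. exp (- (inverse (real (Suc k)) * (1 / a)))) \<longlonglongrightarrow> exp (- (0 * (1 / a)))"
          by (intro tendsto_intros LIMSEQ_inverse_real_of_nat)
        moreover have "exp_inv 0 (real (Suc k) * a) = exp (- (inverse (real (Suc k)) * (1 / a)))" for k
          using a by (simp add: exp_inv_def inverse_eq_divide del: of_nat_Suc)
        ultimately have "(\<lambda>k. exp_inv 0 (real (Suc k) * a)) \<longlonglongrightarrow> 1" by (simp del: of_nat_Suc)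
        from tendsto_of_real[OF this, where 'a = complex] show ?thesis by simp
      qed
      have "(\<lambda>k. \<phi> k x) \<longlonglongrightarrow> (\<Prod>b\<in>(Basis::'a set). 1 * 1)"
        unfolding \<phi>_def
      proof (intro tendsto_prod tendsto_mult)
        fix b :: 'a assume b: "b \<in> Basis"
        then have "l' \<bullet> b < x \<bullet> b" "x \<bullet> b < u' \<bullet> b" using True by (auto simp: mem_box)
        then show "(\<lambda>k. complex_of_real (exp_inv 0 (- (real (Suc k) * (l' \<bullet> b)) + real (Suc k) * (x \<bullet> b)))) \<longlonglongrightarrow> 1"
          "(\<lambda>k. complex_of_real (exp_inv 0 (real (Suc k) * (u' \<bullet> b) + (- real (Suc k)) * (x \<bullet> b)))) \<longlonglongrightarrow> 1"
          using e[of "x \<bullet> b - l' \<bullet> b"] e[of "u' \<bullet> b - x \<bullet> b"] by (simp_all add: algebra_simps)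
      qed
      then have "(\<lambda>k. \<phi> k x * f x) \<longlonglongrightarrow> 1 * f x" by (intro tendsto_mult) simp_all
      then show ?thesis using True by simp
    next
      case False
      then show ?thesis by (simp add: \<phi>0)
    qed
    have "(\<lambda>k. \<integral>x. \<phi> k x * f x \<partial>lborel) \<longlonglongrightarrow> (LBINT x. indicator (box l' u') x *\<^sub>R f x)"
    proof (rule integral_dominated_convergence)
      show "integrable lborel (\<lambda>x. norm (indicator (box l' u') x *\<^sub>R f x))"
        by (rule integrable_norm[OF int_box])
      show "AE x in lborel. norm (\<phi> k x * f x) \<le> norm (indicator (box l' u') x *\<^sub>R f x)" for k
      proof (intro AE_I2)
        fix x
        have "cmod (\<phi> k x) \<le> (\<Prod>b\<in>(Basis::'a set). 1)"
          unfolding \<phi>_def prod_norm[symmetric]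
          by (intro prod_mono) (auto simp: norm_mult exp_inv_0_nonneg exp_inv_0_le_1 intro!: mult_le_one)
        then show "norm (\<phi> k x * f x) \<le> norm (indicator (box l' u') x *\<^sub>R f x)"
          using \<phi>0[of x k] by (cases "x \<in> box l' u'") (auto simp: norm_mult intro!: mult_left_le_one_le)
      qed
      show "(\<lambda>x. \<phi> k x * f x) \<in> borel_measurable lborel" for k
        using test_fn_measurable[OF t[of k]] by simp
    qed (use lim in \<open>auto simp: borel_measurable_scaleR\<close>)
    moreover have "(LBINT x. \<phi> k x * f x) = 0" for k
      using zero[OF t[of k]] by (simp add: mult.commute)
    ultimately show ?thesis by (simp add: LIMSEQ_const_iff)
  qed simp
  have "AE x in lborel. indicator (box l u) x *\<^sub>R f x = 0"
  proof (rule integral_zero_on_boxes[where l = l and u = u, OF int_box])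
    fix l' u' :: 'a
    obtain l'' u'' where b: "box l' u' \<inter> box l u = box l'' u''" by (rule that[OF box_Int_box])
    have "(LBINT x. indicator (box l' u') x *\<^sub>R (indicator (box l u) x *\<^sub>R f x)) = (LBINT x. indicator (box l'' u'') x *\<^sub>R f x)"
      unfolding b[symmetric] by (intro Bochner_Integration.integral_cong) (auto simp: indicator_def)
    also have "\<dots> = 0" by (rule box0) (use b in auto)
    finally show "(LBINT x. indicator (box l' u') x *\<^sub>R (indicator (box l u) x *\<^sub>R f x)) = 0" .
  qed simp
  then have "AE y in lborel. y \<in> box l u \<longrightarrow> f y = 0"
    by (auto simp: indicator_def elim!: eventually_mono)
  then show "\<exists>V. open V \<and> x \<in> V \<and> (AE y in lborel. y \<in> V \<longrightarrow> f y = 0)"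
    using lu(2) open_box by blast
qed

text \<open>Besides the support, only estimates on the transform side are exported. The first holds
  since \<eta> is nonnegative with integral 1, the second since |cis(-(x \<bullet> \<xi>)) - 1|
  \<le> |x| |\<xi>| and |x| < \<epsilon> on the support.\<close>

lemma mollifier_exists:
  assumes "\<epsilon> > 0"
  obtains \<eta> :: "'a::euclidean_space \<Rightarrow> complex" where "test_fn (ball 0 \<epsilon>) \<eta>"
    "\<And>\<xi>. cmod (fourier \<eta> \<xi>) \<le> 1" "\<And>\<xi>. cmod (fourier \<eta> \<xi> - 1) \<le> \<epsilon> * norm \<xi>"
proof -
  define r where "r = \<epsilon> / 2"
  have r: "r > 0" using assms by (simp add: r_def)
  define h where "h x = exp_inv 0 (r\<^sup>2 - 1 * ((x - 0) \<bullet> (x - 0)))" for x :: 'a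
  have h_pos: "h x > 0 \<longleftrightarrow> norm x < r" for x
    using r unfolding h_def exp_inv_0_pos
    by (auto simp: dot_square_norm intro: power_strict_mono power2_less_imp_less)
  have h0: "h x \<ge> 0" for x unfolding h_def by (rule exp_inv_0_nonneg)
  have h_out: "h x = 0" if "x \<notin> cball 0 r" for x
    using h_pos[of x] h0[of x] that by (auto simp: less_le)
  have th: "test_fn (ball 0 \<epsilon>) (\<lambda>x. complex_of_real (h x))"
  proof (rule test_fnI[OF _ compact_cball[of 0 r]])
    show "smooth_fn (\<lambda>x. complex_of_real (h x))"
      unfolding h_def by (intro smooth_closure_imp_smooth_fn smooth_closure_exp_inv_quadratic)
    show "cball 0 r \<subseteq> ball 0 \<epsilon>" using assms by (auto simp: r_def)
  qed (use h_out in auto)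
  have inth: "integrable lborel h"
    using integrable_Re[OF test_fn_integrable[OF th]] by simp
  define I where "I = (LBINT x. h x)"
  have I: "I > 0"
  proof (rule ccontr)
    assume "\<not> I > 0"
    then have "I = 0" unfolding I_def using Bochner_Integration.integral_nonneg[of lborel h] h0 by (simp add: less_le)
    then have "AE x in lborel. h x = 0"
      unfolding I_def using h0 by (subst (asm) integral_nonneg_eq_0_iff_AE[OF inth]) auto
    then have "AE x in lborel. x \<notin> ball (0::'a) r"
    proof eventually_elim
      case (elim x)
      then show ?case using h_pos[of x] by simp
    qed
    then have "emeasure lborel (ball (0::'a) r) = 0"
      by (subst (asm) AE_iff_measurable[of "ball 0 r"]) auto
    then have "measure lborel (ball (0::'a) r) = 0" by (simp add: measure_def)
    then show False using content_ball_pos[OF r, of "0::'a"] by simp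
  qed
  define \<eta> where "\<eta> x = complex_of_real (h x / I)" for x
  have t: "test_fn (ball 0 \<epsilon>) \<eta>"
    using test_fn_cmult[OF th, of "1 / of_real I"] by (simp add: \<eta>_def[abs_def])
  have int\<eta>: "integrable lborel \<eta>" by (rule test_fn_integrable[OF t])
  have norm\<eta>: "cmod (\<eta> x) = h x / I" for x
    using I h0[of x] by (simp add: \<eta>_def norm_divide)
  have I1: "(LBINT x. \<eta> x) = 1" "(LBINT x. h x / I) = 1"
    using I unfolding \<eta>_def by (simp_all add: I_def[symmetric] del: of_real_divide)
  have "cmod (fourier \<eta> \<xi>) \<le> 1" for \<xi>
    using fourier_bound[OF int\<eta>, of \<xi>] I1(2) by (simp add: norm\<eta>)
  moreover have "cmod (fourier \<eta> \<xi> - 1) \<le> \<epsilon> * norm \<xi>" for \<xi>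
  proof -
    have i: "integrable lborel (\<lambda>x. cis (- (x \<bullet> \<xi>)) * \<eta> x)"
      by (rule integrable_cis_mult[OF int\<eta>]) simp
    have "fourier \<eta> \<xi> - 1 = (LBINT x. cis (- (x \<bullet> \<xi>)) * \<eta> x - \<eta> x)"
      unfolding fourier_def by (subst Bochner_Integration.integral_diff[OF i int\<eta>]) (simp add: I1)
    also have "cmod \<dots> \<le> (LBINT x. norm (cis (- (x \<bullet> \<xi>)) * \<eta> x - \<eta> x))"
      by (rule integral_norm_bound)
    also have "\<dots> \<le> (LBINT x. \<epsilon> * norm \<xi> * (h x / I))"
    proof (rule integral_mono)
      show "integrable lborel (\<lambda>x. norm (cis (- (x \<bullet> \<xi>)) * \<eta> x - \<eta> x))" using i int\<eta> by simp
      show "integrable lborel (\<lambda>x. \<epsilon> * norm \<xi> * (h x / I))" using inth by simp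
      fix x :: 'a
      show "norm (cis (- (x \<bullet> \<xi>)) * \<eta> x - \<eta> x) \<le> \<epsilon> * norm \<xi> * (h x / I)"
      proof (cases "x \<in> ball 0 \<epsilon>")
        case True
        have "cmod (cis (- (x \<bullet> \<xi>)) - 1) \<le> \<bar>x \<bullet> \<xi>\<bar>"
          using iexp_approx1[of "- (x \<bullet> \<xi>)" 0] by (simp add: cis_conv_exp)
        also have "\<dots> \<le> norm x * norm \<xi>" by (rule Cauchy_Schwarz_ineq2)
        also have "\<dots> \<le> \<epsilon> * norm \<xi>" using True by (intro mult_right_mono) auto
        finally have "cmod (cis (- (x \<bullet> \<xi>)) - 1) * cmod (\<eta> x) \<le> \<epsilon> * norm \<xi> * cmod (\<eta> x)"
          by (rule mult_right_mono) simp
        then show ?thesis unfolding norm\<eta>[symmetric] norm_mult[symmetric] by (simp add: algebra_simps)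
      next
        case False
        then have "\<eta> x = 0" using test_fn_outside[OF t] by blast
        then show ?thesis using h0[of x] I assms by (simp add: zero_le_mult_iff)
      qed
    qed
    also have "\<dots> = \<epsilon> * norm \<xi>" using I1(2) by simp
    finally show ?thesis .
  qed
  ultimately show ?thesis using that[OF t] by blast
qed

lemma fourier_convolution:
  fixes f :: "'a::euclidean_space \<Rightarrow> complex"
  assumes \<eta>: "integrable lborel \<eta>" and f: "integrable lborel f"
  shows "fourier (\<lambda>x. \<integral>y. \<eta> (x - y) * f y \<partial>lborel) \<xi> = fourier \<eta> \<xi> * fourier f \<xi>"
proof -
  have [measurable]: "\<eta> \<in> borel_measurable borel" "f \<in> borel_measurable borel" using \<eta> f by auto
  have int: "integrable (lborel \<Otimes>\<^sub>M lborel) (\<lambda>(y, x). cis (- (x \<bullet> \<xi>)) * (\<eta> (x - y) * f y))"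
  proof (rule lborel_pair.Fubini_integrable)
    have "(LBINT x. norm (case (y, x) of (y, x) \<Rightarrow> cis (- (x \<bullet> \<xi>)) * (\<eta> (x - y) * f y))) = (LBINT x. cmod (\<eta> x)) * cmod (f y)" for y
    proof -
      have "(LBINT x. cmod (\<eta> (x - y))) = (LBINT x. cmod (\<eta> x))"
        by (subst integral_affine[of "\<lambda>x. cmod (\<eta> (x - y))" 1 y]) auto
      then show ?thesis by (simp add: norm_mult)
    qed
    then show "integrable lborel (\<lambda>y. \<integral>x. norm (case (y, x) of (y, x) \<Rightarrow> cis (- (x \<bullet> \<xi>)) * (\<eta> (x - y) * f y)) \<partial>lborel)"
      using f by simp
    have "integrable lborel (\<lambda>x. cis (- (x \<bullet> \<xi>)) * (\<eta> (x - y) * f y))" for y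
      using integrable_affine[OF \<eta>, of 1 "- y"] by (intro integrable_cis_mult integrable_mult_left) auto
    then show "AE y in lborel. integrable lborel (\<lambda>x. case (y, x) of (y, x) \<Rightarrow> cis (- (x \<bullet> \<xi>)) * (\<eta> (x - y) * f y))"
      by simp
  qed measurable
  have "fourier (\<lambda>x. \<integral>y. \<eta> (x - y) * f y \<partial>lborel) \<xi> = (LBINT x. (LBINT y. cis (- (x \<bullet> \<xi>)) * (\<eta> (x - y) * f y)))"
    by (simp add: fourier_def)
  also have "\<dots> = (LBINT y. (LBINT x. cis (- (x \<bullet> \<xi>)) * (\<eta> (x - y) * f y)))"
    by (rule lborel_pair.Fubini_integral[OF int])
  also have "\<dots> = (LBINT y. fourier \<eta> \<xi> * (cis (- (y \<bullet> \<xi>)) * f y))"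
  proof (rule Bochner_Integration.integral_cong[OF refl])
    fix y :: 'a
    have "(LBINT x. cis (- (x \<bullet> \<xi>)) * (\<eta> (x - y) * f y)) = fourier (\<lambda>x. \<eta> (x + (- y))) \<xi> * f y"
      by (simp add: fourier_def integral_mult_left_zero[symmetric] mult.assoc del: integral_mult_left_zero)
    also have "\<dots> = fourier \<eta> \<xi> * (cis (- (y \<bullet> \<xi>)) * f y)"
      by (subst fourier_translate) (simp_all add: mult_ac)
    finally show "(LBINT x. cis (- (x \<bullet> \<xi>)) * (\<eta> (x - y) * f y)) = fourier \<eta> \<xi> * (cis (- (y \<bullet> \<xi>)) * f y)" .
  qed
  also have "\<dots> = fourier \<eta> \<xi> * fourier f \<xi>" by (simp add: fourier_def)
  finally show ?thesis .
qed

lemma peetre_inequality: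
  fixes \<xi> \<eta> :: "'a::euclidean_space"
  shows "1 + (norm \<xi>)\<^sup>2 \<le> 2 * ((1 + (norm (\<xi> + \<eta>))\<^sup>2) * (1 + (norm \<eta>)\<^sup>2))"
proof -
  have "norm \<xi> \<le> norm (\<xi> + \<eta>) + norm \<eta>"
    using norm_triangle_ineq4[of "\<xi> + \<eta>" \<eta>] by simp
  then have "(norm \<xi>)\<^sup>2 \<le> (norm (\<xi> + \<eta>) + norm \<eta>)\<^sup>2" by (intro power_mono) auto
  also have "\<dots> \<le> 2 * (norm (\<xi> + \<eta>))\<^sup>2 + 2 * (norm \<eta>)\<^sup>2"
    using sum_squares_bound[of "norm (\<xi> + \<eta>)" "norm \<eta>"] by (simp add: power2_sum)
  finally have "(norm \<xi>)\<^sup>2 \<le> 2 * (norm (\<xi> + \<eta>))\<^sup>2 + 2 * (norm \<eta>)\<^sup>2" .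
  moreover have "x \<le> 2 * a + 2 * b \<Longrightarrow> 0 \<le> a * b \<Longrightarrow> 1 + x \<le> 2 * ((1 + a) * (1 + b))" for x a b :: real
    by (simp add: algebra_simps)
  ultimately show ?thesis by simp
qed

text \<open>In essence Young's inequality for an L1 and an L2 function: \<open>k\<close> is
  integrable by the rapid decay of the transform of \<kappa>, and \<open>b\<close> is square
  integrable by hypothesis. It is proved by Cauchy-Schwarz with \<open>k\<close> split as sqrt k
  times sqrt k, followed by Fubini.\<close>

theorem cutoff_multiplication_bracket_finite:
  fixes w \<kappa> :: "'a::euclidean_space \<Rightarrow> complex"
  assumes \<kappa>: "test_fn U \<kappa>" and w: "integrable lborel w" and s: "s \<ge> 0"
    and fin: "sobolev_sq s (fourier w) < \<infinity>"
  shows "sobolev_sq s (fourier (\<lambda>x. \<kappa> x * w x)) < \<infinity>"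
proof -
  have [measurable]: "w \<in> borel_measurable borel" "\<kappa> \<in> borel_measurable borel"
    using w test_fn_measurable[OF \<kappa>] by auto
  define k where "k \<eta> = bracket (s / 2) \<eta> * cmod (fourier \<kappa> (- \<eta>))" for \<eta> :: 'a
  define b where "b \<xi> = bracket (s / 2) \<xi> * cmod (fourier w \<xi>)" for \<xi> :: 'a
  have k0: "k \<eta> \<ge> 0" and b0: "b \<eta> \<ge> 0" for \<eta> by (simp_all add: k_def b_def)
  have [measurable]: "k \<in> borel_measurable borel" "b \<in> borel_measurable borel"
    unfolding k_def[abs_def] b_def[abs_def] by measurable
  have pow2: "(bracket (s / 2) \<xi>)\<^sup>2 = bracket s \<xi>" for \<xi> :: 'a
    by (simp add: power2_eq_square powr_add[symmetric])
  have b2: "(\<integral>\<^sup>+ \<xi>. ennreal ((b \<xi>)\<^sup>2) \<partial>lborel) < \<infinity>"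
    using fin by (simp add: b_def power_mult_distrib pow2)
  have kfin: "(\<integral>\<^sup>+ \<eta>. ennreal (k \<eta>) \<partial>lborel) < \<infinity>"
  proof -
    define m where "m = nat \<lceil>s / 2\<rceil>"
    have m: "s / 2 \<le> real m" unfolding m_def by linarith
    have "(\<integral>\<^sup>+ \<eta>. ennreal (k \<eta>) \<partial>lborel) = (\<integral>\<^sup>+ \<eta>. ennreal (bracket (s / 2) \<eta> * cmod (fourier \<kappa> \<eta>)) \<partial>lborel)"
      using nn_integral_uminus[of "\<lambda>\<eta>. ennreal (bracket (s / 2) \<eta> * cmod (fourier \<kappa> \<eta>))"] by (simp add: k_def)
    also have "\<dots> \<le> (\<integral>\<^sup>+ \<eta>. ennreal (norm ((1 + (norm \<eta>)\<^sup>2) ^ m * cmod (fourier \<kappa> \<eta>))) \<partial>lborel)"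
    proof (intro nn_integral_mono ennreal_leI)
      fix \<eta> :: 'a
      have "1 + (norm \<eta>)\<^sup>2 > 0" by (rule add_pos_nonneg) auto
      then have "bracket (s / 2) \<eta> \<le> (1 + (norm \<eta>)\<^sup>2) ^ m"
        using m by (subst powr_realpow[symmetric]) (auto intro!: powr_mono)
      then have "bracket (s / 2) \<eta> * cmod (fourier \<kappa> \<eta>) \<le> (1 + (norm \<eta>)\<^sup>2) ^ m * cmod (fourier \<kappa> \<eta>)"
        by (intro mult_right_mono) auto
      then show "bracket (s / 2) \<eta> * cmod (fourier \<kappa> \<eta>) \<le> norm ((1 + (norm \<eta>)\<^sup>2) ^ m * cmod (fourier \<kappa> \<eta>))" by simp
    qed
    also have "\<dots> < \<infinity>"
      using integrable_fourier_test_fn(1)[OF \<kappa>, of m] unfolding integrable_iff_bounded by simp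
    finally show ?thesis .
  qed
  \<comment> \<open>The transform of \<open>\<kappa> w\<close> is a convolution; Peetre's inequality moves the weight onto the factors.\<close>
  define D where "D = 2 powr (s / 2) * (2 * pi) powr (- real DIM('a))"
  have D: "D \<ge> 0" by (simp add: D_def)
  have pt: "ennreal (bracket s \<xi> * (cmod (fourier (\<lambda>x. \<kappa> x * w x) \<xi>))\<^sup>2) \<le>
     ennreal (D\<^sup>2) * ((\<integral>\<^sup>+ \<eta>. ennreal ((b (\<xi> + \<eta>))\<^sup>2) * ennreal (k \<eta>) \<partial>lborel) * (\<integral>\<^sup>+ \<eta>. ennreal (k \<eta>) \<partial>lborel))" for \<xi>
  proof -
    have ig: "integrable lborel (\<lambda>x. cis (- (x \<bullet> \<xi>)) * w x)" by (rule integrable_cis_mult[OF w]) simp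
    have Fg: "fourier (\<lambda>x. cis (- (x \<bullet> \<xi>)) * w x) \<eta> = fourier w (\<xi> + \<eta>)" for \<eta>
      unfolding fourier_def by (simp add: mult.assoc[symmetric] cis_mult inner_add_right add.commute)
    have "fourier (\<lambda>x. \<kappa> x * w x) \<xi> = pair (fourier (\<lambda>x. cis (- (x \<bullet> \<xi>)) * w x)) \<kappa>"
      by (subst pair_fourier[OF ig \<kappa>]) (simp add: fourier_def mult_ac)
    then have "ennreal (bracket (s / 2) \<xi> * cmod (fourier (\<lambda>x. \<kappa> x * w x) \<xi>)) =
        ennreal (bracket (s / 2) \<xi> * (2 * pi) powr (- real DIM('a))) * ennreal (cmod (LBINT \<eta>. fourier w (\<xi> + \<eta>) * fourier \<kappa> (- \<eta>)))"
      unfolding pair_def Fg by (simp add: norm_mult ennreal_mult[symmetric] mult.assoc)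
    also have "\<dots> \<le> ennreal (bracket (s / 2) \<xi> * (2 * pi) powr (- real DIM('a))) * (\<integral>\<^sup>+ \<eta>. ennreal (cmod (fourier w (\<xi> + \<eta>) * fourier \<kappa> (- \<eta>))) \<partial>lborel)"
    proof (intro mult_left_mono integral_norm_bound_ennreal)
      have "integrable lborel (\<lambda>\<eta>. fourier \<kappa> (- \<eta>))"
        using integrable_affine[OF integrable_fourier_test_fn(3)[OF \<kappa>], of "-1" 0] by simp
      then show "integrable lborel (\<lambda>\<eta>. fourier w (\<xi> + \<eta>) * fourier \<kappa> (- \<eta>))"
        using fourier_bound[OF w] by (intro integrable_bounded_mult) auto
    qed simp
    also have "\<dots> = (\<integral>\<^sup>+ \<eta>. ennreal (bracket (s / 2) \<xi> * (2 * pi) powr (- real DIM('a))) * ennreal (cmod (fourier w (\<xi> + \<eta>) * fourier \<kappa> (- \<eta>))) \<partial>lborel)"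
      by (subst nn_integral_cmult) auto
    also have "\<dots> \<le> (\<integral>\<^sup>+ \<eta>. ennreal D * ((ennreal (b (\<xi> + \<eta>)) * ennreal (sqrt (k \<eta>))) * ennreal (sqrt (k \<eta>))) \<partial>lborel)"
    proof (intro nn_integral_mono)
      fix \<eta> :: 'a
      have "bracket (s / 2) \<xi> \<le> (2 * ((1 + (norm (\<xi> + \<eta>))\<^sup>2) * (1 + (norm \<eta>)\<^sup>2))) powr (s / 2)"
        using s by (intro powr_mono2 peetre_inequality) auto
      also have "\<dots> = 2 powr (s / 2) * (bracket (s / 2) (\<xi> + \<eta>) * bracket (s / 2) \<eta>)"
        by (simp add: powr_mult)
      finally have "bracket (s / 2) \<xi> * ((2 * pi) powr (- real DIM('a)) * cmod (fourier w (\<xi> + \<eta>) * fourier \<kappa> (- \<eta>))) \<le>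
          2 powr (s / 2) * (bracket (s / 2) (\<xi> + \<eta>) * bracket (s / 2) \<eta>) * ((2 * pi) powr (- real DIM('a)) * cmod (fourier w (\<xi> + \<eta>) * fourier \<kappa> (- \<eta>)))"
        by (rule mult_right_mono) simp
      also have "\<dots> = D * (b (\<xi> + \<eta>) * k \<eta>)"
        by (simp add: D_def b_def k_def norm_mult mult_ac)
      also have "\<dots> = D * ((b (\<xi> + \<eta>) * sqrt (k \<eta>)) * sqrt (k \<eta>))"
        using k0[of \<eta>] by (simp add: mult.assoc)
      finally show "ennreal (bracket (s / 2) \<xi> * (2 * pi) powr (- real DIM('a))) * ennreal (cmod (fourier w (\<xi> + \<eta>) * fourier \<kappa> (- \<eta>)))
          \<le> ennreal D * ((ennreal (b (\<xi> + \<eta>)) * ennreal (sqrt (k \<eta>))) * ennreal (sqrt (k \<eta>)))"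
        using D b0 k0 by (simp add: ennreal_mult[symmetric] mult.assoc ennreal_leI)
    qed
    also have "\<dots> = ennreal D * (\<integral>\<^sup>+ \<eta>. (ennreal (b (\<xi> + \<eta>)) * ennreal (sqrt (k \<eta>))) * ennreal (sqrt (k \<eta>)) \<partial>lborel)"
      by (rule nn_integral_cmult) measurable
    finally have le: "ennreal (bracket (s / 2) \<xi> * cmod (fourier (\<lambda>x. \<kappa> x * w x) \<xi>)) \<le> \<dots>" .
    have "ennreal (bracket s \<xi> * (cmod (fourier (\<lambda>x. \<kappa> x * w x) \<xi>))\<^sup>2) = (ennreal (bracket (s / 2) \<xi> * cmod (fourier (\<lambda>x. \<kappa> x * w x) \<xi>)))\<^sup>2"
      by (simp add: ennreal_power power_mult_distrib pow2)
    also have "\<dots> \<le> (ennreal D * (\<integral>\<^sup>+ \<eta>. (ennreal (b (\<xi> + \<eta>)) * ennreal (sqrt (k \<eta>))) * ennreal (sqrt (k \<eta>)) \<partial>lborel))\<^sup>2"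
      using le by (rule power_mono) simp
    also have "\<dots> = ennreal (D\<^sup>2) * (\<integral>\<^sup>+ \<eta>. (ennreal (b (\<xi> + \<eta>)) * ennreal (sqrt (k \<eta>))) * ennreal (sqrt (k \<eta>)) \<partial>lborel)\<^sup>2"
      using D by (simp add: power_mult_distrib ennreal_power)
    also have "\<dots> \<le> ennreal (D\<^sup>2) * ((\<integral>\<^sup>+ \<eta>. (ennreal (b (\<xi> + \<eta>)) * ennreal (sqrt (k \<eta>)))\<^sup>2 \<partial>lborel) * (\<integral>\<^sup>+ \<eta>. (ennreal (sqrt (k \<eta>)))\<^sup>2 \<partial>lborel))"
      by (intro mult_left_mono Cauchy_Schwarz_nn_integral) auto
    finally show ?thesis
      using b0 k0 by (simp add: power_mult_distrib ennreal_power)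
  qed
  have "sobolev_sq s (fourier (\<lambda>x. \<kappa> x * w x)) \<le>
      (\<integral>\<^sup>+ \<xi>. ennreal (D\<^sup>2) * ((\<integral>\<^sup>+ \<eta>. ennreal ((b (\<xi> + \<eta>))\<^sup>2) * ennreal (k \<eta>) \<partial>lborel) * (\<integral>\<^sup>+ \<eta>. ennreal (k \<eta>) \<partial>lborel)) \<partial>lborel)"
    by (intro nn_integral_mono pt)
  also have "\<dots> = ennreal (D\<^sup>2) * ((\<integral>\<^sup>+ \<xi>. (\<integral>\<^sup>+ \<eta>. ennreal ((b (\<xi> + \<eta>))\<^sup>2) * ennreal (k \<eta>) \<partial>lborel) \<partial>lborel) * (\<integral>\<^sup>+ \<eta>. ennreal (k \<eta>) \<partial>lborel))"
    by (simp add: nn_integral_cmult nn_integral_multc)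
  finally have le: "sobolev_sq s (fourier (\<lambda>x. \<kappa> x * w x)) \<le> \<dots>" .
  have "(\<integral>\<^sup>+ \<xi>. (\<integral>\<^sup>+ \<eta>. ennreal ((b (\<xi> + \<eta>))\<^sup>2) * ennreal (k \<eta>) \<partial>lborel) \<partial>lborel) =
      (\<integral>\<^sup>+ \<eta>. (\<integral>\<^sup>+ \<xi>. ennreal ((b (\<xi> + \<eta>))\<^sup>2) * ennreal (k \<eta>) \<partial>lborel) \<partial>lborel)"
    by (rule lborel_pair.Fubini'[symmetric]) measurable
  also have "\<dots> = (\<integral>\<^sup>+ \<eta>. (\<integral>\<^sup>+ \<xi>. ennreal ((b \<xi>)\<^sup>2) \<partial>lborel) * ennreal (k \<eta>) \<partial>lborel)"
  proof (rule nn_integral_cong)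
    fix \<eta> :: 'a
    have "(\<integral>\<^sup>+ \<xi>. ennreal ((b \<xi>)\<^sup>2) \<partial>lborel) = (\<integral>\<^sup>+ \<xi>. ennreal ((b (\<xi> + \<eta>))\<^sup>2) \<partial>lborel)"
      by (subst nn_integral_affine[of _ 1 \<eta>]) (auto simp: add.commute)
    then show "(\<integral>\<^sup>+ \<xi>. ennreal ((b (\<xi> + \<eta>))\<^sup>2) * ennreal (k \<eta>) \<partial>lborel) = (\<integral>\<^sup>+ \<xi>. ennreal ((b \<xi>)\<^sup>2) \<partial>lborel) * ennreal (k \<eta>)"
      by (subst nn_integral_multc) auto
  qed
  also have "\<dots> = (\<integral>\<^sup>+ \<xi>. ennreal ((b \<xi>)\<^sup>2) \<partial>lborel) * (\<integral>\<^sup>+ \<eta>. ennreal (k \<eta>) \<partial>lborel)"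
    by (subst nn_integral_cmult) auto
  finally have eq: "(\<integral>\<^sup>+ \<xi>. (\<integral>\<^sup>+ \<eta>. ennreal ((b (\<xi> + \<eta>))\<^sup>2) * ennreal (k \<eta>) \<partial>lborel) \<partial>lborel) = \<dots>" .
  show ?thesis
    by (rule le_less_trans[OF le]) (use b2 kfin in \<open>auto simp: eq ennreal_mult_less_top\<close>)
qed

section \<open>Uniqueness for the Dirichlet problem\<close>

text \<open>In the interior the direction \<open>e = 0\<close> works; at a boundary point \<open>e\<close> is minus the gradient
of the local defining function.\<close>

lemma smooth_boundary_inward:
  fixes \<Omega> :: "'a::euclidean_space set"
  assumes sb: "smooth_boundary \<Omega>" and op: "open \<Omega>" and x: "x \<in> closure \<Omega>"
  obtains e r t0 where "r > 0" "t0 > 0"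
    "\<And>y t. y \<in> closure \<Omega> \<Longrightarrow> y \<in> ball x r \<Longrightarrow> 0 < t \<Longrightarrow> t < t0 \<Longrightarrow> y + t *\<^sub>R e \<in> \<Omega>"
proof (cases "x \<in> \<Omega>")
  case True
  then obtain r where "r > 0" "ball x r \<subseteq> \<Omega>" using op open_contains_ball by blast
  then show ?thesis by (intro that[of r 1 0]) auto
next
  case False
  then have xf: "x \<in> frontier \<Omega>" using x op by (simp add: frontier_def interior_open)
  obtain r \<rho> where r: "r > 0" and \<rho>: "smooth_fn \<rho>"
    and D: "\<forall>y\<in>ball x r. \<exists>D. (\<rho> has_derivative D) (at y) \<and> D \<noteq> (\<lambda>_. 0)"
    and sub: "\<Omega> \<inter> ball x r = {y\<in>ball x r. \<rho> y < (0::real)}"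
    using bspec[OF sb[unfolded smooth_boundary_def] xf] by (elim exE conjE) (rule that; assumption)
  obtain D where D: "\<And>y. y \<in> ball x r \<Longrightarrow> (\<rho> has_derivative D y) (at y)" "\<And>y. y \<in> ball x r \<Longrightarrow> D y \<noteq> (\<lambda>_. 0)"
    using bchoice[OF D] by blast
  have "\<exists>g. (\<forall>y. ((\<lambda>t::real. \<rho> (y + t *\<^sub>R b)) has_vector_derivative g y) (at 0)) \<and> smooth_fn g" if "b \<in> Basis" for b
    using smooth_fn_partial[OF \<rho> that] by metis
  then obtain g where g: "\<And>b y. b \<in> Basis \<Longrightarrow> ((\<lambda>t::real. \<rho> (y + t *\<^sub>R b)) has_vector_derivative g b y) (at 0)"
    "\<And>b. b \<in> Basis \<Longrightarrow> smooth_fn (g b)" by metis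
  \<comment> \<open>The total derivative from the definition of a smooth boundary is identified with
    the coordinate derivatives from \<open>smooth_fn\<close>, which are known to be continuous in
    y.\<close>
  have Dg: "D y b = g b y" if y: "y \<in> ball x r" and b: "b \<in> Basis" for y b
  proof -
    have "(\<rho> has_derivative D y) (at (y + 0 *\<^sub>R b))" using D(1)[OF y] by simp
    then have "((\<lambda>t::real. \<rho> (y + t *\<^sub>R b)) has_derivative (\<lambda>h. D y (h *\<^sub>R b))) (at 0)"
      by (rule has_derivative_compose[rotated]) (auto intro!: derivative_eq_intros)
    then have "((\<lambda>t::real. \<rho> (y + t *\<^sub>R b)) has_vector_derivative D y b) (at 0)"
      unfolding has_vector_derivative_def using linear_scale[OF has_derivative_linear[OF D(1)[OF y]]] by simp
    then show ?thesis using g(1)[OF b] vector_derivative_unique_at by blast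
  qed
  define e where "e = (\<Sum>b\<in>Basis. (- g b x) *\<^sub>R b)"
  \<comment> \<open>The derivative of \<rho> at y in the fixed direction \<open>e\<close>; at x it
    is minus the squared norm of the gradient.\<close>
  define q where "q y = (\<Sum>b\<in>Basis. - (g b x * g b y))" for y
  have De: "D y e = q y" if y: "y \<in> ball x r" for y
  proof -
    have l: "linear (D y)" by (rule has_derivative_linear[OF D(1)[OF y]])
    show ?thesis
      unfolding e_def linear_sum[OF l] linear_scale[OF l] q_def using Dg[OF y] by simp
  qed
  have xin: "x \<in> ball x r" using r by simp
  have "\<exists>b\<in>Basis. g b x \<noteq> 0"
  proof (rule ccontr)
    assume "\<not> (\<exists>b\<in>Basis. g b x \<noteq> 0)"
    then have "D x b = 0" if "b \<in> Basis" for b using Dg[OF xin that] that by simp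
    then have "D x = (\<lambda>_. 0)"
      using linear_eq_stdbasis[OF has_derivative_linear[OF D(1)[OF xin]] linear_zero] by (simp add: fun_eq_iff)
    then show False using D(2)[OF xin] by simp
  qed
  then obtain b0 where b0: "b0 \<in> Basis" "g b0 x \<noteq> 0" by blast
  have "0 < (\<Sum>b\<in>Basis. g b x * g b x)"
    using b0 by (intro sum_pos2[of _ b0]) (auto simp: zero_less_mult_iff)
  then have q0: "q x < 0" by (simp add: q_def sum_negf)
  have cq: "continuous_on UNIV q"
    unfolding q_def by (intro continuous_intros smooth_fn_continuous g)
  have oq: "open {y. q y < 0}"
    using open_vimage[OF _ cq, of "{..<0}"] by (simp add: vimage_def)
  then obtain r1 where r1: "r1 > 0" "ball x r1 \<subseteq> {y. q y < 0}"
    using q0 open_contains_ball by (metis mem_Collect_eq)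
  define \<delta> where "\<delta> = min r r1"
  have \<delta>: "\<delta> > 0" "ball x \<delta> \<subseteq> ball x r" "\<And>y. y \<in> ball x \<delta> \<Longrightarrow> q y < 0"
    using r r1 by (auto simp: \<delta>_def)
  \<comment> \<open>Small enough that |t e| \<le> \<delta>/2 for t < t0, so segments starting within
    \<delta>/2 of x stay in the ball of radius \<delta>. The summand 1 keeps the denominator
    positive.\<close>
  define t0 where "t0 = \<delta> / (2 * (1 + norm e))"
  have t0: "t0 > 0" using \<delta> by (simp add: t0_def add_pos_nonneg)
  have main: "y + t *\<^sub>R e \<in> \<Omega>" if y: "y \<in> closure \<Omega>" "y \<in> ball x (\<delta> / 2)" and t: "0 < t" "t < t0" for y t
  proof -
    have inb: "y + \<tau> *\<^sub>R e \<in> ball x \<delta>" if \<tau>: "0 \<le> \<tau>" "\<tau> \<le> t" for \<tau>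
    proof -
      have "\<tau> * norm e \<le> t0 * norm e" using \<tau> t by (intro mult_right_mono) auto
      also have "\<dots> \<le> t0 * (1 + norm e)" using t0 by (intro mult_left_mono) auto
      also have "\<dots> = \<delta> / 2" 
      proof -
        have "p \<noteq> 0 \<Longrightarrow> \<delta> / (2 * p) * p = \<delta> / 2" for p :: real by simp
        moreover have "1 + norm e \<noteq> 0" using norm_ge_zero[of e] by linarith
        ultimately show ?thesis unfolding t0_def by blast
      qed
      finally have "norm (\<tau> *\<^sub>R e) \<le> \<delta> / 2" using \<tau> by simp
      moreover have "norm (x - (y + \<tau> *\<^sub>R e)) \<le> norm (x - y) + norm (\<tau> *\<^sub>R e)"
        using norm_triangle_ineq4[of "x - y" "\<tau> *\<^sub>R e"] by (simp add: algebra_simps)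
      ultimately show ?thesis using y(2) by (simp add: dist_norm)
    qed
    have y_r: "y \<in> ball x r" using inb[of 0] t \<delta>(2) by auto
    \<comment> \<open>At points of the closure \<rho> cannot be positive: otherwise it would be
      positive on a whole neighbourhood, which would then miss \<Omega>.\<close>
    have \<rho>y: "\<rho> y \<le> 0"
    proof (rule ccontr)
      assume "\<not> \<rho> y \<le> 0"
      define O' where "O' = ball x r \<inter> {z. \<rho> z > 0}"
      have "open O'" unfolding O'_def
        using open_vimage[OF _ smooth_fn_continuous[OF \<rho>], of "{0<..}"] by (auto simp: vimage_def)
      moreover have "y \<in> O'" using y_r \<open>\<not> \<rho> y \<le> 0\<close> by (simp add: O'_def)
      ultimately have "\<Omega> \<inter> O' \<noteq> {}" using y(1) by (metis open_Int_closure_eq_empty inf_commute disjoint_iff)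
      then show False using sub by (force simp: O'_def)
    qed
    \<comment> \<open>The mean value theorem along the segment: \<rho> y \<le> 0 and a negative
      directional derivative make \<rho> strictly negative at the endpoint.\<close>
    have "\<exists>z>0. z < t \<and> \<rho> (y + t *\<^sub>R e) - \<rho> (y + 0 *\<^sub>R e) = (t - 0) * q (y + z *\<^sub>R e)"
    proof (rule MVT2[OF t(1)])
      fix \<tau> assume \<tau>: "0 \<le> \<tau>" "\<tau> \<le> t"
      have z: "y + \<tau> *\<^sub>R e \<in> ball x r" using inb[OF \<tau>] \<delta>(2) by auto
      have "((\<lambda>t::real. y + t *\<^sub>R e) has_derivative (\<lambda>h. h *\<^sub>R e)) (at \<tau>)"
        by (auto intro!: derivative_eq_intros)
      from has_derivative_compose[OF this D(1)[OF z]]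
      have "((\<lambda>t::real. \<rho> (y + t *\<^sub>R e)) has_derivative (\<lambda>h. D (y + \<tau> *\<^sub>R e) (h *\<^sub>R e))) (at \<tau>)" .
      then have "((\<lambda>t::real. \<rho> (y + t *\<^sub>R e)) has_vector_derivative q (y + \<tau> *\<^sub>R e)) (at \<tau>)"
        using linear_scale[OF has_derivative_linear[OF D(1)[OF z]]] De[OF z] by (simp add: has_vector_derivative_def)
      then show "((\<lambda>t::real. \<rho> (y + t *\<^sub>R e)) has_real_derivative q (y + \<tau> *\<^sub>R e)) (at \<tau>)"
        by (simp add: has_real_derivative_iff_has_vector_derivative)
    qed
    then obtain z where z: "0 < z" "z < t" "\<rho> (y + t *\<^sub>R e) - \<rho> y = t * q (y + z *\<^sub>R e)" by auto
    have "q (y + z *\<^sub>R e) < 0" using inb[of z] z by (intro \<delta>(3)) auto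
    then have "\<rho> (y + t *\<^sub>R e) < 0" using z(3) \<rho>y t(1) by (smt (verit) mult_pos_neg)
    moreover have "y + t *\<^sub>R e \<in> ball x r" using inb[of t] t \<delta>(2) by auto
    ultimately show ?thesis using sub by auto
  qed
  from \<delta>(1) have "\<delta> / 2 > 0" by simp
  from that[OF this t0 main] show ?thesis .
qed

lemma fourier_cnj: "fourier (\<lambda>x. cnj (f x)) (- \<xi>) = cnj (fourier f \<xi>)"
proof -
  have "fourier (\<lambda>x. cnj (f x)) (- \<xi>) = (LBINT x. cnj (cis (- (x \<bullet> \<xi>)) * f x))"
    by (simp add: fourier_def cis_cnj)
  also have "\<dots> = cnj (fourier f \<xi>)" unfolding fourier_def by (rule Bochner_Integration.integral_cnj)
  finally show ?thesis .
qed

lemma weak_form_integrable: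
  fixes f g :: "'a::euclidean_space \<Rightarrow> complex"
  assumes m: "f \<in> borel_measurable borel" "g \<in> borel_measurable borel" and s: "s > 0"
    and f: "sobolev_sq s f < \<infinity>"
    and g: "sobolev_sq s g < \<infinity>"
  shows "integrable lborel (\<lambda>\<xi>. complex_of_real (norm \<xi> powr (2 * s)) * f \<xi> * g \<xi>)"
proof -
  note [measurable] = m
  let ?h = "\<lambda>\<xi>. complex_of_real (norm \<xi> powr (2 * s)) * f \<xi>"
  have h: "sobolev_sq (- s) (\<lambda>\<xi>. ?h \<xi>) < \<infinity>"
    using norm_powr_mult_Hneg[OF m(1) s f] by (simp add: Hneg_def)
  have "(\<integral>\<^sup>+ \<xi>. ennreal (cmod (?h \<xi> * g \<xi>)) \<partial>lborel)\<^sup>2 < \<infinity>"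
    by (rule le_less_trans[OF bracket_Cauchy_Schwarz]) (use h g in \<open>auto simp: ennreal_mult_less_top\<close>)
  then have "(\<integral>\<^sup>+ \<xi>. ennreal (cmod (?h \<xi> * g \<xi>)) \<partial>lborel) < \<infinity>"
    by (cases "\<integral>\<^sup>+ \<xi>. ennreal (cmod (?h \<xi> * g \<xi>)) \<partial>lborel") (auto simp: power2_eq_square)
  then show ?thesis by (intro integrableI_bounded) auto
qed

lemma convolution_test_fn:
  fixes f :: "'a::euclidean_space \<Rightarrow> complex"
  assumes \<eta>: "test_fn (ball 0 \<epsilon>) \<eta>" and f: "integrable lborel f" and K: "compact K" "\<And>x. x \<notin> K \<Longrightarrow> f x = 0"
    and U: "\<And>x y. x \<in> K \<Longrightarrow> dist x y \<le> \<epsilon> \<Longrightarrow> y \<in> U"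
  shows "test_fn U (\<lambda>x. \<integral>y. \<eta> (x - y) * f y \<partial>lborel)"
proof (rule test_fnI[where K = "{x + y | x y. x \<in> K \<and> y \<in> cball 0 \<epsilon>}"])
  show "smooth_fn (\<lambda>x. \<integral>y. \<eta> (x - y) * f y \<partial>lborel)"
    by (rule smooth_fn_convolution[OF test_fn_mono[OF \<eta>] f]) simp
  show "compact {x + y | x y. x \<in> K \<and> y \<in> cball 0 \<epsilon>}"
    by (rule compact_sums[OF K(1) compact_cball])
  show "{x + y | x y. x \<in> K \<and> y \<in> cball 0 \<epsilon>} \<subseteq> U"
    using U by (auto simp: dist_norm)
  fix x assume x: "x \<notin> {x + y | x y. x \<in> K \<and> y \<in> cball 0 \<epsilon>}"
  have zero: "\<eta> (x - y) * f y = 0" for y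
  proof (cases "y \<in> K")
    case True
    have "x = y + (x - y)" by simp
    then have "x - y \<notin> cball 0 \<epsilon>" using x True by blast
    then have "x - y \<notin> ball 0 \<epsilon>" by auto
    then show ?thesis using test_fn_outside[OF \<eta>] by simp
  qed (simp add: K(2))
  show "(LBINT y. \<eta> (x - y) * f y) = 0" unfolding zero by simp
qed

text \<open>On the transform side the test functions are m_n times the conjugate transform of
  \<kappa> w, where m_n is the product of a mollifier transform and a translation phase. As |m_n|
  \<le> 1 and m_n tends to 1 pointwise, dominated convergence passes to the limit directly, without
  convergence in H^s. Translating before mollifying makes room between the support and the
  boundary.\<close>

lemma local_weak_form:
  fixes \<Omega> :: "'a::euclidean_space set" and w :: "'a \<Rightarrow> complex" and \<kappa> :: "'a \<Rightarrow> real"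
  assumes s: "s > 0" and op: "open \<Omega>" and bd: "bounded \<Omega>"
    and w: "L2fun w" "\<And>x. x \<notin> closure \<Omega> \<Longrightarrow> w x = 0"
    and fin: "sobolev_sq s (fourier w) < \<infinity>"
    and weak: "\<And>\<phi>. test_fn \<Omega> \<phi> \<Longrightarrow> (LBINT \<xi>. complex_of_real (norm \<xi> powr (2 * s)) * fourier w \<xi> * fourier \<phi> (- \<xi>)) = 0"
    and \<kappa>: "smooth_fn (\<lambda>x. complex_of_real (\<kappa> x))" "\<And>x. x \<notin> cball a r \<Longrightarrow> \<kappa> x = 0"
    and inward: "\<And>y t. y \<in> closure \<Omega> \<Longrightarrow> y \<in> cball a r \<Longrightarrow> 0 < t \<Longrightarrow> t < t0 \<Longrightarrow> y + t *\<^sub>R e \<in> \<Omega>" "t0 > 0"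
  shows "integrable lborel (\<lambda>\<xi>. complex_of_real (norm \<xi> powr (2 * s)) * fourier w \<xi> * cnj (fourier (\<lambda>x. of_real (\<kappa> x) * w x) \<xi>))"
    and "(LBINT \<xi>. complex_of_real (norm \<xi> powr (2 * s)) * fourier w \<xi> * cnj (fourier (\<lambda>x. of_real (\<kappa> x) * w x) \<xi>)) = 0"
proof -
  have t\<kappa>: "test_fn UNIV (\<lambda>x. complex_of_real (\<kappa> x))"
    using \<kappa>(2) by (intro test_fnI[OF \<kappa>(1) compact_cball[of a r]]) auto
  have [measurable]: "w \<in> borel_measurable borel" using w by (simp add: L2fun_def)
  have \<kappa>m[measurable]: "(\<lambda>x. complex_of_real (\<kappa> x)) \<in> borel_measurable borel" by (rule test_fn_measurable[OF t\<kappa>])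
  obtain R where R: "\<And>x. x \<in> closure \<Omega> \<Longrightarrow> norm x < R"
    using bounded_closure[OF bd] bounded_pos_less by metis
  have iw: "integrable lborel w"
    by (rule L2_bounded_support_integrable[OF w(1), of R]) (use R w(2) in force)
  define v where "v x = complex_of_real (\<kappa> x) * w x" for x
  have [measurable]: "v \<in> borel_measurable borel" unfolding v_def[abs_def] by measurable
  have finv: "sobolev_sq s (fourier v) < \<infinity>"
    unfolding v_def[abs_def] using s by (intro cutoff_multiplication_bracket_finite[OF t\<kappa> iw _ fin]) simp
  obtain C where C: "\<And>x. cmod (complex_of_real (\<kappa> x)) \<le> C" using test_fn_bounded[OF t\<kappa>] by metis
  have iv: "integrable lborel v"
    unfolding v_def[abs_def] using C by (intro integrable_bounded_mult iw) auto
  let ?W = "\<lambda>\<xi>. complex_of_real (norm \<xi> powr (2 * s)) * fourier w \<xi>"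
  have int: "integrable lborel (\<lambda>\<xi>. ?W \<xi> * cnj (fourier v \<xi>))"
    using finv by (intro weak_form_integrable s fin) auto
  then show "integrable lborel (\<lambda>\<xi>. ?W \<xi> * cnj (fourier (\<lambda>x. of_real (\<kappa> x) * w x) \<xi>))"
    by (simp add: v_def[abs_def])
  define f where "f x = cnj (v x)" for x
  have [measurable]: "f \<in> borel_measurable borel" unfolding f_def[abs_def] by measurable
  have f: "integrable lborel f" unfolding f_def[abs_def] using iv by simp
  define K where "K = closure \<Omega> \<inter> cball a r"
  have K: "compact K" unfolding K_def using bd by (auto intro!: closed_Int_compact)
  have fK: "f x = 0" if "x \<notin> K" for x
    using that \<kappa>(2)[of x] w(2)[of x] by (auto simp: f_def v_def K_def)
  \<comment> \<open>The offset 2 makes \<open>t n\<close> strictly smaller than \<open>t0\<close>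
    already for n = 0.\<close>
  define t where "t n = t0 / real (n + 2)" for n
  have t: "0 < t n" "t n < t0" for n
  proof -
    have "t0 * 1 < t0 * real (n + 2)" using inward(2) by (intro mult_strict_left_mono) auto
    then show "0 < t n" "t n < t0" using inward(2) by (simp_all add: t_def pos_divide_less_eq)
  qed
  have "\<exists>\<phi>. test_fn \<Omega> \<phi> \<and> (\<exists>m. (\<forall>\<xi>. fourier \<phi> (- \<xi>) = m \<xi> * cnj (fourier v \<xi>)) \<and> (\<forall>\<xi>. cmod (m \<xi>) \<le> 1) \<and>
      (\<forall>\<xi>. cmod (m \<xi> - cis ((t n *\<^sub>R e) \<bullet> \<xi>)) \<le> 1 / real (Suc n) * norm \<xi>))" for n
  proof -
    define fn where "fn x = f (x - t n *\<^sub>R e)" for x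
    define Kn where "Kn = (\<lambda>x. x + t n *\<^sub>R e) ` K"
    have Kn: "compact Kn" unfolding Kn_def using K by (intro compact_continuous_image continuous_intros)
    have "Kn \<subseteq> \<Omega>" unfolding Kn_def K_def using inward(1) t[of n] by auto
    then have "Kn \<inter> - \<Omega> = {}" by auto
    then obtain d where d: "d > 0" "\<And>x y. x \<in> Kn \<Longrightarrow> y \<in> - \<Omega> \<Longrightarrow> d \<le> dist x y"
      using separate_compact_closed[OF Kn, of "- \<Omega>"] op closed_Compl by metis
    \<comment> \<open>The bound d/2 keeps the mollified function supported in \<Omega>; the bound
      1/(n + 1) makes the mollifier transforms converge to 1.\<close>
    define \<epsilon> where "\<epsilon> = min (d / 2) (1 / real (Suc n))"
    have \<epsilon>: "\<epsilon> > 0" "\<epsilon> < d" "\<epsilon> \<le> 1 / real (Suc n)" using d by (auto simp: \<epsilon>_def)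
    obtain \<eta> :: "'a \<Rightarrow> complex" where \<eta>: "test_fn (ball 0 \<epsilon>) \<eta>" "\<And>\<xi>. cmod (fourier \<eta> \<xi>) \<le> 1" "\<And>\<xi>. cmod (fourier \<eta> \<xi> - 1) \<le> \<epsilon> * norm \<xi>"
      using mollifier_exists[OF \<epsilon>(1)] by metis
    have fn: "integrable lborel fn"
      unfolding fn_def[abs_def] using integrable_affine[OF f, of 1 "- (t n *\<^sub>R e)"] by simp
    have 1: "test_fn \<Omega> (\<lambda>x. \<integral>y. \<eta> (x - y) * fn y \<partial>lborel)"
    proof (rule convolution_test_fn[OF \<eta>(1) fn Kn])
      show "fn x = 0" if "x \<notin> Kn" for x
      proof -
        have "x - t n *\<^sub>R e \<notin> K"
        proof
          assume "x - t n *\<^sub>R e \<in> K"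
          then have "(x - t n *\<^sub>R e) + t n *\<^sub>R e \<in> Kn" unfolding Kn_def by (rule imageI)
          then show False using that by simp
        qed
        then show ?thesis by (simp add: fn_def fK)
      qed
      show "y \<in> \<Omega>" if "x \<in> Kn" "dist x y \<le> \<epsilon>" for x y
        using d(2)[OF that(1), of y] that(2) \<epsilon>(2) by fastforce
    qed
    have 2: "fourier (\<lambda>x. \<integral>y. \<eta> (x - y) * fn y \<partial>lborel) (- \<xi>) = (fourier \<eta> (- \<xi>) * cis ((t n *\<^sub>R e) \<bullet> \<xi>)) * cnj (fourier v \<xi>)" for \<xi>
    proof -
      have "fourier fn (- \<xi>) = cis ((t n *\<^sub>R e) \<bullet> \<xi>) * fourier f (- \<xi>)"
        using fourier_translate[of f "- (t n *\<^sub>R e)" "- \<xi>"] by (simp add: fn_def[abs_def])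
      also have "fourier f (- \<xi>) = cnj (fourier v \<xi>)" unfolding f_def[abs_def] by (rule fourier_cnj)
      finally show ?thesis
        by (subst fourier_convolution[OF test_fn_integrable[OF \<eta>(1)] fn]) (simp add: mult.assoc)
    qed
    have 3: "cmod (fourier \<eta> (- \<xi>) * cis ((t n *\<^sub>R e) \<bullet> \<xi>)) \<le> 1" for \<xi>
      using \<eta>(2)[of "- \<xi>"] by (simp add: norm_mult)
    have 4: "cmod (fourier \<eta> (- \<xi>) * cis ((t n *\<^sub>R e) \<bullet> \<xi>) - cis ((t n *\<^sub>R e) \<bullet> \<xi>)) \<le> 1 / real (Suc n) * norm \<xi>" for \<xi>
    proof -
      have "cmod (fourier \<eta> (- \<xi>) * cis ((t n *\<^sub>R e) \<bullet> \<xi>) - cis ((t n *\<^sub>R e) \<bullet> \<xi>)) = cmod ((fourier \<eta> (- \<xi>) - 1) * cis ((t n *\<^sub>R e) \<bullet> \<xi>))"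
        by (simp add: algebra_simps)
      also have "\<dots> \<le> \<epsilon> * norm \<xi>" using \<eta>(3)[of "- \<xi>"] by (simp add: norm_mult)
      also have "\<dots> \<le> 1 / real (Suc n) * norm \<xi>" using \<epsilon>(3) by (intro mult_right_mono) auto
      finally show ?thesis .
    qed
    show ?thesis
      by (rule exI, rule conjI, rule 1, rule exI[of _ "\<lambda>\<xi>. fourier \<eta> (- \<xi>) * cis ((t n *\<^sub>R e) \<bullet> \<xi>)"])
         (intro conjI allI 2 3 4)
  qed
  then obtain \<phi> m where \<phi>: "\<And>n. test_fn \<Omega> (\<phi> n)" "\<And>n \<xi>. fourier (\<phi> n) (- \<xi>) = m n \<xi> * cnj (fourier v \<xi>)"
    "\<And>n \<xi>. cmod (m n \<xi>) \<le> 1" "\<And>n \<xi>. cmod (m n \<xi> - cis ((t n *\<^sub>R e) \<bullet> \<xi>)) \<le> 1 / real (Suc n) * norm \<xi>"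
    by metis
  have \<phi>m[measurable]: "\<phi> n \<in> borel_measurable borel" for n by (rule test_fn_measurable[OF \<phi>(1)])
  have mlim: "(\<lambda>n. m n \<xi>) \<longlonglongrightarrow> 1" for \<xi>
  proof -
    have "(\<lambda>n. inverse (real (Suc n)) * norm \<xi>) \<longlonglongrightarrow> 0 * norm \<xi>"
      by (intro tendsto_intros LIMSEQ_inverse_real_of_nat)
    then have "(\<lambda>n. 1 / real (Suc n) * norm \<xi>) \<longlonglongrightarrow> 0" by (simp add: inverse_eq_divide)
    then have "(\<lambda>n. m n \<xi> - cis ((t n *\<^sub>R e) \<bullet> \<xi>)) \<longlonglongrightarrow> 0"
      by (rule Lim_null_comparison[rotated]) (use \<phi>(4) in auto)
    moreover have "(\<lambda>n. cis ((t n *\<^sub>R e) \<bullet> \<xi>)) \<longlonglongrightarrow> cis ((0 *\<^sub>R e) \<bullet> \<xi>)"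
    proof -
      have "t \<longlonglongrightarrow> 0"
        unfolding t_def by (rule LIMSEQ_ignore_initial_segment[OF lim_const_over_n])
      then show ?thesis by (intro tendsto_intros)
    qed
    ultimately have "(\<lambda>n. (m n \<xi> - cis ((t n *\<^sub>R e) \<bullet> \<xi>)) + cis ((t n *\<^sub>R e) \<bullet> \<xi>)) \<longlonglongrightarrow> 0 + cis ((0 *\<^sub>R e) \<bullet> \<xi>)"
      by (rule tendsto_add)
    then show ?thesis by simp
  qed
  have "(\<lambda>n. \<integral>\<xi>. ?W \<xi> * fourier (\<phi> n) (- \<xi>) \<partial>lborel) \<longlonglongrightarrow> (LBINT \<xi>. ?W \<xi> * cnj (fourier v \<xi>))"
  proof (rule integral_dominated_convergence)
    show "integrable lborel (\<lambda>\<xi>. norm (?W \<xi> * cnj (fourier v \<xi>)))" by (rule integrable_norm[OF int])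
    show "AE \<xi> in lborel. norm (?W \<xi> * fourier (\<phi> n) (- \<xi>)) \<le> norm (?W \<xi> * cnj (fourier v \<xi>))" for n
      unfolding \<phi>(2) norm_mult using \<phi>(3)[of n]
      by (intro AE_I2 mult_left_mono) (auto intro!: mult_left_le_one_le)
    show "AE \<xi> in lborel. (\<lambda>n. ?W \<xi> * fourier (\<phi> n) (- \<xi>)) \<longlonglongrightarrow> ?W \<xi> * cnj (fourier v \<xi>)"
    proof (intro AE_I2 tendsto_mult tendsto_const)
      fix \<xi>
      have "(\<lambda>n. m n \<xi> * cnj (fourier v \<xi>)) \<longlonglongrightarrow> 1 * cnj (fourier v \<xi>)"
        by (intro tendsto_mult tendsto_const mlim)
      then show "(\<lambda>n. fourier (\<phi> n) (- \<xi>)) \<longlonglongrightarrow> cnj (fourier v \<xi>)" by (simp add: \<phi>(2))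
    qed
  qed measurable
  moreover have "(LBINT \<xi>. ?W \<xi> * fourier (\<phi> n) (- \<xi>)) = 0" for n by (rule weak[OF \<phi>(1)])
  ultimately have "(LBINT \<xi>. ?W \<xi> * cnj (fourier v \<xi>)) = 0"
    by (simp add: LIMSEQ_const_iff)
  then show "(LBINT \<xi>. ?W \<xi> * cnj (fourier (\<lambda>x. of_real (\<kappa> x) * w x) \<xi>)) = 0"
    by (simp add: v_def[abs_def])
qed

text \<open>The identity is additive in the test slot, so identities for finitely many cutoffs add
  up. The cutoffs come from a finite cover of the compact closure of \<Omega>; a product
  construction turns them into pieces that sum to 1 there.\<close>

lemma global_weak_form:
  fixes \<Omega> :: "'a::euclidean_space set" and w :: "'a \<Rightarrow> complex"
  assumes s: "s > 0" and op: "open \<Omega>" and bd: "bounded \<Omega>" and sb: "smooth_boundary \<Omega>"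
    and w: "L2fun w" "\<And>x. x \<notin> closure \<Omega> \<Longrightarrow> w x = 0"
    and fin: "sobolev_sq s (fourier w) < \<infinity>"
    and weak: "\<And>\<phi>. test_fn \<Omega> \<phi> \<Longrightarrow> (LBINT \<xi>. complex_of_real (norm \<xi> powr (2 * s)) * fourier w \<xi> * fourier \<phi> (- \<xi>)) = 0"
  shows "integrable lborel (\<lambda>\<xi>. complex_of_real (norm \<xi> powr (2 * s)) * fourier w \<xi> * cnj (fourier w \<xi>))"
    and "(LBINT \<xi>. complex_of_real (norm \<xi> powr (2 * s)) * fourier w \<xi> * cnj (fourier w \<xi>)) = 0"
proof -
  let ?W = "\<lambda>\<xi>. complex_of_real (norm \<xi> powr (2 * s)) * fourier w \<xi>"
  have [measurable]: "w \<in> borel_measurable borel" using w by (simp add: L2fun_def)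
  obtain R where R: "\<And>x. x \<in> closure \<Omega> \<Longrightarrow> norm x < R"
    using bounded_closure[OF bd] bounded_pos_less by metis
  have iw: "integrable lborel w"
    by (rule L2_bounded_support_integrable[OF w(1), of R]) (use R w(2) in force)
  have "\<exists>r>0. \<exists>t0>0. \<exists>e. \<forall>y t. y \<in> closure \<Omega> \<longrightarrow> y \<in> ball x r \<longrightarrow> 0 < t \<longrightarrow> t < t0 \<longrightarrow> y + t *\<^sub>R e \<in> \<Omega>" if "x \<in> closure \<Omega>" for x
    using smooth_boundary_inward[OF sb op that] by metis
  then obtain r t0 e where in1: "\<And>x. x \<in> closure \<Omega> \<Longrightarrow> r x > 0" "\<And>x. x \<in> closure \<Omega> \<Longrightarrow> t0 x > 0"
    "\<And>x y t. x \<in> closure \<Omega> \<Longrightarrow> y \<in> closure \<Omega> \<Longrightarrow> y \<in> ball x (r x) \<Longrightarrow> 0 < t \<Longrightarrow> t < t0 x \<Longrightarrow> y + t *\<^sub>R e x \<in> \<Omega>" by metis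
  \<comment> \<open>The cutoff is 1 on the ball of radius r/4 used for the cover, and its support
    lies in the closed ball of radius r/2, well inside the ball where the inward direction
    works.\<close>
  have "\<exists>\<kappa>::'a \<Rightarrow> real. smooth_fn (\<lambda>y. complex_of_real (\<kappa> y)) \<and> (\<forall>y\<in>ball x (r x / 4). \<kappa> y = 1) \<and> (\<forall>y. y \<notin> cball x (r x / 2) \<longrightarrow> \<kappa> y = 0)" if "x \<in> closure \<Omega>" for x
  proof -
    have "r x / 4 > 0" using in1(1)[OF that] by simp
    then obtain \<kappa> :: "'a \<Rightarrow> real" where \<kappa>: "smooth_fn (\<lambda>y. complex_of_real (\<kappa> y))" "\<And>y. y \<in> cball x (r x / 4) \<Longrightarrow> \<kappa> y = 1"
      "\<And>y. y \<notin> ball x (2 * (r x / 4)) \<Longrightarrow> \<kappa> y = 0"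
      using smooth_cutoff_exists[of "r x / 4" x] by metis
    show ?thesis by (intro exI[of _ \<kappa>] conjI ballI allI impI \<kappa>) auto
  qed
  then obtain \<kappa> :: "'a \<Rightarrow> 'a \<Rightarrow> real" where \<kappa>: "\<And>x. x \<in> closure \<Omega> \<Longrightarrow> smooth_fn (\<lambda>y. complex_of_real (\<kappa> x y))"
    "\<And>x y. x \<in> closure \<Omega> \<Longrightarrow> y \<in> ball x (r x / 4) \<Longrightarrow> \<kappa> x y = 1" "\<And>x y. x \<in> closure \<Omega> \<Longrightarrow> y \<notin> cball x (r x / 2) \<Longrightarrow> \<kappa> x y = 0"
    by metis
  have "compact (closure \<Omega>)" using bd by simp
  then obtain F where F: "F \<subseteq> closure \<Omega>" "finite F" "closure \<Omega> \<subseteq> (\<Union>x\<in>F. ball x (r x / 4))"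
    by (rule compactE_image[of _ "closure \<Omega>" "\<lambda>x. ball x (r x / 4)"]) (use in1(1) in force)+
  \<comment> \<open>\<open>1 - P F\<close> equals 1 on the closure of \<open>\<Omega>\<close>, and adding a point \<open>x\<close> to \<open>F\<close> changes it by
    \<open>\<kappa> x * P F\<close>, which has small support.\<close>
  define P where "P F y = (\<Prod>x\<in>F. 1 - \<kappa> x y)" for F y
  have Ps: "smooth_closure (\<lambda>y. complex_of_real (P G y))" if "finite G" "G \<subseteq> closure \<Omega>" for G
    unfolding P_def of_real_prod of_real_diff of_real_1 using that \<kappa>(1)
    by (intro smooth_closure_prod smooth_closure_diff smooth_closure.const smooth_closure.base) auto
  \<comment> \<open>Integrability of the localised function itself is carried in the invariant
    because additivity of \<open>fourier\<close> requires it.\<close>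
  have "integrable lborel (\<lambda>\<xi>. ?W \<xi> * cnj (fourier (\<lambda>y. of_real (1 - P G y) * w y) \<xi>)) \<and>
      (LBINT \<xi>. ?W \<xi> * cnj (fourier (\<lambda>y. of_real (1 - P G y) * w y) \<xi>)) = 0 \<and> integrable lborel (\<lambda>y. of_real (1 - P G y) * w y)"
    if "finite G" "G \<subseteq> closure \<Omega>" for G
    using that
  proof (induction G rule: finite_induct)
    case empty
    show ?case by (simp add: P_def fourier_def)
  next
    case (insert x G)
    then have x: "x \<in> closure \<Omega>" and G: "G \<subseteq> closure \<Omega>" by auto
    define k where "k y = \<kappa> x y * P G y" for y
    have ks: "smooth_fn (\<lambda>y. complex_of_real (k y))"
      unfolding k_def of_real_mult
      by (rule smooth_closure_imp_smooth_fn[OF smooth_closure.mult[OF smooth_closure.base[OF \<kappa>(1)[OF x]] Ps[OF insert.hyps(1) G]]])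
    have k0: "k y = 0" if "y \<notin> cball x (r x / 2)" for y using \<kappa>(3)[OF x that] by (simp add: k_def)
    have inw: "y + t *\<^sub>R e x \<in> \<Omega>" if "y \<in> closure \<Omega>" "y \<in> cball x (r x / 2)" "0 < t" "t < t0 x" for y t
      using that in1(1)[OF x] by (intro in1(3)[OF x]) auto
    have L: "integrable lborel (\<lambda>\<xi>. ?W \<xi> * cnj (fourier (\<lambda>y. of_real (k y) * w y) \<xi>))"
      "(LBINT \<xi>. ?W \<xi> * cnj (fourier (\<lambda>y. of_real (k y) * w y) \<xi>)) = 0"
      by (rule local_weak_form[where \<Omega> = \<Omega> and a = x and r = "r x / 2" and e = "e x"];
          fact s op bd w fin weak ks k0 inw in1(2)[OF x])+
    have tk: "test_fn UNIV (\<lambda>y. complex_of_real (k y))"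
      using k0 by (intro test_fnI[OF ks compact_cball[of x "r x / 2"]]) auto
    obtain C where C: "\<And>y. cmod (complex_of_real (k y)) \<le> C" using test_fn_bounded[OF tk] by metis
    have ik: "integrable lborel (\<lambda>y. of_real (k y) * w y)"
      using C test_fn_measurable[OF tk] by (intro integrable_bounded_mult iw) auto
    have IH: "integrable lborel (\<lambda>\<xi>. ?W \<xi> * cnj (fourier (\<lambda>y. of_real (1 - P G y) * w y) \<xi>))"
      "(LBINT \<xi>. ?W \<xi> * cnj (fourier (\<lambda>y. of_real (1 - P G y) * w y) \<xi>)) = 0" "integrable lborel (\<lambda>y. of_real (1 - P G y) * w y)"
      using insert.IH[OF G] by auto
    have split: "(\<lambda>y. of_real (1 - P (insert x G) y) * w y) = (\<lambda>y. of_real (1 - P G y) * w y + of_real (k y) * w y)"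
      using insert.hyps by (simp add: P_def k_def fun_eq_iff algebra_simps)
    have F: "?W \<xi> * cnj (fourier (\<lambda>y. of_real (1 - P (insert x G) y) * w y) \<xi>) =
       ?W \<xi> * cnj (fourier (\<lambda>y. of_real (1 - P G y) * w y) \<xi>) + ?W \<xi> * cnj (fourier (\<lambda>y. of_real (k y) * w y) \<xi>)" for \<xi>
      unfolding split fourier_add[OF IH(3) ik] by (simp only: complex_cnj_add distrib_left)
    show ?case
    proof (intro conjI)
      show "integrable lborel (\<lambda>\<xi>. ?W \<xi> * cnj (fourier (\<lambda>y. of_real (1 - P (insert x G) y) * w y) \<xi>))"
        unfolding F by (rule Bochner_Integration.integrable_add[OF IH(1) L(1)])
      show "(LBINT \<xi>. ?W \<xi> * cnj (fourier (\<lambda>y. of_real (1 - P (insert x G) y) * w y) \<xi>)) = 0"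
        unfolding F Bochner_Integration.integral_add[OF IH(1) L(1)] IH(2) L(2) by simp
      show "integrable lborel (\<lambda>y. of_real (1 - P (insert x G) y) * w y)"
        unfolding split by (rule Bochner_Integration.integrable_add[OF IH(3) ik])
    qed
  qed
  note main = this[OF F(2,1)]
  have "of_real (1 - P F y) * w y = w y" for y
  proof (cases "y \<in> closure \<Omega>")
    case True
    then obtain x where x: "x \<in> F" "y \<in> ball x (r x / 4)" using F(3) by auto
    then have "\<kappa> x y = 1" using \<kappa>(2) F(1) by blast
    then have "P F y = 0" unfolding P_def using F(2) x(1) by (intro prod_zero) auto
    then show ?thesis by simp
  qed (simp add: w(2))
  then have eq: "(\<lambda>y. of_real (1 - P F y) * w y) = w" by (simp add: fun_eq_iff)
  show "integrable lborel (\<lambda>\<xi>. ?W \<xi> * cnj (fourier w \<xi>))" "(LBINT \<xi>. ?W \<xi> * cnj (fourier w \<xi>)) = 0"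
    using main unfolding eq by auto
qed

text \<open>Vanishing energy means that |\<xi>|^{2s} times the squared modulus of the transform of w
  is zero almost everywhere. The weight vanishes only at the origin, a null set, so the transform
  vanishes, and with it all integrals of w against test functions.\<close>

theorem fraclap_unique_continuation:
  fixes \<Omega> :: "'a::euclidean_space set" and w :: "'a \<Rightarrow> complex"
  assumes s: "s > 0" and op: "open \<Omega>" and bd: "bounded \<Omega>" and sb: "smooth_boundary \<Omega>"
    and w: "Hs s w" "AE x in lborel. x \<in> ext \<Omega> \<longrightarrow> w x = 0"
    and weak: "\<And>\<phi>. test_fn \<Omega> \<phi> \<Longrightarrow> pair (fraclap s w) \<phi> = 0"
  shows "AE x in lborel. w x = 0"
proof -
  \<comment> \<open>A representative that vanishes everywhere, not just almost everywhere, outside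
    the closure of \<Omega>, as the weak-form lemmas demand.\<close>
  define w1 where "w1 x = indicator (closure \<Omega>) x * w x" for x
  have L2: "L2fun w" "L2fun (FT w)" and F: "fourier_L2 w (FT w)" using Hs_FT[OF w(1)] by auto
  have [measurable]: "w \<in> borel_measurable borel" "FT w \<in> borel_measurable borel" using L2 by (auto simp: L2fun_def)
  have L1: "L2fun w1" unfolding w1_def[abs_def] by (intro L2fun_indicator L2) simp
  then have [measurable]: "w1 \<in> borel_measurable borel" by (simp add: L2fun_def)
  have ww1: "AE x in lborel. w x = w1 x"
    using w(2) by eventually_elim (auto simp: w1_def ext_def indicator_def)
  obtain R where R: "\<And>x. x \<in> closure \<Omega> \<Longrightarrow> norm x < R"
    using bounded_closure[OF bd] bounded_pos_less by metis
  have "fourier_L2 w (fourier w)"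
    by (rule fourier_L2_bounded_support[OF L2(1), of R])
       (use w(2) R in \<open>auto simp: ext_def elim!: eventually_mono\<close>)
  moreover have fw: "fourier w = fourier w1"
    by (intro ext fourier_cong_AE ww1) auto
  ultimately have FT: "AE \<xi> in lborel. FT w \<xi> = fourier w1 \<xi>"
    using fourier_L2_FT(2) by metis
  have fin: "sobolev_sq s (fourier w1) < \<infinity>"
  proof -
    have "sobolev_sq s (fourier w1) = sobolev_sq s (FT w)"
      using FT by (intro nn_integral_cong_AE) (auto elim!: eventually_mono)
    then show ?thesis using Hs_FT(2)[OF w(1)] by simp
  qed
  have weak1: "(LBINT \<xi>. complex_of_real (norm \<xi> powr (2 * s)) * fourier w1 \<xi> * fourier \<phi> (- \<xi>)) = 0" if \<phi>: "test_fn \<Omega> \<phi>" for \<phi>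
  proof -
    have [measurable]: "\<phi> \<in> borel_measurable borel" by (rule test_fn_measurable[OF \<phi>])
    have "(LBINT \<xi>. complex_of_real (norm \<xi> powr (2 * s)) * fourier w1 \<xi> * fourier \<phi> (- \<xi>)) =
       (LBINT \<xi>. fraclap s w \<xi> * fourier \<phi> (- \<xi>))"
      unfolding fraclap_def by (intro integral_cong_AE) (use FT in \<open>auto elim!: eventually_mono\<close>)
    also have "\<dots> = 0" using weak[OF \<phi>] by (simp add: pair_def)
    finally show ?thesis .
  qed
  have w1_out: "w1 x = 0" if "x \<notin> closure \<Omega>" for x using that by (simp add: w1_def)
  have G: "integrable lborel (\<lambda>\<xi>. complex_of_real (norm \<xi> powr (2 * s)) * fourier w1 \<xi> * cnj (fourier w1 \<xi>))"
    "(LBINT \<xi>. complex_of_real (norm \<xi> powr (2 * s)) * fourier w1 \<xi> * cnj (fourier w1 \<xi>)) = 0"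
    by (rule global_weak_form[where \<Omega> = \<Omega>]; fact s op bd sb L1 w1_out fin weak1)+
  let ?h = "\<lambda>\<xi>. norm \<xi> powr (2 * s) * (cmod (fourier w1 \<xi>))\<^sup>2"
  have h: "complex_of_real (norm \<xi> powr (2 * s)) * fourier w1 \<xi> * cnj (fourier w1 \<xi>) = of_real (?h \<xi>)" for \<xi>
    unfolding of_real_mult complex_norm_square by (simp only: mult.assoc)
  have ih: "integrable lborel ?h" using integrable_Re[OF G(1)] unfolding h by simp
  have "(LBINT \<xi>. ?h \<xi>) = 0" using G(2) unfolding h by (simp only: integral_complex_of_real of_real_eq_0_iff)
  then have "AE \<xi> in lborel. ?h \<xi> = 0"
    by (subst (asm) integral_nonneg_eq_0_iff_AE[OF ih]) auto
  moreover have "AE \<xi> in lborel. \<xi> \<noteq> (0::'a)" by (rule AE_lborel_singleton)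
  ultimately have F0: "AE \<xi> in lborel. FT w \<xi> = 0" using FT
    by eventually_elim auto
  have "(LBINT x. w x * \<phi> x) = 0" if \<phi>: "test_fn UNIV \<phi>" for \<phi>
  proof -
    have "(LBINT x. w x * \<phi> x) = pair (FT w) \<phi>" by (rule pair_FT[OF F \<phi>, symmetric])
    also have "\<dots> = pair (\<lambda>_. 0) \<phi>" by (rule pair_cong_AE[OF F0 _ _ \<phi>]) auto
    finally show ?thesis by (simp add: pair_def)
  qed
  then show ?thesis using L2fun_zero_on_open[OF L2(1) open_UNIV] by simp
qed

section \<open>High-frequency perturbations\<close>

text \<open>An explicit inverse transform: the Bessel inequality applied to \<open>G\<close>
  controls its L2 norm, and the pairing identifies it with the distribution represented by
  \<open>G\<close>.\<close>

lemma inverse_fourier: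
  fixes G :: "'a::euclidean_space \<Rightarrow> complex"
  assumes G: "integrable lborel G" "L2fun G"
  defines "g \<equiv> \<lambda>x. complex_of_real ((2 * pi) powr (- real DIM('a))) * fourier G (- x)"
  shows "L2fun g"
    and "l2_sq g \<le> ennreal ((2 * pi) powr (- real DIM('a))) * (l2_sq G)"
    and "test_fn U \<phi> \<Longrightarrow> pair G \<phi> = (LBINT x. g x * \<phi> x)"
proof -
  let ?c = "(2 * pi) powr (- real DIM('a))"
  have [measurable]: "G \<in> borel_measurable borel" using G by (simp add: L2fun_def)
  have c1: "?c * (2 * pi) ^ DIM('a) = 1"
    by (subst powr_minus, subst powr_realpow, simp) (rule left_inverse, simp)
  have "l2_sq g = ennreal (?c\<^sup>2) * (l2_sq (\<lambda>x. fourier G (- x)))"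
    unfolding g_def by (subst nn_integral_cmult[symmetric]) (auto simp: norm_mult power_mult_distrib ennreal_mult)
  also have "l2_sq (\<lambda>x. fourier G (- x)) = l2_sq (fourier G)"
    by (rule nn_integral_uminus) measurable
  also have "ennreal (?c\<^sup>2) * \<dots> \<le> ennreal (?c\<^sup>2) * (ennreal ((2 * pi) ^ DIM('a)) * (l2_sq G))"
    by (intro mult_left_mono bessel_inequality G) simp
  also have "\<dots> = ennreal (?c\<^sup>2 * (2 * pi) ^ DIM('a)) * (l2_sq G)"
    by (subst ennreal_mult) (auto simp: mult.assoc)
  also have "?c\<^sup>2 * (2 * pi) ^ DIM('a) = ?c"
    unfolding power2_eq_square mult.assoc c1 by simp
  finally show le: "l2_sq g \<le> ennreal ?c * (l2_sq G)" .
  have "ennreal ?c * (l2_sq G) < \<infinity>"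
    using G(2) by (auto simp: L2fun_def ennreal_mult_less_top)
  from le_less_trans[OF le this] show "L2fun g" unfolding L2fun_def g_def by auto
  assume \<phi>: "test_fn U \<phi>"
  have [measurable]: "\<phi> \<in> borel_measurable borel" by (rule test_fn_measurable[OF \<phi>])
  have i: "integrable lborel (\<lambda>x. \<phi> (- x))"
    using integrable_affine[OF test_fn_integrable[OF \<phi>], of "-1" 0] by simp
  have F: "fourier (\<lambda>x. \<phi> (- x)) \<xi> = fourier \<phi> (- \<xi>)" for \<xi>
    using integral_uminus[of "\<lambda>x. cis (- (x \<bullet> - \<xi>)) * \<phi> x"] by (simp add: fourier_def)
  have "(LBINT \<xi>. G \<xi> * fourier \<phi> (- \<xi>)) = (LBINT x. fourier G x * \<phi> (- x))"
    using fourier_multiplication_formula[OF G(1) i] by (simp add: F)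
  also have "\<dots> = (LBINT x. fourier G (- x) * \<phi> x)"
    using integral_uminus[of "\<lambda>x. fourier G (- x) * \<phi> x"] by simp
  finally show "pair G \<phi> = (LBINT x. g x * \<phi> x)"
    by (simp add: pair_def g_def mult.assoc)
qed

text \<open>A bound independent of l, to dominate the error multiplier as the frequency grows. It
  uses |\<xi> + l b| / l \<le> |\<xi>| + 1, from l \<ge> 1, and 2s \<le> 2.\<close>

lemma norm_powr_shift_bound:
  fixes \<xi> b :: "'a::euclidean_space"
  assumes s: "0 < s" "s < 1" and l: "l \<ge> 1" and b: "norm b = 1"
  shows "\<bar>(norm (\<xi> + l *\<^sub>R b) / l) powr (2 * s) - 1\<bar> \<le> 2 * (1 + (norm \<xi>)\<^sup>2)"
proof -
  have "norm (\<xi> + l *\<^sub>R b) \<le> norm \<xi> + l"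
    using norm_triangle_ineq[of \<xi> "l *\<^sub>R b"] l b by simp
  also have "\<dots> \<le> l * (norm \<xi> + 1)"
    using l mult_right_mono[of 1 l "norm \<xi>"] by (simp add: algebra_simps)
  finally have "norm (\<xi> + l *\<^sub>R b) / l \<le> norm \<xi> + 1"
    using l by (simp add: pos_divide_le_eq mult.commute)
  then have "(norm (\<xi> + l *\<^sub>R b) / l) powr (2 * s) \<le> (norm \<xi> + 1) powr (2 * s)"
    using s l by (intro powr_mono2) auto
  also have "\<dots> \<le> (norm \<xi> + 1) powr 2" using s by (intro powr_mono) auto
  also have "\<dots> = (norm \<xi> + 1)\<^sup>2" using norm_ge_zero[of \<xi>] by (intro powr_numeral) linarith
  also have "\<dots> \<le> 2 * (1 + (norm \<xi>)\<^sup>2)"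
    using sum_squares_bound[of "norm \<xi>" 1] by (simp add: power2_sum)
  finally have "(norm (\<xi> + l *\<^sub>R b) / l) powr (2 * s) \<le> 2 * (1 + (norm \<xi>)\<^sup>2)" .
  moreover have "0 \<le> (norm (\<xi> + l *\<^sub>R b) / l) powr (2 * s)" by simp
  moreover have "1 \<le> 2 * (1 + (norm \<xi>)\<^sup>2)" by simp
  ultimately show ?thesis by linarith
qed

lemma L2fun_test_fn_integrable:
  fixes f \<phi> :: "'a::euclidean_space \<Rightarrow> complex"
  assumes f: "L2fun f" and \<phi>: "test_fn V \<phi>"
  shows "integrable lborel (\<lambda>x. f x * \<phi> x)"
proof -
  have [measurable]: "f \<in> borel_measurable borel" "\<phi> \<in> borel_measurable borel"
    using f test_fn_measurable[OF \<phi>] by (auto simp: L2fun_def)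
  have "(\<integral>\<^sup>+ x. ennreal (cmod (f x * \<phi> x)) \<partial>lborel)\<^sup>2 \<le>
    (sobolev_sq (- 0) f) * (sobolev_sq 0 \<phi>)"
    by (rule bracket_Cauchy_Schwarz) auto
  also have "\<dots> < \<infinity>"
    using f test_fn_L2fun[OF \<phi>] by (auto simp: L2fun_def ennreal_mult_less_top add_nonneg_eq_0_iff)
  finally have "(\<integral>\<^sup>+ x. ennreal (cmod (f x * \<phi> x)) \<partial>lborel) < \<infinity>"
    by (cases "\<integral>\<^sup>+ x. ennreal (cmod (f x * \<phi> x)) \<partial>lborel") (auto simp: power2_eq_square)
  then show ?thesis by (intro integrableI_bounded) auto
qed

text \<open>Modulation shifts frequencies by \<lambda> b, so after undoing the shift the error
  (-\<Delta>)^s \<theta> - e has the transform of \<psi> multiplied by |\<xi>/\<lambda> + b|^{2s} -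
  1. This factor tends to 0 pointwise and is dominated by a polynomial, so the error tends to 0 in
  L2. It is recorded twice: as a function \<open>g\<close>, to be measured on \<Omega>, and by its
  transform \<open>G\<close>, which is all that remains where \<psi> vanishes.\<close>

lemma high_frequency_data:
  fixes \<psi> :: "'a::euclidean_space \<Rightarrow> complex"
  assumes \<psi>: "test_fn U \<psi>" and s: "0 < s" "s < 1"
  obtains \<theta> e g G :: "nat \<Rightarrow> 'a \<Rightarrow> complex" where
    "\<And>n. Hs s (\<theta> n)" "\<And>n x. \<psi> x = 0 \<Longrightarrow> \<theta> n x = 0"
    "\<And>n. L2fun (e n)" "\<And>n x. cmod (e n x) = cmod (\<psi> x)" "\<And>n. L2fun (g n)" "\<And>n. Hneg s (G n)"
    "\<And>n V \<phi>. test_fn V \<phi> \<Longrightarrow> pair (fraclap s (\<theta> n)) \<phi> = (LBINT x. (e n x + g n x) * \<phi> x)"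
    "\<And>n V \<phi>. test_fn V \<phi> \<Longrightarrow> (\<And>x. \<psi> x * \<phi> x = 0) \<Longrightarrow> pair (fraclap s (\<theta> n)) \<phi> = pair (G n) \<phi>"
    "(\<lambda>n. hneg_norm s (G n)) \<longlonglongrightarrow> 0"
    "(\<lambda>n. enn2real (l2_sq (g n))) \<longlonglongrightarrow> 0"
    "(\<lambda>n. \<integral>x. (e n x + g n x) * \<psi> x \<partial>lborel) \<longlonglongrightarrow> 0"
proof -
  obtain b :: 'a where b: "b \<in> Basis" using nonempty_Basis by blast
  have nb: "norm b = 1" using b by simp
  have [measurable]: "\<psi> \<in> borel_measurable borel" by (rule test_fn_measurable[OF \<psi>])
  \<comment> \<open>The frequency \<lambda>; it starts at 1 because
    \<open>norm_powr_shift_bound\<close> asks for l \<ge> 1.\<close>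
  define l where "l n = real (Suc n)" for n
  have l: "l n \<ge> 1" "l n > 0" for n by (simp_all add: l_def)
  define e where "e n x = cis (x \<bullet> (l n *\<^sub>R b)) * \<psi> x" for n x
  have em[measurable]: "e n \<in> borel_measurable borel" for n unfolding e_def[abs_def] by measurable
  have ne: "cmod (e n x) = cmod (\<psi> x)" for n x by (simp add: e_def norm_mult)
  have eL2: "L2fun (e n)" for n using test_fn_L2fun[OF \<psi>] by (simp add: L2fun_def ne)
  have ei: "integrable lborel (e n)" for n
    unfolding e_def[abs_def] by (rule integrable_cis_mult[OF test_fn_integrable[OF \<psi>]]) simp
  have Fe: "fourier (e n) \<xi> = fourier \<psi> (\<xi> - l n *\<^sub>R b)" for n \<xi>
    unfolding fourier_def e_def by (simp add: mult.assoc[symmetric] cis_mult inner_diff_right)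
  define a where "a n = l n powr (- (2 * s))" for n
  define \<theta> where "\<theta> n x = complex_of_real (a n) * e n x" for n x
  have \<theta>m[measurable]: "\<theta> n \<in> borel_measurable borel" for n unfolding \<theta>_def[abs_def] by measurable
  have F\<theta>: "fourier (\<theta> n) \<xi> = of_real (a n) * fourier (e n) \<xi>" for n \<xi>
    unfolding \<theta>_def[abs_def] by (rule fourier_cmult)
  have "bounded (csupp \<psi>)" using \<psi> by (simp add: test_fn_def compact_imp_bounded)
  then obtain R where R: "\<And>x. x \<in> csupp \<psi> \<Longrightarrow> norm x < R" using bounded_pos_less by metis
  have \<theta>0: "\<theta> n x = 0" if "\<psi> x = 0" for n x using that by (simp add: \<theta>_def e_def)
  have L2zero: "L2fun (\<lambda>_::'a. 0::complex)" by (simp add: L2fun_def)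
  have \<theta>L2: "L2fun (\<theta> n)" for n
    using L2fun_lincomb[OF L2zero eL2[of n], of "of_real (a n)"] by (simp add: \<theta>_def[abs_def])
  have \<theta>F: "fourier_L2 (\<theta> n) (fourier (\<theta> n))" for n
    by (rule fourier_L2_bounded_support[OF \<theta>L2, where R = R]) (use R not_in_csupp[of _ \<psi>] \<theta>0 in \<open>auto intro!: AE_I2\<close>)
  define k where "k n \<xi> = (norm (\<xi> + l n *\<^sub>R b) / l n) powr (2 * s) - 1" for n and \<xi> :: 'a
  have km[measurable]: "k n \<in> borel_measurable borel" for n unfolding k_def[abs_def] by measurable
  have kb: "\<bar>k n \<xi>\<bar> \<le> 2 * (1 + (norm \<xi>)\<^sup>2)" for n \<xi>
    unfolding k_def by (rule norm_powr_shift_bound[OF s l(1) nb])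
  have klim: "(\<lambda>n. k n \<xi>) \<longlonglongrightarrow> 0" for \<xi>
  proof -
    have "(\<lambda>n. norm (inverse (real (Suc n)) *\<^sub>R \<xi> + b)) \<longlonglongrightarrow> norm (0 *\<^sub>R \<xi> + b)"
      by (intro tendsto_intros LIMSEQ_inverse_real_of_nat)
    moreover have "norm (inverse (real (Suc n)) *\<^sub>R \<xi> + b) = norm (\<xi> + l n *\<^sub>R b) / l n" for n
    proof -
      have "inverse (real (Suc n)) *\<^sub>R \<xi> + b = inverse (l n) *\<^sub>R (\<xi> + l n *\<^sub>R b)"
        using l(2)[of n] by (simp add: l_def scaleR_add_right del: of_nat_Suc)
      then show ?thesis using l(2)[of n] by (simp add: divide_inverse mult.commute)
    qed
    ultimately have "(\<lambda>n. norm (\<xi> + l n *\<^sub>R b) / l n) \<longlonglongrightarrow> 1" using nb by simp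
    then have "(\<lambda>n. (norm (\<xi> + l n *\<^sub>R b) / l n) powr (2 * s) - 1) \<longlonglongrightarrow> 1 powr (2 * s) - 1"
      by (intro tendsto_intros) auto
    then show ?thesis by (simp add: k_def)
  qed
  define G where "G n \<xi> = complex_of_real (norm \<xi> powr (2 * s)) * fourier (\<theta> n) \<xi> - fourier (e n) \<xi>" for n \<xi>
  have Gm[measurable]: "G n \<in> borel_measurable borel" for n unfolding G_def[abs_def] by measurable
  have Gk: "G n (\<xi> + l n *\<^sub>R b) = of_real (k n \<xi>) * fourier \<psi> \<xi>" for n \<xi>
  proof -
    have "norm (\<xi> + l n *\<^sub>R b) powr (2 * s) * a n = (norm (\<xi> + l n *\<^sub>R b) / l n) powr (2 * s)"
      unfolding a_def powr_minus by (simp only: powr_divide divide_inverse[of "_ powr _"])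
    then have "complex_of_real (norm (\<xi> + l n *\<^sub>R b) powr (2 * s)) * of_real (a n) = of_real (k n \<xi>) + 1"
      unfolding k_def by (simp flip: of_real_mult)
    then show ?thesis by (simp add: G_def F\<theta> Fe mult.assoc[symmetric] algebra_simps)
  qed
  \<comment> \<open>Translation invariance of Lebesgue measure removes the frequency shift.\<close>
  have G2: "l2_sq (G n) = (\<integral>\<^sup>+ \<xi>. ennreal ((k n \<xi>)\<^sup>2 * (cmod (fourier \<psi> \<xi>))\<^sup>2) \<partial>lborel)" for n
    by (subst nn_integral_affine[of _ 1 "l n *\<^sub>R b"]) (auto simp: add.commute[of "l n *\<^sub>R b"] Gk norm_mult power_mult_distrib)
  let ?dom = "\<lambda>\<xi>. 4 * ((1 + (norm \<xi>)\<^sup>2) ^ 2 * (cmod (fourier \<psi> \<xi>))\<^sup>2)"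
  have domi: "integrable lborel ?dom" by (intro integrable_mult_right integrable_fourier_test_fn(2)[OF \<psi>])
  have domfin: "(\<integral>\<^sup>+ \<xi>. ennreal (?dom \<xi>) \<partial>lborel) < \<infinity>"
  proof -
    have nd: "norm (?dom \<xi>) = ?dom \<xi>" for \<xi> :: 'a by simp
    show ?thesis using conjunct2[OF domi[unfolded integrable_iff_bounded]] unfolding nd .
  qed
  have ptdom: "(k n \<xi>)\<^sup>2 * (cmod (fourier \<psi> \<xi>))\<^sup>2 \<le> ?dom \<xi>" for n \<xi>
  proof -
    have "(k n \<xi>)\<^sup>2 \<le> (2 * (1 + (norm \<xi>)\<^sup>2))\<^sup>2" using kb[of n \<xi>] by (metis abs_ge_zero power2_abs power_mono)
    from mult_right_mono[OF this, of "(cmod (fourier \<psi> \<xi>))\<^sup>2"] show ?thesis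
      by (simp only: power_mult_distrib) simp
  qed
  have Elim: "(\<lambda>n. l2_sq (G n)) \<longlonglongrightarrow> 0"
  proof -
    have "(\<lambda>n. \<integral>\<^sup>+ \<xi>. ennreal ((k n \<xi>)\<^sup>2 * (cmod (fourier \<psi> \<xi>))\<^sup>2) \<partial>lborel) \<longlonglongrightarrow> (\<integral>\<^sup>+ \<xi>. (0 :: ennreal) \<partial>(lborel :: 'a measure))"
    proof (rule nn_integral_dominated_convergence[where w = "\<lambda>\<xi>. ennreal (?dom \<xi>)"])
      show "AE \<xi> in lborel. ennreal ((k n \<xi>)\<^sup>2 * (cmod (fourier \<psi> \<xi>))\<^sup>2) \<le> ennreal (?dom \<xi>)" for n
        by (intro AE_I2 ennreal_leI ptdom)
      show "AE \<xi> in lborel. (\<lambda>n. ennreal ((k n \<xi>)\<^sup>2 * (cmod (fourier \<psi> \<xi>))\<^sup>2)) \<longlonglongrightarrow> 0"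
      proof (intro AE_I2)
        fix \<xi> :: 'a
        have "(\<lambda>n. (k n \<xi>)\<^sup>2 * (cmod (fourier \<psi> \<xi>))\<^sup>2) \<longlonglongrightarrow> 0\<^sup>2 * (cmod (fourier \<psi> \<xi>))\<^sup>2"
          by (intro tendsto_intros klim)
        then have "(\<lambda>n. ennreal ((k n \<xi>)\<^sup>2 * (cmod (fourier \<psi> \<xi>))\<^sup>2)) \<longlonglongrightarrow> ennreal (0\<^sup>2 * (cmod (fourier \<psi> \<xi>))\<^sup>2)"
          by (rule tendsto_ennrealI)
        then show "(\<lambda>n. ennreal ((k n \<xi>)\<^sup>2 * (cmod (fourier \<psi> \<xi>))\<^sup>2)) \<longlonglongrightarrow> 0" by simp
      qed
    qed (use domfin in auto)
    then show ?thesis by (simp add: G2)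
  qed
  have GL2: "L2fun (G n)" for n
  proof -
    have "l2_sq (G n) \<le> (\<integral>\<^sup>+ \<xi>. ennreal (?dom \<xi>) \<partial>lborel)"
      unfolding G2 by (intro nn_integral_mono ennreal_leI ptdom)
    from le_less_trans[OF this domfin] show ?thesis by (simp add: L2fun_def)
  qed
  have Gi: "integrable lborel (G n)" for n
  proof -
    have "integrable lborel (\<lambda>\<xi>. of_real (k n \<xi>) * fourier \<psi> \<xi>)"
    proof (rule Bochner_Integration.integrable_bound)
      show "integrable lborel (\<lambda>\<xi>. 2 * ((1 + (norm \<xi>)\<^sup>2) ^ 1 * cmod (fourier \<psi> \<xi>)))"
        by (intro integrable_mult_right integrable_fourier_test_fn(1)[OF \<psi>])
      show "AE \<xi> in lborel. norm (of_real (k n \<xi>) * fourier \<psi> \<xi>) \<le> norm (2 * ((1 + (norm \<xi>)\<^sup>2) ^ 1 * cmod (fourier \<psi> \<xi>)))"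
      proof (intro AE_I2)
        fix \<xi> :: 'a
        have "\<bar>k n \<xi>\<bar> * cmod (fourier \<psi> \<xi>) \<le> 2 * (1 + (norm \<xi>)\<^sup>2) * cmod (fourier \<psi> \<xi>)"
          by (intro mult_right_mono kb) simp
        then show "norm (of_real (k n \<xi>) * fourier \<psi> \<xi>) \<le> norm (2 * ((1 + (norm \<xi>)\<^sup>2) ^ 1 * cmod (fourier \<psi> \<xi>)))"
          by (simp add: norm_mult distrib_right distrib_left)
      qed
    qed measurable
    then have "integrable lborel (\<lambda>\<xi>. G n (\<xi> + l n *\<^sub>R b))" by (simp add: Gk)
    from integrable_affine[OF this, of 1 "- (l n *\<^sub>R b)"] show ?thesis by simp
  qed
  define g where "g n x = complex_of_real ((2 * pi) powr (- real DIM('a))) * fourier (G n) (- x)" for n x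
  note inv = inverse_fourier[OF Gi GL2, folded g_def[abs_def]]
  have gL2: "L2fun (g n)" for n using inv(1)[of n] by (simp add: g_def[abs_def])
  have g2: "l2_sq (g n) \<le> ennreal ((2 * pi) powr (- real DIM('a))) * (l2_sq (G n))" for n
    using inv(2)[of n] by (simp add: g_def[abs_def])
  have gpair: "pair (G n) \<phi> = (LBINT x. g n x * \<phi> x)" if "test_fn V \<phi>" for n V \<phi>
    using inv(3)[OF that, of n] by (simp add: g_def[abs_def])
  have GH: "Hneg s (G n)" for n using s by (intro L2fun_Hneg GL2) simp
  have eH: "Hneg s (fourier (e n))" for n using s by (intro L2fun_Hneg L2fun_fourier ei eL2) simp
  have Hs\<theta>: "Hs s (\<theta> n)" for n
    unfolding Hs_def
  proof (intro exI conjI, rule \<theta>F)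
    let ?d = "\<lambda>\<xi>. (a n)\<^sup>2 * 2 powr s * (1 + (l n)\<^sup>2) powr s"
    have "sobolev_sq s (fourier (\<theta> n)) =
       (\<integral>\<^sup>+ \<xi>. ennreal (bracket s (\<xi> + l n *\<^sub>R b) * ((a n)\<^sup>2 * (cmod (fourier \<psi> \<xi>))\<^sup>2)) \<partial>lborel)"
      by (subst nn_integral_affine[of _ 1 "l n *\<^sub>R b"]) (auto simp: add.commute[of "l n *\<^sub>R b"] F\<theta> Fe norm_mult power_mult_distrib)
    also have "\<dots> \<le> (\<integral>\<^sup>+ \<xi>. ennreal ((a n)\<^sup>2 * (2 powr s * (1 + (l n)\<^sup>2) powr s)) * ennreal (bracket s \<xi> * (cmod (fourier \<psi> \<xi>))\<^sup>2) \<partial>lborel)"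
    proof (intro nn_integral_mono)
      fix \<xi> :: 'a
      have "1 + (norm (\<xi> + l n *\<^sub>R b))\<^sup>2 \<le> 2 * ((1 + (norm \<xi>)\<^sup>2) * (1 + (l n)\<^sup>2))"
        using peetre_inequality[of "\<xi> + l n *\<^sub>R b" "- (l n *\<^sub>R b)"] l(2)[of n] nb by simp
      then have "bracket s (\<xi> + l n *\<^sub>R b) \<le> (2 * ((1 + (norm \<xi>)\<^sup>2) * (1 + (l n)\<^sup>2))) powr s"
        using s by (intro powr_mono2) auto
      also have "\<dots> = 2 powr s * (bracket s \<xi> * (1 + (l n)\<^sup>2) powr s)" by (simp add: powr_mult)
      finally have "bracket s (\<xi> + l n *\<^sub>R b) * ((a n)\<^sup>2 * (cmod (fourier \<psi> \<xi>))\<^sup>2) \<le>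
         2 powr s * (bracket s \<xi> * (1 + (l n)\<^sup>2) powr s) * ((a n)\<^sup>2 * (cmod (fourier \<psi> \<xi>))\<^sup>2)"
        by (rule mult_right_mono) simp
      also have "\<dots> = ((a n)\<^sup>2 * (2 powr s * (1 + (l n)\<^sup>2) powr s)) * (bracket s \<xi> * (cmod (fourier \<psi> \<xi>))\<^sup>2)"
        by (simp only: mult_ac)
      finally show "ennreal (bracket s (\<xi> + l n *\<^sub>R b) * ((a n)\<^sup>2 * (cmod (fourier \<psi> \<xi>))\<^sup>2)) \<le>
          ennreal ((a n)\<^sup>2 * (2 powr s * (1 + (l n)\<^sup>2) powr s)) * ennreal (bracket s \<xi> * (cmod (fourier \<psi> \<xi>))\<^sup>2)"
        by (subst ennreal_mult[symmetric]) (auto intro: ennreal_leI)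
    qed
    also have "\<dots> = ennreal ((a n)\<^sup>2 * (2 powr s * (1 + (l n)\<^sup>2) powr s)) * (sobolev_sq s (fourier \<psi>))"
      by (rule nn_integral_cmult) measurable
    also have "\<dots> < \<infinity>"
      using test_fn_bracket_finite[OF \<psi>, of s] by (auto simp: ennreal_mult_less_top)
    finally show "sobolev_sq s (fourier (\<theta> n)) < \<infinity>" .
  qed
  have pairG: "pair (fraclap s (\<theta> n)) \<phi> = pair (G n) \<phi> + (LBINT x. e n x * \<phi> x)" if \<phi>: "test_fn V \<phi>" for n V \<phi>
  proof -
    have [measurable]: "FT (\<theta> n) \<in> borel_measurable borel" using Hs_FT(4)[OF Hs\<theta>] by (simp add: L2fun_def)
    have ae: "AE \<xi> in lborel. fraclap s (\<theta> n) \<xi> = G n \<xi> + 1 * fourier (e n) \<xi>"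
      using fourier_L2_FT(2)[OF \<theta>F[of n]] by eventually_elim (simp add: fraclap_def G_def)
    have "pair (fraclap s (\<theta> n)) \<phi> = pair (\<lambda>\<xi>. G n \<xi> + 1 * fourier (e n) \<xi>) \<phi>"
      by (rule pair_cong_AE[OF ae _ _ \<phi>]) (simp_all add: fraclap_def[abs_def])
    also have "\<dots> = pair (G n) \<phi> + 1 * pair (fourier (e n)) \<phi>" by (rule pair_lincomb[OF \<phi> GH eH])
    finally show ?thesis by (simp add: pair_fourier[OF ei \<phi>])
  qed
  have P1: "pair (fraclap s (\<theta> n)) \<phi> = (LBINT x. (e n x + g n x) * \<phi> x)" if \<phi>: "test_fn V \<phi>" for n V \<phi>
    unfolding pairG[OF \<phi>] gpair[OF \<phi>] distrib_right
    by (subst Bochner_Integration.integral_add[OF L2fun_test_fn_integrable[OF eL2 \<phi>] L2fun_test_fn_integrable[OF gL2 \<phi>]]) simp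
  have P2: "pair (fraclap s (\<theta> n)) \<phi> = pair (G n) \<phi>" if \<phi>: "test_fn V \<phi>" and z: "\<And>x. \<psi> x * \<phi> x = 0" for n V \<phi>
  proof -
    have z': "e n x * \<phi> x = 0" for x unfolding e_def mult.assoc z by simp
    show ?thesis unfolding pairG[OF \<phi>] z' by simp
  qed
  have hneg_lim: "(\<lambda>n. hneg_norm s (G n)) \<longlonglongrightarrow> 0"
  proof -
    have "(\<lambda>n. sobolev_sq (- s) (G n)) \<longlonglongrightarrow> ennreal 0"
    proof (rule tendsto_sandwich[OF _ _ tendsto_const[of "ennreal 0"]])
      have "sobolev_sq (- s) (G n) \<le> l2_sq (G n)" for n
      proof (intro nn_integral_mono ennreal_leI)
        fix \<xi> :: 'a
        have "bracket (- s) \<xi> \<le> bracket 0 \<xi>" using s by (intro powr_mono) auto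
        also have "\<dots> = 1" by (simp add: add_nonneg_eq_0_iff)
        finally show "bracket (- s) \<xi> * (cmod (G n \<xi>))\<^sup>2 \<le> (cmod (G n \<xi>))\<^sup>2"
          by (intro mult_left_le_one_le) auto
      qed
      then show "\<forall>\<^sub>F n in sequentially. (sobolev_sq (- s) (G n)) \<le> l2_sq (G n)"
        by simp
    qed (use Elim in auto)
    then have "(\<lambda>n. hneg_norm s (G n)) \<longlonglongrightarrow> (2 * pi) powr (- real DIM('a) / 2) * sqrt 0"
      unfolding hneg_norm_def by (intro tendsto_mult tendsto_const tendsto_real_sqrt tendsto_enn2real) auto
    then show ?thesis by simp
  qed
  have g_lim: "(\<lambda>n. enn2real (l2_sq (g n))) \<longlonglongrightarrow> 0"
  proof (rule tendsto_enn2real)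
    show "(\<lambda>n. l2_sq (g n)) \<longlonglongrightarrow> ennreal 0"
    proof (rule tendsto_sandwich[OF _ _ tendsto_const[of "ennreal 0"]])
      show "(\<lambda>n. ennreal ((2 * pi) powr (- real DIM('a))) * (l2_sq (G n))) \<longlonglongrightarrow> ennreal 0"
        using ennreal_tendsto_cmult[OF _ Elim, of "ennreal ((2 * pi) powr (- real DIM('a)))"] by simp
    qed (use g2 in auto)
  qed simp
  have v_lim: "(\<lambda>n. \<integral>x. (e n x + g n x) * \<psi> x \<partial>lborel) \<longlonglongrightarrow> 0"
  proof -
    obtain K where K: "K > 0" "\<And>G. Hneg s G \<Longrightarrow> cmod (pair G \<psi>) \<le> K * hneg_norm s G"
      using pair_bound[OF \<psi>, of s] by metis
    \<comment> \<open>The pairing is bilinear, so the main term is the transform of \<psi>^2, not of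
      |\<psi>|^2, at -\<lambda> b. Its decay with exponent 1 gives an explicit Riemann-Lebesgue
      limit.\<close>
    have t2: "test_fn U (\<lambda>x. \<psi> x * \<psi> x)" using \<psi> by (intro test_fn_smooth_mult) (auto simp: test_fn_def)
    obtain C where C: "C > 0" "\<And>\<xi>. (1 + (norm \<xi>)\<^sup>2) ^ 1 * cmod (fourier (\<lambda>x. \<psi> x * \<psi> x) \<xi>) \<le> C"
      using fourier_test_fn_decay[OF t2] by metis
    have ee: "cmod (LBINT x. e n x * \<psi> x) \<le> C * inverse (real (Suc n))" for n
    proof -
      have "(LBINT x. e n x * \<psi> x) = fourier (\<lambda>x. \<psi> x * \<psi> x) (- (l n *\<^sub>R b))"
        by (simp add: fourier_def e_def mult.assoc)
      moreover have "(1 + (l n)\<^sup>2) * cmod (fourier (\<lambda>x. \<psi> x * \<psi> x) (- (l n *\<^sub>R b))) \<le> C"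
        using C(2)[of "- (l n *\<^sub>R b)"] l(2)[of n] nb by simp
      moreover have "l n * cmod (fourier (\<lambda>x. \<psi> x * \<psi> x) (- (l n *\<^sub>R b))) \<le> (1 + (l n)\<^sup>2) * cmod (fourier (\<lambda>x. \<psi> x * \<psi> x) (- (l n *\<^sub>R b)))"
      proof (rule mult_right_mono)
        have "l n * 1 \<le> l n * l n" using l[of n] by (intro mult_left_mono) auto
        then show "l n \<le> 1 + (l n)\<^sup>2" by (simp add: power2_eq_square)
      qed simp
      ultimately have "l n * cmod (LBINT x. e n x * \<psi> x) \<le> C" by simp
      then show ?thesis using l(2)[of n] by (simp add: l_def field_simps del: of_nat_Suc)
    qed
    have split: "(LBINT x. (e n x + g n x) * \<psi> x) = pair (G n) \<psi> + (LBINT x. e n x * \<psi> x)" for n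
      using P1[OF \<psi>, of n] pairG[OF \<psi>, of n] by simp
    have bnd: "cmod (LBINT x. (e n x + g n x) * \<psi> x) \<le> K * hneg_norm s (G n) + C * inverse (real (Suc n))" for n
      unfolding split by (rule order_trans[OF norm_triangle_ineq add_mono[OF K(2)[OF GH] ee]])
    have lim: "(\<lambda>n. K * hneg_norm s (G n) + C * inverse (real (Suc n))) \<longlonglongrightarrow> K * 0 + C * 0"
      by (intro tendsto_intros hneg_lim LIMSEQ_inverse_real_of_nat)
    show ?thesis
    proof (rule Lim_null_comparison)
      show "\<forall>\<^sub>F n in sequentially. norm (LBINT x. (e n x + g n x) * \<psi> x) \<le> K * hneg_norm s (G n) + C * inverse (real (Suc n))"
        by (intro always_eventually allI bnd)
      show "(\<lambda>n. K * hneg_norm s (G n) + C * inverse (real (Suc n))) \<longlonglongrightarrow> 0" using lim by simp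
    qed
  qed
  show ?thesis
    by (rule that[of \<theta> e g G]; fact Hs\<theta> \<theta>0 eL2 ne gL2 GH P1 P2 hneg_lim g_lim v_lim)
qed

section \<open>The main theorem\<close>

lemma hs_norm_eq_hneg_norm: "hs_norm s u = hneg_norm (- s) (FT u)"
  by (simp add: hs_norm_def hneg_norm_def)

text \<open>The approximating test functions live in \<Omega> and do not meet the support of \<phi>,
  so the integral of u \<phi> is bounded by a multiple of their H^s distance to u. Duality is used
  with exponent -s, since \<open>hs_norm s\<close> is \<open>hneg_norm (- s)\<close> of the
  transform.\<close>

lemma Hs_tilde_zero_outside:
  fixes u :: "'a::euclidean_space \<Rightarrow> complex"
  assumes u: "Hs_tilde s \<Omega> u"
  shows "AE x in lborel. x \<in> ext \<Omega> \<longrightarrow> u x = 0"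
proof (rule L2fun_zero_on_open)
  have uHs: "Hs s u" using u by (simp add: Hs_tilde_def)
  then show "L2fun u" by (rule Hs_FT)
  show "open (ext \<Omega>)" by (simp add: ext_def open_Compl)
  fix \<phi> assume \<phi>: "test_fn (ext \<Omega>) \<phi>"
  obtain f where f: "\<And>k. test_fn \<Omega> (f k)" "(\<lambda>k. hs_norm s (\<lambda>x. f k x - u x)) \<longlonglongrightarrow> 0"
    using u by (auto simp: Hs_tilde_def)
  obtain K where K: "K > 0" "\<And>G. Hneg (- s) G \<Longrightarrow> cmod (pair G \<phi>) \<le> K * hneg_norm (- s) G"
    using pair_bound[OF \<phi>, of "- s"] by metis
  have le: "cmod (LBINT x. u x * \<phi> x) \<le> K * hs_norm s (\<lambda>x. f k x - u x)" for k
  proof -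
    have d: "Hs s (\<lambda>x. f k x - u x)"
      using Hs_lincomb(1)[OF test_fn_Hs[OF f(1)[of k]] uHs, of "-1"] by simp
    have "pair (FT (\<lambda>x. f k x - u x)) \<phi> = (LBINT x. (f k x - u x) * \<phi> x)"
      by (rule pair_FT[OF Hs_FT(1)[OF d] \<phi>])
    also have "\<dots> = (LBINT x. - (u x * \<phi> x))"
    proof (rule Bochner_Integration.integral_cong[OF refl])
      fix x
      have "f k x * \<phi> x = 0"
        using test_fn_outside[OF f(1)[of k], of x] test_fn_outside[OF \<phi>, of x] closure_subset[of \<Omega>]
        by (auto simp: ext_def)
      then show "(f k x - u x) * \<phi> x = - (u x * \<phi> x)" by (simp add: left_diff_distrib)
    qed
    finally have "cmod (pair (FT (\<lambda>x. f k x - u x)) \<phi>) = cmod (LBINT x. u x * \<phi> x)" by simp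
    moreover have "Hneg (- s) (FT (\<lambda>x. f k x - u x))"
      using Hs_FT(2,4)[OF d] by (simp add: Hneg_def L2fun_def)
    ultimately show ?thesis using K(2) unfolding hs_norm_eq_hneg_norm by metis
  qed
  have "(\<lambda>k. K * hs_norm s (\<lambda>x. f k x - u x)) \<longlonglongrightarrow> K * 0" by (intro tendsto_intros f)
  then have "cmod (LBINT x. u x * \<phi> x) \<le> K * 0"
    by (rule tendsto_lowerbound) (use le in auto)
  then show "(LBINT x. u x * \<phi> x) = 0" by simp
qed

lemma spt_empty_imp_zero:
  assumes "spt u = {}" shows "AE x in lborel. u x = 0"
proof -
  have "AE x in lborel. x \<in> UNIV \<longrightarrow> u x = 0"
  proof (rule AE_on_open_locally)
    fix x :: 'a
    have "x \<notin> spt u" using assms by simp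
    then obtain e where "e > 0" "AE y in lborel. y \<in> ball x e \<longrightarrow> u y = 0" by (auto simp: spt_def)
    then show "\<exists>V. open V \<and> x \<in> V \<and> (AE y in lborel. y \<in> V \<longrightarrow> u y = 0)"
      by (intro exI[of _ "ball x e"]) auto
  qed
  then show ?thesis by simp
qed

lemma spt_subset_closure:
  assumes "AE x in lborel. x \<in> ext \<Omega> \<longrightarrow> u x = 0" shows "spt u \<subseteq> closure \<Omega>"
proof
  fix x assume x: "x \<in> spt u"
  show "x \<in> closure \<Omega>"
  proof (rule ccontr)
    assume "x \<notin> closure \<Omega>"
    then have "x \<in> ext \<Omega>" "open (ext \<Omega>)" by (auto simp: ext_def open_Compl)
    then obtain e where e: "e > 0" "ball x e \<subseteq> ext \<Omega>" using open_contains_ball by metis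
    have "AE y in lborel. y \<in> ball x e \<longrightarrow> u y = 0"
      using assms by eventually_elim (use e in blast)
    then show False using x e(1) by (auto simp: spt_def)
  qed
qed

text \<open>Used to pass from the support of u to \<Omega>. Nonemptiness of \<open>S\<close>
  matters: \<open>infdist\<close> to the empty set is 0, so \<open>nbhd {} r\<close> is the whole
  space for r \<ge> 0.\<close>

lemma ext_nbhd_antimono:
  assumes "S \<subseteq> closure T" "S \<noteq> {}"
  shows "ext (nbhd T r) \<subseteq> ext (nbhd S r)"
proof -
  have "nbhd S r \<subseteq> nbhd T r"
  proof
    fix x assume "x \<in> nbhd S r"
    then have "infdist x S \<le> r" by (simp add: nbhd_def)
    moreover have "infdist x T \<le> infdist x S"
      unfolding infdist_notempty[OF assms(2)]
    proof (rule cINF_greatest[OF assms(2)])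
      fix z assume "z \<in> S"
      then have "z \<in> closure T" using assms(1) by blast
      moreover from this have "T \<noteq> {}" by auto
      ultimately have "infdist z T = 0" by (simp add: in_closure_iff_infdist_zero)
      then show "infdist x T \<le> dist x z" using infdist_triangle[of x T z] by simp
    qed
    ultimately have "infdist x T \<le> r" by simp
    then show "x \<in> nbhd T r" by (simp add: nbhd_def)
  qed
  then show ?thesis using closure_mono unfolding ext_def by blast
qed

section \<open>Square-integrable functions on a measurable set\<close>

lemma set_nn_integral_eq:
  "(\<integral>\<^sup>+ x\<in>A. ennreal ((cmod (f x))\<^sup>2) \<partial>M) = (\<integral>\<^sup>+ x. ennreal (indicator A x * (cmod (f x))\<^sup>2) \<partial>M)"
  by (intro nn_integral_cong) (auto simp: indicator_def)

lemma L2on_lincomb: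
  fixes f g :: "'a::euclidean_space \<Rightarrow> complex"
  assumes A[measurable]: "A \<in> sets borel" and f: "L2on A f" and g: "L2on A g"
  shows "L2on A (\<lambda>x. f x + c * g x)"
    and "(L2norm_on A (\<lambda>x. f x + c * g x))\<^sup>2 \<le> 2 * (L2norm_on A f)\<^sup>2 + 2 * (cmod c)\<^sup>2 * (L2norm_on A g)\<^sup>2"
proof -
  have [measurable]: "f \<in> borel_measurable borel" "g \<in> borel_measurable borel" using f g by (auto simp: L2on_def)
  let ?N = "\<lambda>f. \<integral>\<^sup>+ x. ennreal (indicator A x * (cmod (f x))\<^sup>2) \<partial>lborel"
  have fin: "?N f < \<infinity>" "?N g < \<infinity>" using f g by (auto simp: L2on_def set_nn_integral_eq)
  have le: "?N (\<lambda>x. f x + c * g x) \<le> ennreal 2 * ?N f + ennreal (2 * (cmod c)\<^sup>2) * ?N g"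
    by (rule nn_integral_weighted_add) auto
  show "L2on A (\<lambda>x. f x + c * g x)"
    unfolding L2on_def set_nn_integral_eq using nn_integral_weighted_add_finite[OF _ _ _ _ fin] by auto
  have sq: "(L2norm_on A f)\<^sup>2 = enn2real (?N f)" for f
    by (simp add: L2norm_on_def set_nn_integral_eq)
  have e: "?N f = ennreal (enn2real (?N f))" "?N g = ennreal (enn2real (?N g))" using fin by simp_all
  have "ennreal 2 * ?N f + ennreal (2 * (cmod c)\<^sup>2) * ?N g = ennreal (2 * enn2real (?N f) + 2 * (cmod c)\<^sup>2 * enn2real (?N g))"
    by (subst e(1), subst e(2), subst ennreal_plus) (auto simp: ennreal_mult)
  with le have "enn2real (?N (\<lambda>x. f x + c * g x)) \<le> 2 * enn2real (?N f) + 2 * (cmod c)\<^sup>2 * enn2real (?N g)"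
    by (intro enn2real_leI) auto
  then show "(L2norm_on A (\<lambda>x. f x + c * g x))\<^sup>2 \<le> 2 * (L2norm_on A f)\<^sup>2 + 2 * (cmod c)\<^sup>2 * (L2norm_on A g)\<^sup>2"
    unfolding sq .
qed

lemma L2norm_on_nonneg: "L2norm_on A f \<ge> 0"
  by (simp add: L2norm_on_def)

lemma L2on_cmult:
  fixes f :: "'a::euclidean_space \<Rightarrow> complex"
  assumes A[measurable]: "A \<in> sets borel" and f: "L2on A f"
  shows "L2on A (\<lambda>x. c * f x)" and "L2norm_on A (\<lambda>x. c * f x) = cmod c * L2norm_on A f"
proof -
  have [measurable]: "f \<in> borel_measurable borel" using f by (auto simp: L2on_def)
  have "(\<integral>\<^sup>+ x. ennreal (indicator A x * (cmod (c * f x))\<^sup>2) \<partial>lborel) = (\<integral>\<^sup>+ x. ennreal ((cmod c)\<^sup>2) * ennreal (indicator A x * (cmod (f x))\<^sup>2) \<partial>lborel)"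
    by (intro nn_integral_cong) (simp add: ennreal_mult[symmetric] norm_mult power_mult_distrib mult.left_commute)
  also have "\<dots> = ennreal ((cmod c)\<^sup>2) * (\<integral>\<^sup>+ x. ennreal (indicator A x * (cmod (f x))\<^sup>2) \<partial>lborel)"
    by (rule nn_integral_cmult) measurable
  finally have e: "(\<integral>\<^sup>+ x. ennreal (indicator A x * (cmod (c * f x))\<^sup>2) \<partial>lborel) = \<dots>" .
  show "L2on A (\<lambda>x. c * f x)" using f unfolding L2on_def set_nn_integral_eq e by (auto simp: ennreal_mult_less_top)
  show "L2norm_on A (\<lambda>x. c * f x) = cmod c * L2norm_on A f"
    unfolding L2norm_on_def set_nn_integral_eq e by (simp add: enn2real_mult real_sqrt_mult)
qed

lemma L2fun_L2on:
  fixes f :: "'a::euclidean_space \<Rightarrow> complex"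
  assumes "L2fun f"
  shows "L2on A f" and "(L2norm_on A f)\<^sup>2 \<le> enn2real (l2_sq f)"
proof -
  have le: "(\<integral>\<^sup>+ x. ennreal (indicator A x * (cmod (f x))\<^sup>2) \<partial>lborel) \<le> l2_sq f"
    by (intro nn_integral_mono ennreal_leI) (auto simp: indicator_def)
  have fin: "l2_sq f < \<infinity>" using assms by (simp add: L2fun_def)
  show "L2on A f" using assms le_less_trans[OF le fin] by (simp add: L2on_def L2fun_def set_nn_integral_eq)
  show "(L2norm_on A f)\<^sup>2 \<le> enn2real (l2_sq f)"
    using le fin by (simp add: L2norm_on_def set_nn_integral_eq enn2real_mono)
qed

lemma L2on_L2fun_indicator:
  fixes f :: "'a::euclidean_space \<Rightarrow> complex"
  assumes [measurable]: "A \<in> sets borel" and f: "L2on A f"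
  shows "L2fun (\<lambda>x. indicator A x * f x)"
proof -
  have m: "f \<in> borel_measurable lborel" using f by (simp add: L2on_def)
  have "l2_sq (\<lambda>x. indicator A x * f x) = (\<integral>\<^sup>+ x. ennreal (indicator A x * (cmod (f x))\<^sup>2) \<partial>lborel)"
    by (intro nn_integral_cong) (auto simp: indicator_def)
  then have fin: "l2_sq (\<lambda>x. indicator A x * f x) < \<infinity>"
    using f by (simp add: L2on_def set_nn_integral_eq)
  have "(\<lambda>x. indicator A x *\<^sub>R f x) \<in> borel_measurable lborel"
    using m by (intro borel_measurable_scaleR borel_measurable_indicator) auto
  moreover have "(\<lambda>x. indicator A x *\<^sub>R f x) = (\<lambda>x. indicator A x * f x)" by (auto simp: indicator_def fun_eq_iff)
  ultimately show ?thesis using fin by (simp add: L2fun_def)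
qed

lemma set_integral_indicator: "(LINT x:A|lborel. f x * \<phi> x) = (LBINT x. (indicator A x * f x) * \<phi> x)"
  for f \<phi> :: "'a::euclidean_space \<Rightarrow> complex"
  unfolding set_lebesgue_integral_def
  by (intro Bochner_Integration.integral_cong) (auto simp: indicator_def)

lemma set_integral_lincomb:
  fixes f g \<phi> :: "'a::euclidean_space \<Rightarrow> complex"
  assumes A: "A \<in> sets borel" and f: "L2on A f" and g: "L2on A g" and \<phi>: "test_fn V \<phi>"
  shows "(LINT x:A|lborel. (f x + c * g x) * \<phi> x) = (LINT x:A|lborel. f x * \<phi> x) + c * (LINT x:A|lborel. g x * \<phi> x)"
proof -
  note i = L2fun_test_fn_integrable[OF L2on_L2fun_indicator[OF A f] \<phi>] L2fun_test_fn_integrable[OF L2on_L2fun_indicator[OF A g] \<phi>]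
  have "(LINT x:A|lborel. (f x + c * g x) * \<phi> x) = (LBINT x. (indicator A x * f x) * \<phi> x + c * ((indicator A x * g x) * \<phi> x))"
    unfolding set_integral_indicator by (intro Bochner_Integration.integral_cong) (auto simp: algebra_simps)
  also have "\<dots> = (LINT x:A|lborel. f x * \<phi> x) + c * (LINT x:A|lborel. g x * \<phi> x)"
    unfolding set_integral_indicator
    by (subst Bochner_Integration.integral_add[OF i(1) integrable_mult_right[OF i(2)]]) simp
  finally show ?thesis .
qed

lemma set_integral_test_fn:
  fixes f \<phi> :: "'a::euclidean_space \<Rightarrow> complex"
  assumes "test_fn A \<phi>" shows "(LINT x:A|lborel. f x * \<phi> x) = (LBINT x. f x * \<phi> x)"
  unfolding set_integral_indicator
  by (intro Bochner_Integration.integral_cong refl) (use test_fn_outside[OF assms] in \<open>auto simp: indicator_def\<close>)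

lemma pair_fraclap_lincomb:
  fixes u v :: "'a::euclidean_space \<Rightarrow> complex"
  assumes u: "Hs s u" and v: "Hs s v" and s: "s > 0" and \<phi>: "test_fn V \<phi>"
  shows "pair (fraclap s (\<lambda>x. u x + c * v x)) \<phi> = pair (fraclap s u) \<phi> + c * pair (fraclap s v) \<phi>"
proof -
  note uv = Hs_lincomb[OF u v, of c]
  have "AE \<xi> in lborel. fraclap s (\<lambda>x. u x + c * v x) \<xi> = fraclap s u \<xi> + c * fraclap s v \<xi>"
    using uv(2) by eventually_elim (simp add: fraclap_def algebra_simps)
  then have "pair (fraclap s (\<lambda>x. u x + c * v x)) \<phi> = pair (\<lambda>\<xi>. fraclap s u \<xi> + c * fraclap s v \<xi>) \<phi>"
    using Hneg_measurable[OF fraclap_Hneg[OF uv(1) s]] Hneg_measurable[OF Hneg_lincomb[OF fraclap_Hneg[OF u s] fraclap_Hneg[OF v s]]] \<phi>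
    by (intro pair_cong_AE) auto
  also have "\<dots> = pair (fraclap s u) \<phi> + c * pair (fraclap s v) \<phi>"
    by (rule pair_lincomb[OF \<phi> fraclap_Hneg[OF u s] fraclap_Hneg[OF v s]])
  finally show ?thesis .
qed

lemma Hs_cmult: "Hs s u \<Longrightarrow> Hs s (\<lambda>x. c * u x)"
  using Hs_lincomb(1)[of s u u "c - 1"] by (simp add: algebra_simps)

lemma pair_fraclap_cmult:
  assumes "Hs s u" "s > 0" "test_fn V \<phi>"
  shows "pair (fraclap s (\<lambda>x. c * u x)) \<phi> = c * pair (fraclap s u) \<phi>"
  using pair_fraclap_lincomb[OF assms(1,1,2,3), of "c - 1"] by (simp add: algebra_simps)

text \<open>For \<sigma> > 0 the function |log x|^{-\<sigma>} increases on (0,1), so the norm on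
  \<open>V\<close> may be replaced by any upper bound \<delta> < 1, which also rules out the
  degenerate value 1. The zero operator is admissible for every M \<ge> 0.\<close>

lemma log_estimate_zero_potential:
  fixes \<Omega> V :: "'a::euclidean_space set"
  assumes le: "log_estimate s \<Omega> V M c \<sigma>" and M: "M \<ge> 0" and c: "c > 0" and \<sigma>: "\<sigma> > 0"
    and \<Omega>: "bounded \<Omega>" "open \<Omega>" "smooth_boundary \<Omega>" and s: "s > 0"
    and v: "L2on \<Omega> v" "L2norm_on \<Omega> v = 1" and w: "Hs s w" "AE x in lborel. x \<in> ext \<Omega> \<longrightarrow> w x = 0"
    and eq: "\<And>\<phi>. test_fn \<Omega> \<phi> \<Longrightarrow> pair (fraclap s w) \<phi> = (LINT x:\<Omega>|lborel. v x * \<phi> x)"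
    and \<delta>: "0 < \<delta>" "\<delta> < 1" and N: "hneg_rest_norm s V (fraclap s w) \<le> \<delta>"
  shows "hneg_rest_norm s \<Omega> (FT (\<lambda>x. indicator \<Omega> x * v x)) \<le> c * \<bar>ln \<delta>\<bar> powr (- \<sigma>)"
proof -
  let ?\<Phi> = "\<lambda>(_::'a \<Rightarrow> complex) (_::'a). 0::complex"
  let ?N = "hneg_rest_norm s V (fraclap s w)"
  have "L2op_bdd \<Omega> ?\<Phi> M"
    using M L2norm_on_nonneg by (auto simp: L2op_bdd_def L2on_def L2norm_on_def)
  moreover have "unique_cont s \<Omega> ?\<Phi>"
    unfolding unique_cont_def
  proof (intro allI impI)
    fix w assume "solves s \<Omega> ?\<Phi> (\<lambda>_. 0) w"
    then show "AE x in lborel. w x = 0"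
      by (intro fraclap_unique_continuation[OF s \<Omega>(2,1,3), of w]) (auto simp: solves_def set_lebesgue_integral_def)
  qed
  moreover have "solves s \<Omega> ?\<Phi> v w"
    using w eq by (auto simp: solves_def set_lebesgue_integral_def)
  ultimately have "?N = 1 \<or> hneg_rest_norm s \<Omega> (FT (\<lambda>x. indicator \<Omega> x * v x)) \<le> c * \<bar>ln ?N\<bar> powr (- \<sigma>)"
    using le v unfolding log_estimate_def Let_def by blast
  then have 1: "hneg_rest_norm s \<Omega> (FT (\<lambda>x. indicator \<Omega> x * v x)) \<le> c * \<bar>ln ?N\<bar> powr (- \<sigma>)"
    using N \<delta> by auto
  have N0: "?N \<ge> 0" by (rule hneg_rest_norm_nonneg[OF fraclap_Hneg[OF w(1) s]])
  have "\<bar>ln ?N\<bar> powr (- \<sigma>) \<le> \<bar>ln \<delta>\<bar> powr (- \<sigma>)"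
  \<comment> \<open>For \<open>?N = 0\<close> the left-hand side is \<open>0\<close>, since \<open>ln 0 = 0\<close> and \<open>0 powr x = 0\<close>.\<close>
  proof (cases "?N = 0")
    case False
    then have "?N > 0" using N0 by simp
    then have "ln ?N \<le> ln \<delta>" using N \<delta>(1) by simp
    moreover have "ln \<delta> < 0" using \<delta> by simp
    ultimately show ?thesis using \<sigma> by (intro powr_mono2') auto
  qed simp
  then show ?thesis using 1 c by (smt (verit) mult_left_mono)
qed

theorem theorem1p2:
  fixes W \<Omega> :: "'a::euclidean_space set"
    and s M :: real
    and u :: "'a \<Rightarrow> complex"
    and \<Psi> :: "('a \<Rightarrow> complex) \<Rightarrow> ('a \<Rightarrow> complex)"
    and \<mu> c \<sigma> :: "real \<Rightarrow> real"
  assumes s: "0 < s" "s < 1"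
    and W: "open W" "\<not> bounded W"
    and \<Omega>: "\<Omega> \<subseteq> ext W" "bounded \<Omega>" "open \<Omega>" "smooth_boundary \<Omega>"
    and u: "Hs_tilde s \<Omega> u"
    and lapL2: "\<exists>h. L2on \<Omega> h \<and>
                  (\<forall>\<phi>. test_fn \<Omega> \<phi> \<longrightarrow> pair (fraclap s u) \<phi> = (LINT x:\<Omega>|lborel. h x * \<phi> x))"
    and eq: "\<forall>\<phi>. test_fn W \<phi> \<longrightarrow> pair (\<lambda>\<xi>. fraclap s u \<xi> + \<Psi> u \<xi>) \<phi> = 0"
    and \<Psi>: "quasilocal s \<Psi> \<mu>"
    and M: "M \<ge> 0"
    and cs: "\<forall>r>0. c r > 0 \<and> \<sigma> r > 0 \<and>
                   log_estimate s \<Omega> (W \<inter> ext (nbhd \<Omega> r)) M (c r) (\<sigma> r)"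
    and lim: "((\<lambda>r. c r * \<bar>ln (\<mu> r)\<bar> powr (- \<sigma> r)) \<longlongrightarrow> 0) at_top"
  shows "AE x in lborel. u x = 0"
proof (rule ccontr)
  assume nz: "\<not> (AE x in lborel. u x = 0)"
  have \<Omega>m[measurable]: "\<Omega> \<in> sets borel" using \<Omega>(3) by simp
  have uHs: "Hs s u" using u by (simp add: Hs_tilde_def)
  have uout: "AE x in lborel. x \<in> ext \<Omega> \<longrightarrow> u x = 0" by (rule Hs_tilde_zero_outside[OF u])
  have uH: "Hneg s (fraclap s u)" by (rule fraclap_Hneg[OF uHs s(1)])
  have \<Psi>H: "Hneg s (\<Psi> u)" using \<Psi> uHs by (auto simp: quasilocal_def bdd_op_def)
  obtain h where h: "L2on \<Omega> h" "\<And>\<phi>. test_fn \<Omega> \<phi> \<Longrightarrow> pair (fraclap s u) \<phi> = (LINT x:\<Omega>|lborel. h x * \<phi> x)"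
    using lapL2 by metis
  \<comment> \<open>If \<open>h\<close> paired to zero with all test functions on \<Omega>, then
    \<open>u\<close> would solve the homogeneous Dirichlet problem and vanish.\<close>
  have "\<exists>\<psi>. test_fn \<Omega> \<psi> \<and> (LINT x:\<Omega>|lborel. h x * \<psi> x) \<noteq> 0"
  proof (rule ccontr)
    assume "\<not> ?thesis"
    then have "pair (fraclap s u) \<phi> = 0" if "test_fn \<Omega> \<phi>" for \<phi>
      using that h(2)[OF that] by auto
    then show False using nz fraclap_unique_continuation[OF s(1) \<Omega>(3,2,4) uHs uout] by blast
  qed
  then obtain \<psi> where \<psi>: "test_fn \<Omega> \<psi>" "(LINT x:\<Omega>|lborel. h x * \<psi> x) \<noteq> 0" by blast
  define I0 where "I0 = (LINT x:\<Omega>|lborel. h x * \<psi> x)"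
  have I0: "cmod I0 > 0" using \<psi>(2) by (simp add: I0_def)
  obtain \<theta> e g G :: "nat \<Rightarrow> 'a \<Rightarrow> complex" where
    \<theta>: "\<And>n. Hs s (\<theta> n)" "\<And>n x. \<psi> x = 0 \<Longrightarrow> \<theta> n x = 0" and
    e: "\<And>n. L2fun (e n)" "\<And>n x. cmod (e n x) = cmod (\<psi> x)" and g: "\<And>n. L2fun (g n)" and G: "\<And>n. Hneg s (G n)" and
    pair1: "\<And>n V \<phi>. test_fn V \<phi> \<Longrightarrow> pair (fraclap s (\<theta> n)) \<phi> = (LBINT x. (e n x + g n x) * \<phi> x)" and
    pair2: "\<And>n V \<phi>. test_fn V \<phi> \<Longrightarrow> (\<And>x. \<psi> x * \<phi> x = 0) \<Longrightarrow> pair (fraclap s (\<theta> n)) \<phi> = pair (G n) \<phi>" and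
    lims: "(\<lambda>n. hneg_norm s (G n)) \<longlonglongrightarrow> 0" "(\<lambda>n. enn2real (l2_sq (g n))) \<longlonglongrightarrow> 0"
      "(\<lambda>n. \<integral>x. (e n x + g n x) * \<psi> x \<partial>lborel) \<longlonglongrightarrow> 0"
  proof (rule high_frequency_data[OF \<psi>(1) s], goal_cases)
    case (1 \<theta> e g G)
    show ?case by (rule 1(1); fact 1)
  qed
  \<comment> \<open>Pairing with \<psi> bounds H^{-s} norms from below; this keeps the left-hand
    side of the logarithmic estimate away from 0.\<close>
  obtain K where K: "K > 0" "\<And>G. Hneg s G \<Longrightarrow> cmod (pair G \<psi>) \<le> K * hneg_norm s G"
    using pair_bound[OF \<psi>(1), of s] by metis
  define S where "S = hs_norm s u"
  have S: "S \<ge> 0" by (simp add: S_def hs_norm_def)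
  define H where "H = (L2norm_on \<Omega> h)\<^sup>2"
  define P where "P = (L2norm_on \<Omega> \<psi>)\<^sup>2"
  have P: "P > 0"
  proof (rule ccontr)
    assume "\<not> P > 0"
    then have "P = 0" unfolding P_def using zero_le_power2[of "L2norm_on \<Omega> \<psi>"] by linarith
    moreover have "(\<integral>\<^sup>+ x. ennreal (indicator \<Omega> x * (cmod (\<psi> x))\<^sup>2) \<partial>lborel) < \<infinity>"
      using L2fun_L2on(1)[OF test_fn_L2fun[OF \<psi>(1)], of \<Omega>] by (simp add: L2on_def set_nn_integral_eq)
    ultimately have "(\<integral>\<^sup>+ x. ennreal (indicator \<Omega> x * (cmod (\<psi> x))\<^sup>2) \<partial>lborel) = 0"
      by (auto simp: P_def L2norm_on_def set_nn_integral_eq enn2real_eq_0_iff)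
    then have "AE x in lborel. ennreal (indicator \<Omega> x * (cmod (\<psi> x))\<^sup>2) = 0"
      using test_fn_measurable[OF \<psi>(1)] by (subst (asm) nn_integral_0_iff_AE) auto
    then have "AE x in lborel. (indicator \<Omega> x * h x) * \<psi> x = 0"
      by eventually_elim (auto simp: indicator_def split: if_splits)
    then have "(LINT x:\<Omega>|lborel. h x * \<psi> x) = 0"
      unfolding set_integral_indicator by (rule integral_eq_zero_AE)
    then show False using \<psi>(2) by simp
  qed
  \<comment> \<open>\<open>m0\<close> is a lower bound for the normalising factor that absorbs \<open>\<parallel>u\<parallel>\<close> and the losses in the
    quasi-triangle inequality \<open>hneg_norm_lincomb\<close>; \<open>t\<close> is chosen so that it is attained.\<close>
  define m0 where "m0 = 4 * (S + 2)"
  define t where "t = sqrt (2 * (m0\<^sup>2 + 2 * H + 1) / P)"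
  have H: "H \<ge> 0" by (simp add: H_def)
  have t2: "t\<^sup>2 * P = 2 * (m0\<^sup>2 + 2 * H + 1)"
    using P H by (simp add: t_def)
  have t: "t > 0" unfolding t_def using P H by (auto intro!: divide_pos_pos add_nonneg_pos)
  \<comment> \<open>An upper bound for the squared normalising factor: 2P + 2 bounds the squared
    norm of e + g once that of g is at most 1. The final 1 ensures positivity.\<close>
  define B where "B = 2 * H + 2 * t\<^sup>2 * (2 * P + 2) + 1"
  have B: "B > 0" unfolding B_def using H P by (intro add_nonneg_pos add_nonneg_nonneg mult_nonneg_nonneg) auto
  \<comment> \<open>Half of |I0| survives the oscillating term, normalising costs at most the factor
    sqrt B, and \<open>K\<close> converts the pairing into a norm. None of these depends on r,
    \<delta> or n.\<close>
  define a where "a = cmod I0 / (2 * sqrt B * K)"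
  have a: "a > 0" unfolding a_def using I0 B K by simp
  \<comment> \<open>Only the last condition involves \<delta>; it is met by raising the frequency
    after \<open>t\<close>, and hence \<open>a\<close>, has been fixed.\<close>
  have ev: "\<forall>\<^sub>F n in sequentially. 2 * t\<^sup>2 * enn2real (l2_sq (g n)) \<le> 1 \<and>
      enn2real (l2_sq (g n)) \<le> 1 \<and> t * cmod (LBINT x. (e n x + g n x) * \<psi> x) \<le> cmod I0 / 2 \<and>
      t * hneg_norm s (G n) \<le> \<delta>" if \<delta>: "\<delta> > 0" for \<delta>
  proof (intro eventually_conj)
    have "(\<lambda>n. 2 * t\<^sup>2 * enn2real (l2_sq (g n))) \<longlonglongrightarrow> 2 * t\<^sup>2 * 0"
      by (intro tendsto_intros lims)
    from order_tendstoD(2)[OF this, of 1]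
    show "\<forall>\<^sub>F n in sequentially. 2 * t\<^sup>2 * enn2real (l2_sq (g n)) \<le> 1"
      by (auto elim!: eventually_mono)
    from order_tendstoD(2)[OF lims(2), of 1]
    show "\<forall>\<^sub>F n in sequentially. enn2real (l2_sq (g n)) \<le> 1"
      by (auto elim!: eventually_mono)
    have "(\<lambda>n. t * cmod (LBINT x. (e n x + g n x) * \<psi> x)) \<longlonglongrightarrow> t * cmod 0"
      by (intro tendsto_intros lims)
    from order_tendstoD(2)[OF this, of "cmod I0 / 2"]
    show "\<forall>\<^sub>F n in sequentially. t * cmod (LBINT x. (e n x + g n x) * \<psi> x) \<le> cmod I0 / 2"
      using I0 by (auto elim!: eventually_mono)
    have "(\<lambda>n. t * hneg_norm s (G n)) \<longlonglongrightarrow> t * 0" by (intro tendsto_intros lims)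
    from order_tendstoD(2)[OF this, of \<delta>]
    show "\<forall>\<^sub>F n in sequentially. t * hneg_norm s (G n) \<le> \<delta>"
      using \<delta> by (auto elim!: eventually_mono)
  qed
  \<comment> \<open>The level \<delta> is free, instead of being \<open>\<mu> r\<close>, because
    \<open>\<mu> r\<close> may be 0; in that case \<delta> is sent to 0 afterwards.\<close>
  have key: "a \<le> c r * \<bar>ln \<delta>\<bar> powr (- \<sigma> r)" if r: "r > 0" and \<delta>: "0 < \<delta>" "\<delta> < 1" "\<mu> r \<le> \<delta>" for r \<delta>
  proof -
    obtain n where n: "2 * t\<^sup>2 * enn2real (l2_sq (g n)) \<le> 1"
      "enn2real (l2_sq (g n)) \<le> 1"
      "t * cmod (LBINT x. (e n x + g n x) * \<psi> x) \<le> cmod I0 / 2" "t * hneg_norm s (G n) \<le> \<delta>"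
      using eventually_happens'[OF sequentially_bot ev[OF \<delta>(1)]] by blast
    define v where "v x = e n x + 1 * g n x" for x
    have vL2: "L2fun v" unfolding v_def[abs_def] by (rule L2fun_lincomb[OF e(1) g])
    define V where "V x = h x + of_real t * v x" for x
    define m where "m = L2norm_on \<Omega> V"
    have V: "L2on \<Omega> V" unfolding V_def[abs_def] by (rule L2on_lincomb(1)[OF \<Omega>m h(1) L2fun_L2on(1)[OF vL2]])
    have gn: "L2on \<Omega> (g n)" and en: "L2on \<Omega> (e n)" by (rule L2fun_L2on(1)[OF g], rule L2fun_L2on(1)[OF e(1)])
    have gq: "(L2norm_on \<Omega> (g n))\<^sup>2 \<le> enn2real (l2_sq (g n))" by (rule L2fun_L2on(2)[OF g])
    have eP: "(L2norm_on \<Omega> (e n))\<^sup>2 = P" unfolding P_def L2norm_on_def e(2) ..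
    have m_upper: "m\<^sup>2 \<le> B"
    proof -
      have "(L2norm_on \<Omega> v)\<^sup>2 \<le> 2 * P + 2 * (cmod 1)\<^sup>2 * (L2norm_on \<Omega> (g n))\<^sup>2"
        unfolding v_def[abs_def] eP[symmetric] by (rule L2on_lincomb(2)[OF \<Omega>m en gn])
      then have "(L2norm_on \<Omega> v)\<^sup>2 \<le> 2 * P + 2" using gq n(2) by simp
      then have "2 * t\<^sup>2 * (L2norm_on \<Omega> v)\<^sup>2 \<le> 2 * t\<^sup>2 * (2 * P + 2)" by (intro mult_left_mono) auto
      moreover have "m\<^sup>2 \<le> 2 * H + 2 * (cmod (of_real t))\<^sup>2 * (L2norm_on \<Omega> v)\<^sup>2"
        unfolding m_def V_def[abs_def] H_def by (rule L2on_lincomb(2)[OF \<Omega>m h(1) L2fun_L2on(1)[OF vL2]])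
      ultimately show ?thesis unfolding B_def by simp
    qed
    have m_lower: "m0\<^sup>2 \<le> m\<^sup>2"
    proof -
      \<comment> \<open>The difference of \<open>V\<close> and \<open>q\<close> is t e, whose norm
        is known because |e| = |\<psi>|. The norm of \<open>q\<close> is bounded independently of t,
        so a large t makes \<open>V\<close> large.\<close>
      define q where "q x = h x + of_real t * g n x" for x
      have q: "L2on \<Omega> q" unfolding q_def[abs_def] by (rule L2on_lincomb(1)[OF \<Omega>m h(1) gn])
      have "(L2norm_on \<Omega> q)\<^sup>2 \<le> 2 * H + 2 * (cmod (of_real t))\<^sup>2 * (L2norm_on \<Omega> (g n))\<^sup>2"
        unfolding q_def[abs_def] H_def by (rule L2on_lincomb(2)[OF \<Omega>m h(1) gn])
      also have "\<dots> \<le> 2 * H + 1"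
      proof -
        have "2 * t\<^sup>2 * (L2norm_on \<Omega> (g n))\<^sup>2 \<le> 2 * t\<^sup>2 * enn2real (l2_sq (g n))"
          using gq by (intro mult_left_mono) auto
        then show ?thesis using n(1) by simp
      qed
      finally have q2: "(L2norm_on \<Omega> q)\<^sup>2 \<le> 2 * H + 1" .
      have "(\<lambda>x. V x + (-1) * q x) = (\<lambda>x. of_real t * e n x)"
        by (simp add: V_def v_def q_def fun_eq_iff algebra_simps)
      then have "(L2norm_on \<Omega> (\<lambda>x. of_real t * e n x))\<^sup>2 \<le> 2 * m\<^sup>2 + 2 * (cmod (-1))\<^sup>2 * (L2norm_on \<Omega> q)\<^sup>2"
        using L2on_lincomb(2)[OF \<Omega>m V q, of "-1"] by (simp add: m_def)
      \<comment> \<open>By the choice of t the left side equals 2 m0^2 + 2 (2H + 1), so the terms in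
        H cancel.\<close>
      then have "t\<^sup>2 * P \<le> 2 * m\<^sup>2 + 2 * (2 * H + 1)"
        using q2 by (simp add: L2on_cmult(2)[OF \<Omega>m en] power_mult_distrib eP)
      then show ?thesis unfolding t2 by simp
    qed
    have m0: "m0 \<ge> 8" using S by (simp add: m0_def)
    have mm: "m0 \<le> m" using m_lower L2norm_on_nonneg[of \<Omega> V] by (auto simp: m_def intro: power2_le_imp_le)
    then have m: "m > 0" using m0 by simp
    define v' where "v' x = of_real (1 / m) * V x" for x
    have v': "L2on \<Omega> v'" "L2norm_on \<Omega> v' = 1"
      using L2on_cmult[OF \<Omega>m V, of "of_real (1 / m)"] m unfolding v'_def[abs_def] m_def[symmetric] by (auto simp: norm_divide)
    define w where "w x = u x + of_real t * \<theta> n x" for x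
    have w: "Hs s w" unfolding w_def[abs_def] by (rule Hs_lincomb(1)[OF uHs \<theta>(1)])
    define w' where "w' x = of_real (1 / m) * w x" for x
    have w': "Hs s w'" unfolding w'_def[abs_def] by (rule Hs_cmult[OF w])
    have pw: "pair (fraclap s w') \<phi> = of_real (1 / m) * (pair (fraclap s u) \<phi> + of_real t * pair (fraclap s (\<theta> n)) \<phi>)" if "test_fn X \<phi>" for X \<phi>
      unfolding w'_def[abs_def] pair_fraclap_cmult[OF w s(1) that] unfolding w_def[abs_def]
        pair_fraclap_lincomb[OF uHs \<theta>(1) s(1) that] ..
    have w'out: "AE x in lborel. x \<in> ext \<Omega> \<longrightarrow> w' x = 0"
      using uout
    proof eventually_elim
      case (elim x)
      show ?case
      proof
        assume x: "x \<in> ext \<Omega>"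
        then have "x \<notin> \<Omega>" using closure_subset[of \<Omega>] by (auto simp: ext_def)
        then have "\<theta> n x = 0" by (intro \<theta>(2) test_fn_outside[OF \<psi>(1)])
        then show "w' x = 0" using elim x by (simp add: w'_def w_def)
      qed
    qed
    have LV: "(LINT x:\<Omega>|lborel. v' x * \<phi> x) = of_real (1 / m) * ((LINT x:\<Omega>|lborel. h x * \<phi> x) + of_real t * (LBINT x. v x * \<phi> x))"
      if \<phi>: "test_fn \<Omega> \<phi>" for \<phi>
    proof -
      have "(LINT x:\<Omega>|lborel. v' x * \<phi> x) = of_real (1 / m) * (LINT x:\<Omega>|lborel. V x * \<phi> x)"
        unfolding set_integral_test_fn[OF \<phi>, of v'] set_integral_test_fn[OF \<phi>, of V]
        unfolding v'_def mult.assoc by (rule integral_mult_right_zero)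
      also have "(LINT x:\<Omega>|lborel. V x * \<phi> x) = (LINT x:\<Omega>|lborel. h x * \<phi> x) + of_real t * (LINT x:\<Omega>|lborel. v x * \<phi> x)"
        unfolding V_def by (rule set_integral_lincomb[OF \<Omega>m h(1) L2fun_L2on(1)[OF vL2] \<phi>])
      finally show ?thesis unfolding set_integral_test_fn[OF \<phi>, of v] .
    qed
    have sol: "pair (fraclap s w') \<phi> = (LINT x:\<Omega>|lborel. v' x * \<phi> x)" if \<phi>: "test_fn \<Omega> \<phi>" for \<phi>
      unfolding pw[OF \<phi>] LV[OF \<phi>] h(2)[OF \<phi>] pair1[OF \<phi>] by (simp add: v_def)
    let ?X = "W \<inter> ext (nbhd \<Omega> r)"
    have N: "hneg_rest_norm s ?X (fraclap s w') \<le> \<delta>"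
    proof -
      have "spt u \<noteq> {}" using nz spt_empty_imp_zero by blast
      then have sub: "ext (nbhd \<Omega> r) \<subseteq> ext (nbhd (spt u) r)"
        using spt_subset_closure[OF uout] by (intro ext_nbhd_antimono)
      have "hneg_rest_norm s (ext (nbhd (spt u) r)) (\<Psi> u) \<le> \<mu> r * S"
        using \<Psi> uHs r by (auto simp: quasilocal_def S_def)
      also have "\<dots> \<le> \<delta> * S" using \<delta>(3) S by (intro mult_right_mono)
      \<comment> \<open>The strict gap is needed because the infimum over extensions need not be
        attained.\<close>
      also have "\<dots> < \<delta> * (S + 1)" using \<delta>(1) by simp
      finally obtain G0 where G0: "Hneg s G0" "\<And>\<phi>. test_fn (ext (nbhd (spt u) r)) \<phi> \<Longrightarrow> pair G0 \<phi> = pair (\<Psi> u) \<phi>"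
        "hneg_norm s G0 < \<delta> * (S + 1)"
        using hneg_rest_norm_approx[OF \<Psi>H] by metis
      \<comment> \<open>On W_r the equation turns (-\<Delta>)^s u into -\<Psi> u, which
        \<open>G0\<close> extends, and (-\<Delta>)^s \<theta> reduces to \<open>G n\<close> since
        \<psi> vanishes there. Up to the factor -1/m this combination therefore extends
        (-\<Delta>)^s w'.\<close>
      define F1 where "F1 \<xi> = G0 \<xi> + of_real (- t) * G n \<xi>" for \<xi>
      have F1: "Hneg s F1" unfolding F1_def[abs_def] by (rule Hneg_lincomb[OF G0(1) G])
      have F1n: "hneg_norm s F1 \<le> 2 * (hneg_norm s G0 + cmod (of_real (- t)) * hneg_norm s (G n))"
        unfolding F1_def[abs_def] by (rule hneg_norm_lincomb[OF G0(1) G])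
      have Z: "Hneg s (\<lambda>_::'a. 0)" by (simp add: Hneg_def)
      \<comment> \<open>Scaling is treated as a linear combination with 0, at the cost of a further
        factor 2.\<close>
      define F2 where "F2 \<xi> = 0 + of_real (- (1 / m)) * F1 \<xi>" for \<xi>
      have F2: "Hneg s F2" unfolding F2_def[abs_def] by (rule Hneg_lincomb[OF Z F1])
      have "hneg_norm s F2 \<le> 2 * (hneg_norm s (\<lambda>_::'a. 0) + cmod (of_real (- (1 / m))) * hneg_norm s F1)"
        unfolding F2_def[abs_def] by (rule hneg_norm_lincomb[OF Z F1])
      also have "\<dots> = 2 * hneg_norm s F1 / m"
        using m by (simp add: hneg_norm_def norm_divide)
      also have "\<dots> \<le> (\<delta> * m) / m"
      proof (rule divide_right_mono)
        \<comment> \<open>The origin of \<open>m0\<close>: 4 is the product of the two factors 2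
          from the quasi-triangle inequality, and S + 2 = (S + 1) + 1 collects the contributions of
          u and \<theta>.\<close>
        have "2 * hneg_norm s F1 \<le> 4 * (\<delta> * (S + 1) + \<delta>)"
          using F1n G0(3) n(4) t by simp
        also have "\<dots> = \<delta> * m0" by (simp add: m0_def algebra_simps)
        also have "\<dots> \<le> \<delta> * m" using mm \<delta>(1) by (intro mult_left_mono) auto
        finally show "2 * hneg_norm s F1 \<le> \<delta> * m" .
      qed (use m in simp)
      finally have F2n: "hneg_norm s F2 \<le> \<delta>" using m by simp
      have same: "pair F2 \<phi> = pair (fraclap s w') \<phi>" if \<phi>: "test_fn ?X \<phi>" for \<phi>
      proof -
        have \<phi>W: "test_fn W \<phi>" and \<phi>E: "test_fn (ext (nbhd (spt u) r)) \<phi>"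
          using \<phi> sub by (auto intro: test_fn_mono)
        have disj: "\<psi> x * \<phi> x = 0" for x
          using test_fn_outside[OF \<phi>W, of x] test_fn_outside[OF \<psi>(1), of x] \<Omega>(1) closure_subset[of W]
          by (auto simp: ext_def)
        have "0 = pair (\<lambda>\<xi>. fraclap s u \<xi> + 1 * \<Psi> u \<xi>) \<phi>" using eq \<phi>W by simp
        also have "\<dots> = pair (fraclap s u) \<phi> + 1 * pair (\<Psi> u) \<phi>" by (rule pair_lincomb[OF \<phi> uH \<Psi>H])
        finally have "pair (fraclap s u) \<phi> = - pair G0 \<phi>"
          using G0(2)[OF \<phi>E] by (simp add: eq_neg_iff_add_eq_0)
        moreover have "pair F2 \<phi> = pair (\<lambda>_. 0) \<phi> + of_real (- (1 / m)) * pair F1 \<phi>"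
          unfolding F2_def[abs_def] by (rule pair_lincomb[OF \<phi> Z F1])
        moreover have "pair F1 \<phi> = pair G0 \<phi> + of_real (- t) * pair (G n) \<phi>"
          unfolding F1_def[abs_def] by (rule pair_lincomb[OF \<phi> G0(1) G])
        moreover have "pair (\<lambda>_. 0) \<phi> = 0" by (simp add: pair_def)
        ultimately show ?thesis
          unfolding pw[OF \<phi>] pair2[OF \<phi> disj] by (simp add: algebra_simps)
      qed
      show ?thesis by (rule order_trans[OF hneg_rest_norm_le[OF F2] F2n]) (rule same)
    qed
    have "a \<le> hneg_rest_norm s \<Omega> (FT (\<lambda>x. indicator \<Omega> x * v' x))"
    proof (rule hneg_rest_norm_ge)
      have L: "L2fun (\<lambda>x. indicator \<Omega> x * v' x)" by (rule L2on_L2fun_indicator[OF \<Omega>m v'(1)])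
      obtain R where R: "\<And>x. x \<in> \<Omega> \<Longrightarrow> norm x < R" using \<Omega>(2) bounded_pos_less by metis
      have "fourier_L2 (\<lambda>x. indicator \<Omega> x * v' x) (fourier (\<lambda>x. indicator \<Omega> x * v' x))"
        by (rule fourier_L2_bounded_support[OF L, of R]) (use R in \<open>auto simp: indicator_def intro!: AE_I2\<close>)
      from fourier_L2_FT(1)[OF this]
      have F: "fourier_L2 (\<lambda>x. indicator \<Omega> x * v' x) (FT (\<lambda>x. indicator \<Omega> x * v' x))" .
      then show "Hneg s (FT (\<lambda>x. indicator \<Omega> x * v' x))" using s by (intro L2fun_Hneg) (auto simp: fourier_L2_def)
      \<comment> \<open>Every extension has the same pairing with \<psi>, so a lower bound for this
        single number bounds the norms of all of them.\<close>
      fix G' assume G': "Hneg s G'" "\<And>\<phi>. test_fn \<Omega> \<phi> \<Longrightarrow> pair G' \<phi> = pair (FT (\<lambda>x. indicator \<Omega> x * v' x)) \<phi>"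
      have "pair G' \<psi> = (LINT x:\<Omega>|lborel. v' x * \<psi> x)"
        unfolding G'(2)[OF \<psi>(1)] pair_FT[OF F \<psi>(1)] set_integral_indicator ..
      also have "\<dots> = of_real (1 / m) * (I0 + of_real t * (LBINT x. v x * \<psi> x))"
        unfolding LV[OF \<psi>(1)] I0_def ..
      finally have p: "cmod (pair G' \<psi>) = cmod (I0 + of_real t * (LBINT x. v x * \<psi> x)) / m"
        using m by (simp add: norm_mult norm_divide)
      have "cmod I0 / 2 \<le> cmod I0 - cmod (of_real t * (LBINT x. v x * \<psi> x))"
        using n(3) t by (simp add: norm_mult v_def)
      also have "\<dots> \<le> cmod (I0 + of_real t * (LBINT x. v x * \<psi> x))"
        by (rule norm_diff_ineq)
      finally have "cmod I0 / 2 / m \<le> cmod (pair G' \<psi>)"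
        unfolding p using m by (intro divide_right_mono) auto
      moreover have "cmod I0 / 2 / sqrt B \<le> cmod I0 / 2 / m"
        using m_upper m B by (intro divide_left_mono real_le_rsqrt mult_pos_pos) auto
      ultimately have "cmod I0 / 2 / sqrt B \<le> K * hneg_norm s G'" using K(2)[OF G'(1)] by linarith
      then show "a \<le> hneg_norm s G'"
        unfolding a_def using K(1) B by (simp add: field_simps)
    qed
    also have "\<dots> \<le> c r * \<bar>ln \<delta>\<bar> powr (- \<sigma> r)"
      using cs r by (intro log_estimate_zero_potential[where V = ?X and w = w' and M = M] \<Omega> M s v' w' w'out sol \<delta> N) auto
    finally show ?thesis .
  qed
  have "(\<mu> \<longlongrightarrow> 0) at_top" using \<Psi> by (simp add: quasilocal_def)
  then have "\<forall>\<^sub>F r in at_top. \<mu> r < 1" by (rule order_tendstoD) simp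
  moreover have "\<forall>\<^sub>F r in at_top. c r * \<bar>ln (\<mu> r)\<bar> powr (- \<sigma> r) < a" using lim a by (rule order_tendstoD)
  ultimately have "\<forall>\<^sub>F r in at_top. \<mu> r < 1 \<and> c r * \<bar>ln (\<mu> r)\<bar> powr (- \<sigma> r) < a \<and> r > 0"
    using eventually_gt_at_top[of "0::real"] by eventually_elim auto
  then obtain r where r: "\<mu> r < 1" "c r * \<bar>ln (\<mu> r)\<bar> powr (- \<sigma> r) < a" "r > 0"
    using eventually_happens'[OF trivial_limit_at_top_linorder] by blast
  have "\<mu> r \<ge> 0" using \<Psi> r(3) by (simp add: quasilocal_def)
  then consider "\<mu> r > 0" | "\<mu> r = 0" by linarith
  then show False
  proof cases
    case 1
    then show False using key[OF r(3) 1 r(1)] r(2) by simp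
  next
    case 2
    \<comment> \<open>\<open>key\<close> holds with \<delta> = exp(-L) for every L > 0. For this
      fixed r, letting L tend to infinity drives the right-hand side to 0, which contradicts a >
      0.\<close>
    have "((\<lambda>L. c r * L powr (- \<sigma> r)) \<longlongrightarrow> c r * 0) at_top"
      using cs r(3) by (intro tendsto_mult tendsto_const tendsto_neg_powr filterlim_ident) auto
    moreover have "\<forall>\<^sub>F L in at_top. a \<le> c r * L powr (- \<sigma> r)"
      using eventually_gt_at_top[of "0::real"]
    proof eventually_elim
      case (elim L)
      then show ?case using key[OF r(3), of "exp (- L)"] 2 by simp
    qed
    ultimately have "a \<le> c r * 0" by (intro tendsto_lowerbound) auto
    then show False using a by simp
  qed
qed

end
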